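(* Let $N\ge0$ be an integer and let $\theta=\arg\nu$. (i) Suppose $-\pi<\theta<0$ or $\pi<\theta<2\pi$. Let $\varphi^\ast$ and $\varphi^{\ast\ast}$ be the unique solutions in the interval $I_\theta$ of the equations $$\sin(\theta-2\varphi^\ast)=\frac{N}{N+3}\sin\theta,\qquad\sin(\theta-2\varphi^{\ast\ast})=\frac{N-1}{N+2}\sin\theta .$$ Then $$\left|R_N^{(H)}(\nu)\right|\le\frac{|\sec(\theta-\varphi^\ast)|}{\cos^{\frac{2N+1}{3}}\varphi^\ast}\,\frac{b_N(\nu)}{\sqrt3\pi}+\frac{|\sec(\theta-\varphi^{\ast\ast})|}{\cos^{\frac{2N+3}{3}}\varphi^{\ast\ast}}\,\frac{b_{N+1}(\nu)}{\sqrt3\pi}\quad\text{if }N\equiv0\bmod3;$$ $$\left|R_N^{(H)}(\nu)\right|\le\frac{|\sec(\theta-\varphi^\ast)|}{\cos^{\frac{2N+3}{3}}\varphi^\ast}\,\frac{b_{N+1}(\nu)}{\sqrt3\pi}\quad\text{if }N\equiv1\bmod3;$$ $$\left|R_N^{(H)}(\nu)\right|\le\frac{|\sec(\theta-\varphi^{\ast\ast})|}{\cos^{\frac{2N+1}{3}}\varphi^{\ast\ast}}\,\frac{b_N(\nu)}{\sqrt3\pi}\quad\text{if }N\equiv2\bmod3.$$ (ii) Suppose $\pi<\theta\le\frac{3\pi}{2}$ or $-\frac{\pi}{2}\le\theta<0$. Then $$\left|R_N^{(H)}(\nu)\right|\le\sqrt{\tfrac e3\left(2N+\tfrac52\right)}\,\frac{b_N(\nu)}{\sqrt3\pi}+\sqrt{\tfrac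 e3\left(2N+\tfrac92\right)}\,\frac{b_{N+1}(\nu)}{\sqrt3\pi}\quad\text{if }N\equiv0\bmod3,\ N\ge3,$$ and this remains true for $N=0$ if $\frac52$ is replaced by $\frac92$; $$\left|R_N^{(H)}(\nu)\right|\le\sqrt{\tfrac e3\left(2N+\tfrac92\right)}\,\frac{b_{N+1}(\nu)}{\sqrt3\pi}\quad\text{if }N\equiv1\bmod3;$$ $$\left|R_N^{(H)}(\nu)\right|\le\sqrt{\tfrac e3\left(2N+\tfrac52\right)}\,\frac{b_N(\nu)}{\sqrt3\pi}\quad\text{if }N\equiv2\bmod3.$$
   Context: $\nu\ne0$ is regarded as a point of the Riemann surface of the logarithm, $\nu^{1/3}=|\nu|^{1/3}e^{i\theta/3}$, and $H_\nu^{(1)}(\nu)$ is the Hankel function of the first kind with order equal to its argument, continued analytically in $\nu$ from $\nu>0$. The remainder $R_N^{(H)}(\nu)$ is defined by $$H_\nu^{(1)}(\nu)=-\frac{2}{3\pi}\sum_{n=0}^{N-1}6^{\frac{2n+1}{3}}B_{2n}(0)e^{\frac{2(2n+1)\pi i}{3}}\sin\left(\frac{(2n+1)\pi}{3}\right)\frac{\Gamma\left(\frac{2n+1}{3}\right)}{\nu^{\frac{2n+1}{3}}}+R_N^{(H)}(\nu),$$ where $B_n(0)=\frac{1}{n!}\left[\frac{d^n}{dt^n}\left(\frac16\frac{t^3}{\sinh t-t}\right)^{\frac{n+1}{3}}\right]_{t=0}$ (branch of the power equal to $1$ at $t=0$). Notation: $$b_n(\nu)=6^{\frac{2n+1}{3}}|B_{2n}(0)|\frac{\Gamma\left(\frac{2n+1}{3}\right)}{|\nu|^{\frac{2n+1}{3}}}.$$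 The interval $I_\theta$ is: $\left(-\frac{3\pi}{2}+\theta,\frac{\pi}{2}\right)$ if $\frac{3\pi}{2}\le\theta<2\pi$; $(0,-\pi+\theta)$ if $\pi<\theta<\frac{3\pi}{2}$; $\left(-\frac{\pi}{2},\frac{\pi}{2}+\theta\right)$ if $-\pi<\theta\le-\frac{\pi}{2}$; $(\theta,0)$ if $-\frac{\pi}{2}<\theta<0$. *)

theory Defs
  imports "HOL-Complex_Analysis.Complex_Analysis"
begin

(* A point of the Riemann surface of the logarithm is represented by its logarithm \<zeta> :: complex:
   its modulus is exp (Re \<zeta>), its argument is Im \<zeta> (any real number), its projection to the
   punctured plane is exp \<zeta>, and its power with exponent a is exp (a * \<zeta>). *)
definition log_point :: "real \<Rightarrow> real \<Rightarrow> complex" where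
  "log_point r \<theta> = Complex (ln r) \<theta>"

definition bessel_J :: "complex \<Rightarrow> complex \<Rightarrow> complex" where
  "bessel_J \<mu> \<zeta> = exp (\<mu> * (\<zeta> - of_real (ln 2))) *
     (\<Sum>k. (-1) ^ k / fact k * rGamma (\<mu> + of_nat k + 1) * (exp \<zeta> / 2) ^ (2 * k))"

definition hankel1_quotient :: "complex \<Rightarrow> complex \<Rightarrow> complex" where
  "hankel1_quotient \<mu> \<zeta> =
     (bessel_J (- \<mu>) \<zeta> - exp (- (of_real pi * \<i> * \<mu>)) * bessel_J \<mu> \<zeta>)
       / (\<i> * sin (of_real pi * \<mu>))"

(* At integer orders the quotient has a removable singularity in the order. *)
definition hankel1 :: "complex \<Rightarrow> complex \<Rightarrow> complex" where
  "hankel1 \<mu> \<zeta> =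
     (if \<mu> \<in> \<int> then Lim (at \<mu>) (\<lambda>\<mu>'. hankel1_quotient \<mu>' \<zeta>) else hankel1_quotient \<mu> \<zeta>)"

(* The Hankel function with order equal to its argument. That this is the analytic
   continuation from positive argument is hankel1_diag_continuation below. *)
definition hankel1_diag :: "complex \<Rightarrow> complex" where
  "hankel1_diag \<zeta> = hankel1 (exp \<zeta>) \<zeta>"

(* 1/6 t^3/(sinh t - t) with the removable singularity at t = 0 filled in; its value there is 1,
   so near 0 the principal power is the branch equal to 1 at t = 0. *)
definition B_base :: "complex \<Rightarrow> complex" where
  "B_base t = (if t = 0 then 1 else 1 / 6 * (t ^ 3 / (sinh t - t)))"

definition B0 :: "nat \<Rightarrow> complex" where
  "B0 n = (deriv ^^ n) (\<lambda>t. B_base t powr (of_nat (n + 1) / 3)) 0 / fact n"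

definition R_H :: "nat \<Rightarrow> complex \<Rightarrow> complex" where
  "R_H N \<zeta> = hankel1_diag \<zeta> -
     (- of_real (2 / (3 * pi)) *
       (\<Sum>n<N. of_real (6 powr ((2 * real n + 1) / 3)) * B0 (2 * n)
          * exp (of_real (2 * (2 * real n + 1) * pi / 3) * \<i>)
          * of_real (sin ((2 * real n + 1) * pi / 3))
          * (of_real (Gamma ((2 * real n + 1) / 3)) / exp (of_real ((2 * real n + 1) / 3) * \<zeta>))))"

definition b_term :: "nat \<Rightarrow> real \<Rightarrow> real" where
  "b_term n r = 6 powr ((2 * real n + 1) / 3) * cmod (B0 (2 * n))
     * (Gamma ((2 * real n + 1) / 3) / r powr ((2 * real n + 1) / 3))"

(* The final case is never used: the interval is only defined for the other ranges. *)
definition I_interval :: "real \<Rightarrow> real set" where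
  "I_interval \<theta> =
     (if 3 * pi / 2 \<le> \<theta> \<and> \<theta> < 2 * pi then {- (3 * pi / 2) + \<theta> <..< pi / 2}
      else if pi < \<theta> \<and> \<theta> < 3 * pi / 2 then {0 <..< - pi + \<theta>}
      else if - pi < \<theta> \<and> \<theta> \<le> - (pi / 2) then {- (pi / 2) <..< pi / 2 + \<theta>}
      else if - (pi / 2) < \<theta> \<and> \<theta> < 0 then {\<theta> <..< 0}
      else {})"

lemma norm_rGamma_shift_le:
  assumes "m \<le> k" "1 \<le> Re (z + of_nat m + 1)"
  shows "cmod (rGamma (z + of_nat k + 1)) \<le> cmod (rGamma (z + of_nat m + 1))"
  using assms(1)
proof (induction k rule: dec_induct)
  case base
  show ?case by simp
next
  case (step k)
  let ?w = "z + of_nat k + 1"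
  have "1 \<le> Re ?w"
    using assms(2) step(1) by simp
  hence w: "1 \<le> cmod ?w"
    using complex_Re_le_cmod[of ?w] by linarith
  have "1 * cmod (rGamma (?w + 1)) \<le> cmod ?w * cmod (rGamma (?w + 1))"
    by (intro mult_right_mono w) auto
  also have "\<dots> = cmod (rGamma ?w)"
    using rGamma_plus1[of ?w] by (metis norm_mult)
  finally have "cmod (rGamma (?w + 1)) \<le> cmod (rGamma (z + of_nat m + 1))"
    using step.IH by linarith
  thus ?case
    by (simp add: add_ac)
qed

lemma bessel_J_holomorphic:
  assumes S: "open S" and f: "f holomorphic_on S" and g: "g holomorphic_on S"
  shows "(\<lambda>s. bessel_J (f s) (g s)) holomorphic_on S"
proof -
  define F where "F = (\<lambda>k s. (-1) ^ k / fact k * rGamma (f s + of_nat k + 1) * (exp (g s) / 2) ^ (2 * k))"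
  have F: "F k holomorphic_on S" for k
    unfolding F_def by (intro holomorphic_intros f g) auto
  have der: "(F k has_field_derivative deriv (F k) s) (at s)" if "s \<in> S" for k s
    using holomorphic_derivI[OF F S that] .
  have "\<exists>d h. 0 < d \<and> summable h \<and> (\<forall>\<^sub>F k in sequentially. \<forall>y\<in>ball x d \<inter> S. norm (F k y) \<le> h k)"
    if x: "x \<in> S" for x
  proof -
    obtain d where d: "d > 0" "cball x d \<subseteq> S"
      using S x open_contains_cball by blast
    have bdd: "\<exists>A. \<forall>y\<in>cball x d. cmod (u y) \<le> A" if "u holomorphic_on S" for u
    proof -
      have "continuous_on (cball x d) u"
        using holomorphic_on_imp_continuous_on[OF that] continuous_on_subset d(2) by blast
      hence "compact (u ` cball x d)"
        by (intro compact_continuous_image compact_cball)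
      hence "bounded (u ` cball x d)"
        by (rule compact_imp_bounded)
      thus ?thesis
        by (simp add: bounded_iff)
    qed
    obtain A where A: "\<And>y. y \<in> cball x d \<Longrightarrow> cmod (f y) \<le> A"
      using bdd[OF f] by blast
    obtain m :: nat where m: "A \<le> real m"
      using real_arch_simple by blast
    have "(\<lambda>s. rGamma (f s + of_nat m + 1)) holomorphic_on S"
      by (intro holomorphic_intros f)
    then obtain C where C: "\<And>y. y \<in> cball x d \<Longrightarrow> cmod (rGamma (f y + of_nat m + 1)) \<le> C"
      using bdd by blast
    have "(\<lambda>s. exp (g s) / 2) holomorphic_on S"
      by (intro holomorphic_intros g) auto
    then obtain X where X: "\<And>y. y \<in> cball x d \<Longrightarrow> cmod (exp (g y) / 2) \<le> X"
      using bdd by blast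
    define h where "h = (\<lambda>k. C * (inverse (fact k) * (X\<^sup>2) ^ k))"
    have "summable h"
      unfolding h_def by (intro summable_mult summable_exp)
    moreover have "norm (F k y) \<le> h k" if k: "m \<le> k" and y: "y \<in> ball x d \<inter> S" for k y
    proof -
      have y': "y \<in> cball x d"
        using y by auto
      have "- cmod (f y) \<le> Re (f y)"
        using abs_Re_le_cmod[of "f y"] by linarith
      hence "1 \<le> Re (f y + of_nat m + 1)"
        using A[OF y'] m by simp
      hence 1: "cmod (rGamma (f y + of_nat k + 1)) \<le> C"
        using norm_rGamma_shift_le[OF k] C[OF y'] order_trans by blast
      have 2: "cmod (exp (g y) / 2) ^ (2 * k) \<le> (X\<^sup>2) ^ k"
        using power_mono[OF X[OF y'] norm_ge_zero, of "2 * k"] by (simp only: power_mult)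
      have "norm (F k y) = inverse (fact k) *
              (cmod (rGamma (f y + of_nat k + 1)) * cmod (exp (g y) / 2) ^ (2 * k))"
        unfolding F_def by (simp only: norm_mult norm_divide norm_power norm_fact) (simp add: field_simps)
      also have "\<dots> \<le> inverse (fact k) * (C * (X\<^sup>2) ^ k)"
        using 1 2 order_trans[OF norm_ge_zero 1]
        by (intro mult_left_mono mult_mono) auto
      finally show ?thesis
        by (simp add: h_def mult_ac)
    qed
    ultimately show ?thesis
      using d(1) unfolding eventually_sequentially by blast
  qed
  from series_and_derivative_comparison_local[OF S der this]
  obtain G G' where G: "\<And>s. s \<in> S \<Longrightarrow> (\<lambda>k. F k s) sums G s"
      "\<And>s. s \<in> S \<Longrightarrow> (G has_field_derivative G' s) (at s)"
    by blast
  have "G holomorphic_on S"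
    using G(2) S holomorphic_on_open by blast
  hence "(\<lambda>s. exp (f s * (g s - of_real (ln 2))) * G s) holomorphic_on S"
    by (intro holomorphic_intros f g)
  moreover have "bessel_J (f s) (g s) = exp (f s * (g s - of_real (ln 2))) * G s" if "s \<in> S" for s
    using sums_unique[OF G(1)[OF that]] unfolding bessel_J_def F_def by simp
  ultimately show ?thesis
    using holomorphic_cong by (metis (no_types, lifting))
qed

lemma sin_pi_times_eq_0_iff: "sin (of_real pi * \<mu>) = 0 \<longleftrightarrow> \<mu> \<in> \<int>" for \<mu> :: complex
proof -
  have "sin (of_real pi * \<mu>) = 0 \<longleftrightarrow> (\<exists>n::int. of_real pi * \<mu> = of_real (of_int n * pi))"
    unfolding sin_eq_0 by auto
  also have "\<dots> \<longleftrightarrow> (\<exists>n::int. \<mu> = of_int n)"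
    by (auto simp: mult.commute)
  also have "\<dots> \<longleftrightarrow> \<mu> \<in> \<int>"
    by (auto elim: Ints_cases)
  finally show ?thesis .
qed

lemma open_exp_not_Ints: "open {\<zeta>::complex. exp \<zeta> \<notin> \<int>}"
proof -
  have "open (exp -` (- \<int>) :: complex set)"
    by (intro open_vimage open_Compl closed_Ints) (auto intro!: continuous_intros)
  thus ?thesis by (simp add: vimage_def)
qed

lemma hankel1_diag_holomorphic: "hankel1_diag holomorphic_on {\<zeta>. exp \<zeta> \<notin> \<int>}"
proof -
  let ?S = "{\<zeta>::complex. exp \<zeta> \<notin> \<int>}"
  have "(\<lambda>\<zeta>. hankel1_quotient (exp \<zeta>) \<zeta>) holomorphic_on ?S"
    unfolding hankel1_quotient_def
    by (intro holomorphic_intros bessel_J_holomorphic[OF open_exp_not_Ints])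
       (auto simp: sin_pi_times_eq_0_iff)
  thus ?thesis
    by (rule holomorphic_transform) (simp add: hankel1_diag_def hankel1_def)
qed

lemma hankel1_diag_continuation:
  assumes F: "F holomorphic_on UNIV"
    and agree: "\<And>x::real. 0 < x \<Longrightarrow> F (of_real (ln x)) = hankel1 (of_real x) (of_real (ln x))"
    and \<zeta>: "exp \<zeta> \<notin> \<int>"
  shows "hankel1_diag \<zeta> = F \<zeta>"
proof -
  let ?S = "{\<zeta>::complex. exp \<zeta> \<notin> \<int>}"
  let ?U = "(of_real ` {..<(0::real)}) :: complex set"
  have eq: "hankel1_diag (of_real y) = F (of_real y)" for y :: real
    using agree[of "exp y"] by (simp add: hankel1_diag_def exp_of_real)
  have "countable (- ?S)"
  proof -
    have le: "- ?S \<subseteq> (\<Union>n::int. {\<zeta>. exp \<zeta> = of_int n})"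
      by (auto elim: Ints_cases)
    have cnt: "countable {\<zeta>::complex. exp \<zeta> = of_int n}" for n :: int
    proof (cases "\<exists>w::complex. exp w = of_int n")
      case True
      then obtain w :: complex where w: "exp w = of_int n" by blast
      have "{\<zeta>. exp \<zeta> = of_int n} \<subseteq> range (\<lambda>j::int. w + of_real (of_int (2 * j) * pi) * \<i>)"
      proof
        fix \<zeta> :: complex
        assume "\<zeta> \<in> {\<zeta>. exp \<zeta> = of_int n}"
        hence "exp \<zeta> = exp w"
          using w by simp
        then obtain j :: int where "\<zeta> = w + of_real (of_int (2 * j) * pi) * \<i>"
          unfolding exp_eq by auto
        thus "\<zeta> \<in> range (\<lambda>j::int. w + of_real (of_int (2 * j) * pi) * \<i>)"
          by blast
      qed
      thus ?thesis
        by (rule countable_subset) simp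
    next
      case False
      hence "{\<zeta>::complex. exp \<zeta> = of_int n} = {}"
        by blast
      thus ?thesis
        by simp
    qed
    show ?thesis
      by (rule countable_subset[OF le]) (simp add: cnt)
  qed
  hence "connected (UNIV - (- ?S))"
    by (intro connected_open_diff_countable) auto
  hence conn: "connected ?S"
    by (simp only: Compl_eq_Diff_UNIV[symmetric] double_compl)
  have sub: "?U \<subseteq> ?S"
  proof clarsimp
    fix y :: real
    assume y: "y < 0" and "exp (of_real y :: complex) \<in> \<int>"
    then obtain n :: int where "of_real (exp y) = (of_int n :: complex)"
      by (auto elim: Ints_cases simp: exp_of_real)
    hence "exp y = of_int n"
      by (metis of_real_eq_iff of_real_of_int_eq)
    hence "0 < real_of_int n" "real_of_int n < 1"
      using y exp_gt_zero[of y] exp_less_one_iff[of y] by metis+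
    hence "0 < n" "n < 1"
      by simp_all
    thus False
      by linarith
  qed
  have U: "of_real (-1) \<in> ?S"
    by (rule subsetD[OF sub], rule imageI) simp
  have lim: "(of_real (-1) :: complex) islimpt ?U"
    unfolding islimpt_approachable
  proof (intro allI impI)
    fix e :: real
    assume e: "0 < e"
    have "of_real (-1 - e / 2) \<in> ?U"
      using e by (intro imageI) simp
    moreover have "of_real (-1 - e / 2) \<noteq> (of_real (-1) :: complex)"
      unfolding of_real_eq_iff using e by simp
    moreover have "dist (of_real (-1 - e / 2)) (of_real (-1) :: complex) < e"
      unfolding dist_of_real using e by (simp add: dist_real_def)
    ultimately show "\<exists>x'\<in>?U. x' \<noteq> of_real (-1) \<and> dist x' (of_real (-1)) < e"
      by blast
  qed
  have hol: "(\<lambda>\<zeta>. hankel1_diag \<zeta> - F \<zeta>) holomorphic_on ?S"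
    by (intro holomorphic_on_diff hankel1_diag_holomorphic holomorphic_on_subset[OF F] subset_UNIV)
  have zero: "hankel1_diag z - F z = 0" if "z \<in> ?U" for z
    using that eq by (elim imageE) simp
  have "hankel1_diag \<zeta> - F \<zeta> = 0"
    by (rule analytic_continuation[OF hol open_exp_not_Ints conn sub U lim zero]) (use \<zeta> in simp_all)
  thus ?thesis
    by simp
qed

end

theory Submission
  imports Defs "HOL-Real_Asymp.Real_Asymp"
begin

text \<open>
  On \<open>arg \<nu> = \<pi>/2\<close> the Hankel function is \<open>1/(\<pi> i)\<close> times the sum of the two integrals of
  \<open>exp (- e\<^sup>\<zeta> (sinh s - s))\<close> over \<open>[0, \<infinity>)\<close>, continued from \<open>arg = 0\<close> to \<open>arg = \<pi>/2\<close> and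
  \<open>arg = - \<pi>/2\<close>. In the variable \<open>w = (sinh s - s)\<^sup>1\<^sup>/\<^sup>3\<close> the residue theorem writes the
  Jacobian \<open>ds/dw\<close> as \<open>2/\<pi>\<close> times the integral of \<open>\<rho>/(\<rho>\<^sup>2 + w\<^sup>2)\<close> over the preimage of the
  imaginary \<open>w\<close>-axis, on which \<open>\<rho> > 0\<close>. Expanding this geometric kernel gives the
  coefficients \<open>B\<^bsub>2n\<^esub>(0)\<close> as moments of \<open>1/\<rho>\<close> of sign \<open>(-1)\<^sup>n\<close>, and the remainder as a double
  integral whose ray of integration may be rotated by an angle \<open>\<phi>\<close>.
  Combining the two integrals so that the coefficients \<open>1 + e\<^bsub>N\<^esub>\<close> and \<open>\<omega> + e\<^bsub>N\<^esub>\<close> appear,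
  where \<open>e\<^bsub>N\<^esub> = exp ((2N+1)\<pi>i/3)\<close> (one of which vanishes unless 3 divides \<open>N\<close>) leaves the kernel \<open>1/((1 + z)(1 + \<omega> z))\<close>, bounded by
  \<open>|sec(\<theta> - \<phi>)|\<close>. The resulting estimate holds for every angle \<open>\<phi>\<close> in the
  admissible range, in particular for every point of \<open>I\<^sub>\<theta>\<close>; part (ii) evaluates it at
  \<open>\<phi> = max \<theta> (- arcsin (1 / sqrt (p + 1)))\<close> or its mirror image.
\<close>

section \<open>Parameter integrals\<close>

text \<open>The ray \<open>arg \<nu> = pi / 2\<close> is a good starting point because the order is
  purely imaginary there: it is never an integer, so \<open>hankel1\<close> is the plain quotient,
  and the Macdonald integral representing it has limits at zero that dominated convergence can
  reach. All other arguments are reached by the identity theorem. The obstacle is that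
  \<open>hankel1_diag\<close> is known to be holomorphic only where \<open>exp \<zeta>\<close> is
  not an integer, so the continuation runs through strips with countably many points removed. Taking
  moduli of the two half-line remainders separately would lose the cancellation between them; hence
  they are recombined before anything is estimated. The equations for the two angles are
  stationarity conditions of \<open>|sec(\<theta> - \<phi>)| / cos \<phi> powr p\<close>: the
  condition \<open>p tan \<phi> = tan (\<theta> - \<phi>)\<close> is equivalent to
  \<open>sin (\<theta> - 2 \<phi>) = (p - 1) / (p + 1) * sin \<theta>\<close>, and the ratios
  \<open>N / (N + 3)\<close> and \<open>(N - 1) / (N + 2)\<close> belong to
  \<open>p = (2N + 3) / 3\<close> and \<open>p = (2N + 1) / 3\<close>.\<close>

lemma has_field_derivative_lebesgue_integral:
  fixes f :: "'a \<Rightarrow> complex \<Rightarrow> complex"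
  assumes r: "r > 0"
    and hol: "\<And>x. x \<in> space M \<Longrightarrow> f x holomorphic_on ball z0 r"
    and meas: "\<And>z. z \<in> ball z0 r \<Longrightarrow> (\<lambda>x. f x z) \<in> borel_measurable M"
    and h: "integrable M h"
    and bound: "\<And>x z. x \<in> space M \<Longrightarrow> z \<in> ball z0 r \<Longrightarrow> norm (f x z) \<le> h x"
  shows "((\<lambda>z. \<integral>x. f x z \<partial>M) has_field_derivative (\<integral>x. deriv (f x) z0 \<partial>M)) (at z0)"
proof -
  \<comment> \<open>Cauchy's inequality on circles of radius \<open>r/4\<close>, which stay inside
    the large ball as long as \<open>z\<close> is in the half-size one. Thus a majorant of
    \<open>f\<close> alone controls the derivative and, by the mean value inequality, the difference
    quotients.\<close>
  have bd: "norm (deriv (f x) z) \<le> 4 * h x / r"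
    if "x \<in> space M" "z \<in> ball z0 (r/2)" for x z
  proof -
    have sub: "cball z (r/4) \<subseteq> ball z0 r"
    proof
      fix y assume "y \<in> cball z (r/4)"
      with that(2) r have "dist z0 z < r/2" "dist z y \<le> r/4" by auto
      with dist_triangle[of z0 y z] r show "y \<in> ball z0 r" by auto
    qed
    have "norm ((deriv ^^ 1) (f x) z) \<le> fact 1 * h x / (r/4) ^ 1"
    proof (rule Cauchy_inequality)
      show "f x holomorphic_on ball z (r/4)"
        using hol[OF that(1)] sub by (meson ball_subset_cball holomorphic_on_subset order_trans)
      show "continuous_on (cball z (r/4)) (f x)"
        using hol[OF that(1)] sub holomorphic_on_imp_continuous_on continuous_on_subset by blast
      show "norm (f x y) \<le> h x" if "norm (z - y) = r/4" for y
        using bound[OF \<open>x \<in> space M\<close>, of y] sub that by (auto simp: dist_norm subset_iff)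
    qed (use r in auto)
    thus ?thesis by (simp add: mult.commute)
  qed
  have quot: "norm ((f x z - f x z0) / (z - z0)) \<le> 4 * h x / r"
    if x: "x \<in> space M" and z: "z \<in> ball z0 (r/2)" "z \<noteq> z0" for x z
  proof -
    have "norm (f x z - f x z0) \<le> 4 * h x / r * norm (z - z0)"
    proof (rule field_differentiable_bound[where S = "ball z0 (r/2)"])
      fix y assume y: "y \<in> ball z0 (r/2)"
      hence "y \<in> ball z0 r" using r by auto
      thus "(f x has_field_derivative deriv (f x) y) (at y within ball z0 (r/2))"
        using hol[OF x] by (meson at_within_open has_field_derivative_at_within holomorphic_derivI open_ball)
      show "norm (deriv (f x) y) \<le> 4 * h x / r" by (rule bd[OF x y])
    qed (use z r in auto)
    thus ?thesis using z(2) by (simp add: norm_divide pos_divide_le_eq)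
  qed
  have lim: "((\<lambda>z. (f x z - f x z0) / (z - z0)) \<longlongrightarrow> deriv (f x) z0) (at z0)" if "x \<in> space M" for x
    using holomorphic_derivI[OF hol[OF that] open_ball, of z0] r
    by (simp add: has_field_derivative_iff)
  have int: "integrable M (\<lambda>x. f x z)" if "z \<in> ball z0 r" for z
  proof (rule Bochner_Integration.integrable_bound[OF h meas[OF that]], rule AE_I2)
    fix x assume "x \<in> space M"
    from bound[OF this that] show "norm (f x z) \<le> norm (h x)" by simp
  qed
  show ?thesis
    unfolding has_field_derivative_iff tendsto_at_iff_sequentially comp_def
  proof (intro allI impI)
    fix X assume X: "\<forall>i. X i \<in> UNIV - {z0}" "X \<longlonglongrightarrow> z0"
    \<comment> \<open>Dominated convergence works along sequences, and its majorant is valid only in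
      the half-size ball; so the first \<open>n0\<close> terms are dropped.\<close>
    have "eventually (\<lambda>i. X i \<in> ball z0 (r/2)) sequentially"
      using X(2) r by (intro topological_tendstoD) auto
    then obtain n0 where n0: "\<And>i. i \<ge> n0 \<Longrightarrow> X i \<in> ball z0 (r/2)"
      by (auto simp: eventually_sequentially)
    let ?Y = "\<lambda>i. X (i + n0)"
    have Y: "?Y i \<in> ball z0 (r/2)" "?Y i \<noteq> z0" for i
      using n0 X(1) by auto
    have Y': "?Y i \<in> ball z0 r" for i
      using Y(1)[of i] r by auto
    have Ylim: "?Y \<longlonglongrightarrow> z0" using X(2) by (rule LIMSEQ_ignore_initial_segment)
    have fm: "(\<lambda>x. (f x (?Y i) - f x z0) / (?Y i - z0)) \<in> borel_measurable M" for i
      using meas[OF Y'[of i]] meas[of z0] r by (intro borel_measurable_divide borel_measurable_diff) auto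
    have fl: "(\<lambda>i. (f x (?Y i) - f x z0) / (?Y i - z0)) \<longlonglongrightarrow> deriv (f x) z0" if "x \<in> space M" for x
      by (rule lim[OF that, unfolded tendsto_at_iff_sequentially comp_def, rule_format])
         (use Y(2) Ylim in auto)
    have "(\<lambda>i. \<integral>x. (f x (?Y i) - f x z0) / (?Y i - z0) \<partial>M) \<longlonglongrightarrow> (\<integral>x. deriv (f x) z0 \<partial>M)"
    proof (rule integral_dominated_convergence[where w = "\<lambda>x. 4 * h x / r"])
      show "(\<lambda>x. deriv (f x) z0) \<in> borel_measurable M"
        by (rule borel_measurable_LIMSEQ_metric[OF fm fl])
    qed (use fm fl quot Y h in auto)
    also have "(\<lambda>i. \<integral>x. (f x (?Y i) - f x z0) / (?Y i - z0) \<partial>M) =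
        (\<lambda>i. ((\<integral>x. f x (?Y i) \<partial>M) - (\<integral>x. f x z0 \<partial>M)) / (?Y i - z0))"
      using int[OF Y'] int[of z0] r by (simp add: Bochner_Integration.integral_diff)
    finally show "(\<lambda>i. ((\<integral>x. f x (X i) \<partial>M) - (\<integral>x. f x z0 \<partial>M)) / (X i - z0)) \<longlonglongrightarrow> (\<integral>x. deriv (f x) z0 \<partial>M)"
      by (rule LIMSEQ_offset)
  qed
qed

lemma set_lebesgue_integral_has_field_derivative:
  fixes f :: "'a \<Rightarrow> complex \<Rightarrow> complex"
  assumes A: "A \<in> sets M" and r: "r > 0"
    and hol: "\<And>x. x \<in> A \<Longrightarrow> f x holomorphic_on ball z0 r"
    and meas: "\<And>z. z \<in> ball z0 r \<Longrightarrow> set_borel_measurable M A (\<lambda>x. f x z)"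
    and h: "set_integrable M A h"
    and bound: "\<And>x z. x \<in> A \<Longrightarrow> z \<in> ball z0 r \<Longrightarrow> norm (f x z) \<le> h x"
  shows "((\<lambda>z. LINT x:A|M. f x z) has_field_derivative (LINT x:A|M. deriv (f x) z0)) (at z0)"
proof -
  have A': "A \<inter> space M \<in> sets M" using A by auto
  have "((\<lambda>z. \<integral>x. f x z \<partial>restrict_space M A) has_field_derivative
          (\<integral>x. deriv (f x) z0 \<partial>restrict_space M A)) (at z0)"
  proof (rule has_field_derivative_lebesgue_integral[OF r])
    show "integrable (restrict_space M A) h"
      using h A' by (simp add: integrable_restrict_space set_integrable_def)
    show "(\<lambda>x. f x z) \<in> borel_measurable (restrict_space M A)" if "z \<in> ball z0 r" for z
      using meas[OF that] A' by (simp add: borel_measurable_restrict_space_iff set_borel_measurable_def)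
  qed (use hol bound in \<open>auto simp: space_restrict_space\<close>)
  thus ?thesis
    using A' by (simp add: integral_restrict_space set_lebesgue_integral_def)
qed

lemma set_lebesgue_integral_holomorphic:
  fixes f :: "'a \<Rightarrow> complex \<Rightarrow> complex"
  assumes A: "A \<in> sets M" and S: "open S"
    and hol: "\<And>x. x \<in> A \<Longrightarrow> f x holomorphic_on S"
    and meas: "\<And>z. z \<in> S \<Longrightarrow> set_borel_measurable M A (\<lambda>x. f x z)"
    and dom: "\<And>z0. z0 \<in> S \<Longrightarrow> \<exists>r h. r > 0 \<and> set_integrable M A h \<and>
                (\<forall>x\<in>A. \<forall>z\<in>ball z0 r \<inter> S. norm (f x z) \<le> h x)"
  shows "(\<lambda>z. LINT x:A|M. f x z) holomorphic_on S"
  unfolding holomorphic_on_open[OF S]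
proof
  fix z0 assume z0: "z0 \<in> S"
  obtain r h where r: "r > 0" "set_integrable M A h"
      and h: "\<And>x z. x \<in> A \<Longrightarrow> z \<in> ball z0 r \<inter> S \<Longrightarrow> norm (f x z) \<le> h x"
    using dom[OF z0] by blast
  obtain e where e: "e > 0" "ball z0 e \<subseteq> S" using S z0 open_contains_ball by blast
  have sub: "ball z0 (min r e) \<subseteq> ball z0 r \<inter> S" using e by auto
  show "\<exists>f'. ((\<lambda>z. LINT x:A|M. f x z) has_field_derivative f') (at z0)"
  proof (rule exI, rule set_lebesgue_integral_has_field_derivative[OF A, where r = "min r e" and h = h])
    show "f x holomorphic_on ball z0 (min r e)" if "x \<in> A" for x
      using hol[OF that] sub holomorphic_on_subset by blast
  qed (use r e h sub meas in auto)
qed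

lemma set_borel_measurable_continuous_on:
  fixes f :: "'a::euclidean_space \<Rightarrow> 'b::real_normed_vector"
  assumes "A \<in> sets borel" "continuous_on A f"
  shows "set_borel_measurable lborel A f"
  using borel_measurable_continuous_on_indicator[OF assms] by (simp add: set_borel_measurable_def)

text \<open>Bridge from gauge integrals to \<open>lborel\<close>: nonnegativity makes the gauge
  integral absolute, and continuity supplies the Borel measurability needed to leave the completed
  measure.\<close>

lemma set_integrable_lborel_nonneg:
  fixes f :: "'a::euclidean_space \<Rightarrow> real"
  assumes "A \<in> sets borel" "continuous_on A f" "(f has_integral I) A" "\<And>x. x \<in> A \<Longrightarrow> 0 \<le> f x"
  shows "set_integrable lborel A f" "(LINT x:A|lborel. f x) = I"
proof -
  have "f absolutely_integrable_on A"
    using assms(3,4) by (intro nonnegative_absolutely_integrable_1) auto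
  moreover have m: "(\<lambda>x. indicator A x *\<^sub>R f x) \<in> borel_measurable lborel"
    using set_borel_measurable_continuous_on[OF assms(1,2)] by (simp add: set_borel_measurable_def)
  ultimately show i: "set_integrable lborel A f"
    unfolding set_integrable_def using integrable_completion[OF m] by simp
  show "(LINT x:A|lborel. f x) = I"
    using set_borel_integral_eq_integral(2)[OF i] assms(3) by (simp add: integral_unique)
qed

lemma set_integrable_exp_decay:
  fixes f :: "real \<Rightarrow> 'b::{banach, second_countable_topology}"
  assumes "A \<in> sets borel" "A \<subseteq> {a..}" "continuous_on A f" "c > 0"
    and "\<And>x. x \<in> A \<Longrightarrow> norm (f x) \<le> C * exp (- c * x)"
  shows "set_integrable lborel A f"
proof -
  have "set_integrable lborel {a..} (\<lambda>x. exp (- c * x))"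
    by (rule set_integrable_lborel_nonneg(1)[OF _ _ has_integral_exp_minus_to_infinity])
       (use assms in \<open>auto intro!: continuous_intros\<close>)
  hence "set_integrable lborel {a..} (\<lambda>x. C * exp (- c * x))"
    by (intro set_integrable_mult_right)
  hence "set_integrable lborel A (\<lambda>x. C * exp (- c * x))"
    by (rule set_integrable_subset) (use assms in auto)
  thus ?thesis
    by (rule set_integrable_bound)
       (use assms in \<open>auto intro!: AE_I2 set_borel_measurable_continuous_on intro: order_trans[OF _ abs_ge_self]\<close>)
qed

lemma integrable_exp_minus_abs: "integrable lborel (\<lambda>x::real. exp (- \<bar>x\<bar>))"
proof -
  have 1: "set_integrable lborel {0..} (\<lambda>x::real. exp (- 1 * x))"
    by (rule set_integrable_exp_decay[where a = 0 and c = 1 and C = 1]) (auto intro!: continuous_intros)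
  let ?g = "\<lambda>x::real. indicator {0..} x *\<^sub>R exp (- 1 * x)"
  have g: "integrable lborel ?g" using 1 by (simp add: set_integrable_def)
  hence "integrable lborel (\<lambda>x. ?g (0 + (-1) * x))"
    by (rule lborel_integrable_real_affine) simp
  hence "integrable lborel (\<lambda>x. ?g x + ?g (0 + (-1) * x))"
    using g by (intro Bochner_Integration.integrable_add)
  thus ?thesis
    by (rule Bochner_Integration.integrable_bound) (auto intro!: AE_I2 simp: indicator_def)
qed

lemma integrable_exp_decay:
  fixes f :: "real \<Rightarrow> 'b::{banach, second_countable_topology}"
  assumes "continuous_on UNIV f" and "\<And>x. norm (f x) \<le> C * exp (- \<bar>x\<bar>)"
  shows "integrable lborel f"
proof (rule Bochner_Integration.integrable_bound)
  show "integrable lborel (\<lambda>x::real. C * exp (- \<bar>x\<bar>))"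
    using integrable_exp_minus_abs by simp
  show "f \<in> borel_measurable lborel"
    using assms(1) by (simp add: borel_measurable_continuous_onI)
qed (use assms(2) in \<open>auto intro!: AE_I2 intro: order_trans[OF _ abs_ge_self]\<close>)

section \<open>The cube root of \<open>sinh t - t\<close>\<close>

lemma sinh_Complex: "sinh (Complex x y) = Complex (sinh x * cos y) (cosh x * sin y)"
proof -
  have "exp (Complex x y) = Complex (exp x * cos y) (exp x * sin y)"
       "exp (- Complex x y) = Complex (exp (- x) * cos y) (- exp (- x) * sin y)"
    by (simp_all add: complex_eq_iff Re_exp Im_exp)
  thus ?thesis
    by (simp add: sinh_field_def cosh_field_def complex_eq_iff Re_divide Im_divide power2_eq_square)
       (simp add: sinh_field_def cosh_field_def algebra_simps add_divide_distrib diff_divide_distrib)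
qed

text \<open>Phase function of the Hankel integral when order and argument agree: the two saddle
  points have merged into a triple zero at the origin, which is why cube roots appear
  everywhere.\<close>

definition sinh_defect :: "complex \<Rightarrow> complex" where "sinh_defect t = sinh t - t"

lemma Re_sinh_defect: "Re (sinh_defect t) = sinh (Re t) * cos (Im t) - Re t"
  and Im_sinh_defect: "Im (sinh_defect t) = cosh (Re t) * sin (Im t) - Im t"
  using sinh_Complex[of "Re t" "Im t"] by (simp_all add: sinh_defect_def)

lemma sinh_defect_minus: "sinh_defect (- t) = - sinh_defect t" by (simp add: sinh_defect_def)

lemma sinh_defect_cnj: "sinh_defect (cnj t) = cnj (sinh_defect t)"
  by (simp add: complex_eq_iff Re_sinh_defect Im_sinh_defect)

lemma sinh_defect_of_real: "sinh_defect (of_real x) = of_real (sinh x - x)"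
  by (simp add: complex_eq_iff Re_sinh_defect Im_sinh_defect)

lemma mult_cos_less_sin:
  assumes "0 < y" "y < pi"
  shows "y * cos y < sin (y::real)"
proof -
  have "sin 0 - 0 * cos 0 < sin y - y * cos (y::real)"
  proof (rule DERIV_pos_imp_increasing_open[OF assms(1)])
    fix x assume x: "0 < x" "x < y"
    have "((\<lambda>y. sin y - y * cos y) has_real_derivative x * sin x) (at x)"
      by (auto intro!: derivative_eq_intros)
    moreover have "x * sin x > 0" using x assms sin_gt_zero by auto
    ultimately show "\<exists>z. ((\<lambda>y. sin y - y * cos y) has_real_derivative z) (at x) \<and> z > 0" by blast
  qed (auto intro!: continuous_intros)
  thus ?thesis by simp
qed

lemma sinh_less_mult_cosh:
  assumes "0 < x"
  shows "sinh x < x * cosh (x::real)"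
proof -
  have "0 * cosh 0 - sinh 0 < x * cosh x - sinh (x::real)"
  proof (rule DERIV_pos_imp_increasing_open[OF assms(1)])
    fix y assume x: "0 < y" "y < x"
    have "((\<lambda>y. y * cosh y - sinh y) has_real_derivative y * sinh y) (at y)"
      by (auto intro!: derivative_eq_intros)
    moreover have "y * sinh y > 0" using x by auto
    ultimately show "\<exists>z. ((\<lambda>y. y * cosh y - sinh y) has_real_derivative z) (at y) \<and> z > 0" by blast
  qed (auto intro!: continuous_intros)
  thus ?thesis by simp
qed

lemma sinh_gt_self:
  assumes "0 < x"
  shows "x < sinh (x::real)"
proof -
  have "sinh 0 - 0 < sinh x - (x::real)"
  proof (rule DERIV_pos_imp_increasing_open[OF assms(1)])
    fix y assume x: "0 < y" "y < x"
    have "((\<lambda>y. sinh y - y) has_real_derivative cosh y - 1) (at y)"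
      by (auto intro!: derivative_eq_intros)
    moreover have "cosh y - 1 > 0" using x cosh_real_nonneg_less_iff[of 0 y] by simp
    ultimately show "\<exists>z. ((\<lambda>y. sinh y - y) has_real_derivative z) (at y) \<and> z > 0" by blast
  qed (auto intro!: continuous_intros)
  thus ?thesis by simp
qed

lemma sin_less_self:
  assumes "0 < x"
  shows "sin x < (x::real)"
proof (cases "x < pi")
  case True
  have "0 - sin 0 < x - sin (x::real)"
  proof (rule DERIV_pos_imp_increasing_open[OF assms(1)])
    fix y assume x: "0 < y" "y < x"
    have "((\<lambda>y. y - sin y) has_real_derivative 1 - cos y) (at y)"
      by (auto intro!: derivative_eq_intros)
    moreover have "1 - cos y > 0" using x True cos_monotone_0_pi[of 0 y] by simp
    ultimately show "\<exists>z. ((\<lambda>y. y - sin y) has_real_derivative z) (at y) \<and> z > 0" by blast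
  qed (auto intro!: continuous_intros)
  thus ?thesis by simp
next
  case False
  thus ?thesis using sin_le_one[of x] pi_gt3 by linarith
qed

text \<open>A nonnegative value at \<open>x + \<i> y\<close> would force
  \<open>cosh x * sin y = y\<close> and \<open>sinh x * cos y \<ge> x\<close>. With
  \<open>y cos y < sin y\<close> the first gives \<open>cosh x * cos y < 1\<close>, and then
  \<open>sinh x < x cosh x\<close> contradicts the second. This keeps the principal logarithm of
  \<open>- sinh_defect\<close> off its cut on a quarter of the strip.\<close>

lemma sinh_defect_notin_nonneg:
  assumes "0 \<le> Re t" "0 < Im t" "Im t < 2 * pi"
  shows "- sinh_defect t \<notin> \<real>\<^sub>\<le>\<^sub>0"
proof
  assume "- sinh_defect t \<in> \<real>\<^sub>\<le>\<^sub>0"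
  define x y where "x = Re t" and "y = Im t"
  have im: "cosh x * sin y = y" and re: "sinh x * cos y \<ge> x"
    using \<open>- sinh_defect t \<in> \<real>\<^sub>\<le>\<^sub>0\<close> by (auto simp: complex_nonpos_Reals_iff Re_sinh_defect Im_sinh_defect x_def y_def)
  have y: "0 < y" "y < 2 * pi" and x: "0 \<le> x" using assms by (auto simp: x_def y_def)
  have "sin y > 0" using im y(1) by (metis cosh_real_pos zero_less_mult_pos)
  hence ypi: "y < pi" using y sin_lt_zero[of y] sin_pi by (cases y pi rule: linorder_cases) auto
  show False
  proof (cases "x = 0")
    case True
    thus False using im sin_less_self[OF y(1)] by simp
  next
    case False
    hence x: "x > 0" using x by simp
    have "y * cos y * cosh x < sin y * cosh x"
      using mult_cos_less_sin[OF y(1) ypi] by simp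
    hence "y * (cos y * cosh x) < y * 1" using im by (simp add: mult_ac)
    hence c: "cos y * cosh x < 1" using y(1) by (metis mult_less_cancel_left_pos)
    have "0 < sinh x * cos y" using re x by linarith
    hence cpos: "cos y > 0" using x by (simp add: zero_less_mult_iff)
    have "sinh x * cos y < x * cosh x * cos y"
      using sinh_less_mult_cosh[OF x] cpos by simp
    also have "\<dots> = x * (cos y * cosh x)" by simp
    also have "\<dots> < x * 1" using c x by simp
    finally show False using re by simp
  qed
qed

text \<open>High enough to contain the curve on which the cube root is purely imaginary, low enough
  that the origin is the only zero of \<open>sinh t - t\<close>.\<close>

definition strip :: "complex set" where "strip = {t. \<bar>Im t\<bar> < 2 * pi}"

lemma strip_props: "convex strip" "open strip" "0 \<in> strip" "of_real x \<in> strip"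
proof -
  have eq: "strip = {t. Im t < 2 * pi} \<inter> {t. Im t > - (2 * pi)}" by (auto simp: strip_def)
  show "convex strip" unfolding eq by (intro convex_Int convex_halfspace_Im_lt convex_halfspace_Im_gt)
  show "open strip" unfolding eq by (intro open_Int open_halfspace_Im_lt open_halfspace_Im_gt)
qed (auto simp: strip_def)

text \<open>Oddness and conjugation symmetry reduce nonreal points to the quarter strip with
  \<open>Re t \<ge> 0\<close> and \<open>Im t > 0\<close>.\<close>

lemma sinh_defect_nonzero:
  assumes "t \<in> strip" "t \<noteq> 0"
  shows "sinh_defect t \<noteq> 0"
proof -
  have 1: "sinh_defect t \<noteq> 0" if "0 < Im t" "Im t < 2 * pi" "0 \<le> Re t" for t
    using sinh_defect_notin_nonneg[of t] that by auto
  have 2: "sinh_defect t \<noteq> 0" if "0 < Im t" "Im t < 2 * pi" for t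
  proof (cases "0 \<le> Re t")
    case False
    have "sinh_defect (- cnj t) \<noteq> 0" using that False by (intro 1) auto
    thus ?thesis by (simp add: sinh_defect_minus sinh_defect_cnj)
  qed (use 1 that in auto)
  consider (pos) "Im t > 0" | (neg) "Im t < 0" | (zero) "Im t = 0" by linarith
  thus ?thesis
  proof cases
    case pos thus ?thesis using 2 assms by (auto simp: strip_def)
  next
    case neg
    have "sinh_defect (- t) \<noteq> 0" using neg assms by (intro 2) (auto simp: strip_def)
    thus ?thesis by (simp add: sinh_defect_minus)
  next
    case zero
    hence t: "t = of_real (Re t)" by (simp add: complex_eq_iff)
    have "Re t > 0 \<or> - Re t > 0" using assms(2) zero by (auto simp: complex_eq_iff)
    hence "sinh (Re t) \<noteq> Re t" using sinh_gt_self[of "Re t"] sinh_gt_self[of "- Re t"] by auto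
    thus ?thesis by (subst t, subst sinh_defect_of_real) (simp add: complex_eq_iff)
  qed
qed

text \<open>Reciprocal of \<open>B_base\<close>: the triple zero is divided out and the value at the
  origin is normalised to 1.\<close>

definition sinh_defect_quot :: "complex \<Rightarrow> complex" where "sinh_defect_quot t = (if t = 0 then 1 else 6 * sinh_defect t / t ^ 3)"

lemma sinh_defect_quot_holomorphic: "sinh_defect_quot holomorphic_on UNIV"
proof -
  \<comment> \<open>Taylor series of \<open>sinh\<close> shifted by three places: odd powers
    \<open>n + 3\<close> are those with \<open>n\<close> even.\<close>
  define a :: "nat \<Rightarrow> complex" where "a = (\<lambda>n. if even n then 6 / fact (n + 3) else 0)"
  have a: "(\<lambda>n. a n * t ^ n) sums sinh_defect_quot t" for t
  proof (cases "t = 0")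
    case True
    have "(\<lambda>n. a n * 0 ^ n) sums a 0" by (rule powser_sums_zero)
    thus ?thesis using True by (simp add: sinh_defect_quot_def a_def fact_numeral)
  next
    case False
    let ?f = "\<lambda>n. if even n then 0 else t ^ n /\<^sub>R fact n"
    have "(\<lambda>n. ?f (n + 3)) sums (sinh t - (\<Sum>n<3. ?f n))"
      by (rule sums_split_initial_segment[OF sinh_converges])
    moreover have "(\<Sum>n<3. ?f n) = t" by (simp add: numeral_3_eq_3)
    ultimately have "(\<lambda>n. 6 / t ^ 3 * ?f (n + 3)) sums (6 / t ^ 3 * (sinh t - t))"
      by (intro sums_mult) simp
    moreover have "6 / t ^ 3 * ?f (n + 3) = a n * t ^ n" for n
      using False by (simp add: a_def scaleR_conv_of_real power_add field_simps)
    ultimately show ?thesis using False by (simp add: sinh_defect_quot_def sinh_defect_def)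
  qed
  have "((\<lambda>t. \<Sum>n. a n * t ^ n) has_field_derivative (\<Sum>n. diffs a n * t ^ n)) (at t)" for t
    by (rule termdiffs_strong_converges_everywhere) (use a sums_summable in blast)
  moreover have "(\<lambda>t. \<Sum>n. a n * t ^ n) = sinh_defect_quot" using sums_unique[OF a] by auto
  ultimately show ?thesis by (auto simp: holomorphic_on_open)
qed

lemma sinh_defect_quot_nonzero: "t \<in> strip \<Longrightarrow> sinh_defect_quot t \<noteq> 0"
  using sinh_defect_nonzero by (simp add: sinh_defect_quot_def)

lemma sinh_defect_eq_sinh_defect_quot: "sinh_defect t = t ^ 3 * sinh_defect_quot t / 6"
  by (simp add: sinh_defect_quot_def sinh_defect_def)

text \<open>Distinct values of the difference are at least \<open>2 pi\<close> apart, and a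
  continuous function with discrete range on a connected set is constant.\<close>

lemma continuous_logs_differ_constant:
  assumes "connected T" "continuous_on T f" "continuous_on T g"
    and eq: "\<And>t. t \<in> T \<Longrightarrow> exp (f t) = exp (g t :: complex)"
  shows "(\<lambda>t. f t - g t) constant_on T"
proof (rule continuous_discrete_range_constant[OF assms(1)])
  show "continuous_on T (\<lambda>t. f t - g t)" by (intro continuous_intros assms)
  fix x assume x: "x \<in> T"
  have "2 * pi \<le> norm ((f y - g y) - (f x - g x))" if y: "y \<in> T" "f y - g y \<noteq> f x - g x" for y
  proof -
    obtain m n :: int where m: "f x = g x + of_real (of_int (2 * m) * pi) * \<i>"
        and n: "f y = g y + of_real (of_int (2 * n) * pi) * \<i>"
      using eq[OF x] eq[OF y(1)] unfolding exp_eq by (auto simp: mult.commute)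
    have e: "(f y - g y) - (f x - g x) = of_real (2 * pi * of_int (n - m)) * \<i>"
      unfolding m n by (simp add: algebra_simps)
    have "n \<noteq> m" using y(2) unfolding m n by auto
    hence "(1::real) \<le> \<bar>of_int (n - m)\<bar>" by (metis of_int_1_le_iff of_int_abs int_one_le_iff_zero_less zero_less_abs_iff right_minus_eq)
    thus ?thesis unfolding e norm_mult norm_of_real by (simp add: abs_mult)
  qed
  thus "\<exists>e>0. \<forall>y. y \<in> T \<and> f y - g y \<noteq> f x - g x \<longrightarrow> e \<le> norm (f y - g y - (f x - g x))"
    by (intro exI[of _ "2 * pi"]) auto
qed

text \<open>Such a logarithm exists because the strip is convex and the quotient has no zero in it;
  the value at the origin fixes the branch, so that symmetries of the quotient pass to the logarithm
  by uniqueness.\<close>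

definition ln_sinh_defect_quot :: "complex \<Rightarrow> complex" where
  "ln_sinh_defect_quot = (SOME L. L holomorphic_on strip \<and> (\<forall>t\<in>strip. exp (L t) = sinh_defect_quot t) \<and> L 0 = 0)"

lemma ln_sinh_defect_quot_holomorphic: "ln_sinh_defect_quot holomorphic_on strip"
  and exp_ln_sinh_defect_quot: "t \<in> strip \<Longrightarrow> exp (ln_sinh_defect_quot t) = sinh_defect_quot t"
  and ln_sinh_defect_quot_0 [simp]: "ln_sinh_defect_quot 0 = 0"
proof -
  have "contractible strip" using strip_props(1) by (rule convex_imp_contractible)
  then obtain g where g: "g holomorphic_on strip" "\<And>t. t \<in> strip \<Longrightarrow> sinh_defect_quot t = exp (g t)"
    using contractible_imp_holomorphic_log[of sinh_defect_quot strip] sinh_defect_quot_holomorphic sinh_defect_quot_nonzero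
    by (metis holomorphic_on_subset subset_UNIV)
  have g0: "exp (g 0) = 1" using g(2)[of 0] strip_props(3) by (simp add: sinh_defect_quot_def)
  have "\<exists>L. L holomorphic_on strip \<and> (\<forall>t\<in>strip. exp (L t) = sinh_defect_quot t) \<and> L 0 = 0"
    by (rule exI[of _ "\<lambda>t. g t - g 0"]) (use g g0 in \<open>auto intro!: holomorphic_intros simp: exp_diff\<close>)
  from someI_ex[OF this] show "ln_sinh_defect_quot holomorphic_on strip" "t \<in> strip \<Longrightarrow> exp (ln_sinh_defect_quot t) = sinh_defect_quot t" "ln_sinh_defect_quot 0 = 0"
    unfolding ln_sinh_defect_quot_def by auto
qed

lemma ln_sinh_defect_quot_unique:
  assumes "continuous_on strip f" "\<And>t. t \<in> strip \<Longrightarrow> exp (f t) = sinh_defect_quot t" "f 0 = 0" "t \<in> strip"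
  shows "f t = ln_sinh_defect_quot t"
proof -
  have "(\<lambda>t. f t - ln_sinh_defect_quot t) constant_on strip"
    by (rule continuous_logs_differ_constant)
       (use assms exp_ln_sinh_defect_quot ln_sinh_defect_quot_holomorphic strip_props convex_connected holomorphic_on_imp_continuous_on in auto)
  then obtain c where "\<And>t. t \<in> strip \<Longrightarrow> f t - ln_sinh_defect_quot t = c" by (auto simp: constant_on_def)
  from this[of t] this[of 0] assms strip_props show ?thesis by simp
qed

lemma ln_sinh_defect_quot_minus: "t \<in> strip \<Longrightarrow> ln_sinh_defect_quot (- t) = ln_sinh_defect_quot t"
proof (rule ln_sinh_defect_quot_unique[where f = "\<lambda>t. ln_sinh_defect_quot (- t)"])
  show "continuous_on strip (\<lambda>t. ln_sinh_defect_quot (- t))"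
    by (rule continuous_on_compose2[OF holomorphic_on_imp_continuous_on[OF ln_sinh_defect_quot_holomorphic]])
       (auto intro!: continuous_intros simp: strip_def)
  show "exp (ln_sinh_defect_quot (- t)) = sinh_defect_quot t" if "t \<in> strip" for t
    using exp_ln_sinh_defect_quot[of "- t"] that by (simp add: strip_def sinh_defect_quot_def sinh_defect_minus)
qed auto

lemma ln_sinh_defect_quot_cnj: "t \<in> strip \<Longrightarrow> ln_sinh_defect_quot (cnj t) = cnj (ln_sinh_defect_quot t)"
proof -
  assume t: "t \<in> strip"
  have "cnj (ln_sinh_defect_quot (cnj t)) = ln_sinh_defect_quot t"
  proof (rule ln_sinh_defect_quot_unique[where f = "\<lambda>t. cnj (ln_sinh_defect_quot (cnj t))", OF _ _ _ t])
    show "continuous_on strip (\<lambda>t. cnj (ln_sinh_defect_quot (cnj t)))"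
      by (intro continuous_intros continuous_on_compose2[OF holomorphic_on_imp_continuous_on[OF ln_sinh_defect_quot_holomorphic]])
         (auto simp: strip_def)
    show "exp (cnj (ln_sinh_defect_quot (cnj t))) = sinh_defect_quot t" if "t \<in> strip" for t
      using exp_ln_sinh_defect_quot[of "cnj t"] that by (simp add: strip_def sinh_defect_quot_def sinh_defect_cnj exp_cnj[symmetric])
  qed auto
  thus ?thesis by (metis complex_cnj_cnj)
qed

text \<open>Holomorphic cube root of \<open>sinh t - t\<close>, normalised to be positive on the positive real axis.\<close>
definition cbrt_sinh :: "complex \<Rightarrow> complex" where "cbrt_sinh t = t * exp (ln_sinh_defect_quot t / 3) / of_real (root 3 6)"

lemma root_3_6 [simp]: "root 3 6 > 0" "root 3 6 ^ 3 = 6" "complex_of_real (root 3 6) ^ 3 = 6" "root 3 6 \<noteq> 0"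
proof -
  show "root 3 6 ^ 3 = 6" by simp
  hence "complex_of_real (root 3 6 ^ 3) = of_real 6" by simp
  thus "complex_of_real (root 3 6) ^ 3 = 6" by (simp only: of_real_power of_real_numeral)
qed auto

lemma cbrt_sinh_holomorphic: "cbrt_sinh holomorphic_on strip"
  unfolding cbrt_sinh_def[abs_def] by (intro holomorphic_intros ln_sinh_defect_quot_holomorphic) auto

lemma cbrt_sinh_cubed: "t \<in> strip \<Longrightarrow> cbrt_sinh t ^ 3 = sinh_defect t"
proof -
  assume t: "t \<in> strip"
  have "exp (ln_sinh_defect_quot t / 3) ^ 3 = sinh_defect_quot t" using exp_ln_sinh_defect_quot[OF t] by (simp add: exp_of_nat_mult[symmetric])
  thus ?thesis by (simp add: cbrt_sinh_def power_divide power_mult_distrib sinh_defect_eq_sinh_defect_quot)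
qed

lemma cbrt_sinh_minus: "t \<in> strip \<Longrightarrow> cbrt_sinh (- t) = - cbrt_sinh t" by (simp add: cbrt_sinh_def ln_sinh_defect_quot_minus)

lemma cbrt_sinh_cnj: "t \<in> strip \<Longrightarrow> cbrt_sinh (cnj t) = cnj (cbrt_sinh t)" by (simp add: cbrt_sinh_def ln_sinh_defect_quot_cnj exp_cnj)

lemma cbrt_sinh_0 [simp]: "cbrt_sinh 0 = 0" by (simp add: cbrt_sinh_def)

lemma cbrt_sinh_of_real: "cbrt_sinh (of_real x) = of_real (root 3 (sinh x - x))"
proof -
  have "cnj (cbrt_sinh (of_real x)) = cbrt_sinh (of_real x)" using cbrt_sinh_cnj[of "of_real x"] strip_props(4) by simp
  then obtain r where r: "cbrt_sinh (of_real x) = of_real r" by (metis Reals_cnj_iff Reals_cases)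
  have "of_real (r ^ 3) = complex_of_real (sinh x - x)"
    using cbrt_sinh_cubed[OF strip_props(4), of x] r by (simp add: sinh_defect_of_real)
  hence "r ^ 3 = sinh x - x" by (simp only: of_real_eq_iff)
  hence "r = root 3 (sinh x - x)" by (metis odd_real_root_power_cancel odd_numeral)
  thus ?thesis using r by simp
qed

text \<open>Both exponents (times 3) are continuous logarithms of \<open>sinh_defect\<close> on the
  convex quarter strip, hence differ by a constant, which is computed at one point. The formula
  makes the argument of the cube root readable.\<close>

lemma cbrt_sinh_quarter:
  assumes "0 \<le> Re t" "0 < Im t" "Im t < 2 * pi"
  shows "cbrt_sinh t = exp ((Ln (- sinh_defect t) + \<i> * of_real pi) / 3)"
proof -
  define T where "T = {t. 0 \<le> Re t} \<inter> ({t. 0 < Im t} \<inter> {t. Im t < 2 * pi})"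
  have T: "T \<subseteq> strip" by (auto simp: T_def strip_def)
  have "convex T" unfolding T_def
    by (intro convex_Int convex_halfspace_Im_lt convex_halfspace_Im_gt convex_halfspace_Re_ge)
  hence conn: "connected T" by (rule convex_connected)
  define f where "f = (\<lambda>t. Ln (- sinh_defect t) + \<i> * of_real pi)"
  define g where "g = (\<lambda>t. ln_sinh_defect_quot t + 3 * Ln t - 3 * of_real (ln (root 3 6)))"
  have nz: "t \<notin> \<real>\<^sub>\<le>\<^sub>0" "t \<noteq> 0" if "t \<in> T" for t using that by (auto simp: T_def complex_nonpos_Reals_iff)
  have us: "- sinh_defect t \<notin> \<real>\<^sub>\<le>\<^sub>0" "sinh_defect t \<noteq> 0" if "t \<in> T" for t
    using that sinh_defect_notin_nonneg[of t] by (auto simp: T_def)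
  have ef: "exp (f t) = sinh_defect t" if "t \<in> T" for t
    using us[OF that] by (simp add: f_def exp_add mult.commute[of \<i>])
  have eg': "exp (g t / 3) = cbrt_sinh t" if "t \<in> T" for t
  proof -
    have "exp (g t / 3) = exp (ln_sinh_defect_quot t / 3 + Ln t - of_real (ln (root 3 6)))"
      by (simp add: g_def add_divide_distrib diff_divide_distrib)
    also have "\<dots> = cbrt_sinh t" using nz[OF that]
      by (simp add: exp_add exp_diff cbrt_sinh_def exp_of_real)
    finally show ?thesis .
  qed
  have eg: "exp (g t) = sinh_defect t" if "t \<in> T" for t
  proof -
    have "exp (g t) = exp (g t / 3) ^ 3" by (simp add: exp_of_nat_mult[symmetric])
    thus ?thesis using eg'[OF that] cbrt_sinh_cubed[of t] that T by auto
  qed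
  have "(\<lambda>t. f t - g t) constant_on T"
  proof (rule continuous_logs_differ_constant[OF conn])
    have "continuous_on T sinh_defect" unfolding sinh_defect_def[abs_def] by (intro continuous_intros)
    thus "continuous_on T f" unfolding f_def using us by (intro continuous_intros) auto
    show "continuous_on T g" unfolding g_def using nz
      by (intro continuous_intros continuous_on_subset[OF holomorphic_on_imp_continuous_on[OF ln_sinh_defect_quot_holomorphic] T]) auto
  qed (use ef eg in auto)
  then obtain c where c: "\<And>t. t \<in> T \<Longrightarrow> f t - g t = c" by (auto simp: constant_on_def)
  \<comment> \<open>At \<open>\<i>\<close> evenness and conjugation symmetry together force
    \<open>ln_sinh_defect_quot\<close> to be real, so \<open>g\<close> has imaginary part
    \<open>3 pi / 2\<close>; \<open>- sinh_defect \<i>\<close> is a positive multiple of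
    \<open>\<i>\<close>, so \<open>f\<close> has the same imaginary part.\<close>
  have iT: "\<i> \<in> T" using pi_gt3 by (auto simp: T_def)
  have "ln_sinh_defect_quot \<i> = ln_sinh_defect_quot (cnj \<i>)" using ln_sinh_defect_quot_minus[of \<i>] iT T by auto
  also have "\<dots> = cnj (ln_sinh_defect_quot \<i>)" using ln_sinh_defect_quot_cnj[of \<i>] iT T by auto
  finally have "Im (ln_sinh_defect_quot \<i>) = 0" by (simp add: complex_eq_iff)
  hence img: "Im (g \<i>) = 3 * (pi / 2)" by (simp add: g_def)
  have sin1: "sin 1 < (1::real)" using sin_less_self[of 1] by simp
  have "- sinh_defect \<i> = of_real (1 - sin 1) * \<i>" by (simp add: complex_eq_iff Re_sinh_defect Im_sinh_defect)
  moreover have "Ln (of_real r * \<i>) = of_real (ln r) + of_real (pi / 2) * \<i>" if "r > 0" for r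
    using that Ln_times_of_real[of r \<i>] by (simp add: Ln_of_real mult.commute)
  ultimately have "Ln (- sinh_defect \<i>) = of_real (ln (1 - sin 1)) + of_real (pi / 2) * \<i>"
    using sin1 by (simp only: diff_gt_0_iff_gt)
  hence imf: "Im (f \<i>) = 3 * (pi / 2)" by (simp add: f_def)
  have "exp (Re (f \<i>)) = exp (Re (g \<i>))" using ef[OF iT] eg[OF iT] by (metis norm_exp_eq_Re)
  hence "c = 0" using img imf c[OF iT] by (auto simp: complex_eq_iff)
  moreover have tT: "t \<in> T" using assms by (auto simp: T_def)
  ultimately have "f t = g t" using c[OF tT] by simp
  thus ?thesis using eg'[OF tT] by (simp add: f_def)
qed

text \<open>In the right quarter the argument of the cube root lies strictly between
  \<open>0\<close> and \<open>2 pi / 3\<close>; the left quarter follows by the reflection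
  \<open>t \<mapsto> - cnj t\<close>.\<close>

lemma Im_cbrt_sinh_pos:
  assumes "0 < Im t" "Im t < 2 * pi"
  shows "Im (cbrt_sinh t) > 0"
proof -
  have 1: "Im (cbrt_sinh t) > 0" if t: "0 \<le> Re t" "0 < Im t" "Im t < 2 * pi" for t
  proof -
    let ?a = "Im (Ln (- sinh_defect t))"
    have "sinh_defect t \<noteq> 0" using sinh_defect_notin_nonneg[OF t] by auto
    hence "- pi < ?a" "?a < pi"
      using mpi_less_Im_Ln[of "- sinh_defect t"] Im_Ln_less_pi[OF sinh_defect_notin_nonneg[OF t]] by auto
    hence "sin ((?a + pi) / 3) > 0" by (intro sin_gt_zero) auto
    thus ?thesis unfolding cbrt_sinh_quarter[OF t] by (simp add: Im_exp)
  qed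
  show ?thesis
  proof (cases "0 \<le> Re t")
    case False
    have s: "t \<in> strip" "cnj t \<in> strip" using assms by (auto simp: strip_def)
    have "Im (cbrt_sinh (- cnj t)) > 0" using assms False by (intro 1) auto
    thus ?thesis using s by (simp add: cbrt_sinh_minus cbrt_sinh_cnj)
  qed (use 1 assms in auto)
qed

lemma norm_cbrt_sinh_lower:
  assumes "t \<in> strip" "\<bar>Re t\<bar> \<ge> 5"
  shows "exp (\<bar>Re t\<bar> / 3) / 2 \<le> cmod (cbrt_sinh t)"
proof -
  define x where "x = \<bar>Re t\<bar>"
  have x: "x \<ge> 5" using assms by (simp add: x_def)
  have "cmod (exp t) = exp (Re t)" "cmod (exp (- t)) = exp (- Re t)" by (simp_all add: norm_exp_eq_Re)
  hence "\<bar>exp (Re t) - exp (- Re t)\<bar> \<le> cmod (exp t - exp (- t))"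
    using norm_triangle_ineq3[of "exp t" "exp (- t)"] by simp
  moreover have "\<bar>exp (Re t) - exp (- Re t)\<bar> = exp x - exp (- x)"
    unfolding x_def by (cases "Re t \<ge> 0") auto
  ultimately have "(exp x - exp (- x)) / 2 \<le> cmod (sinh t)" by (simp add: sinh_field_def norm_divide)
  moreover have "cmod t \<le> x + 2 * pi"
    using cmod_le[of t] assms(1) by (simp add: x_def strip_def)
  moreover have "cmod (sinh t) - cmod t \<le> cmod (sinh_defect t)" unfolding sinh_defect_def by (rule norm_triangle_ineq2)
  ultimately have u: "(exp x - exp (- x)) / 2 - x - 2 * pi \<le> cmod (sinh_defect t)" by linarith
  have "exp x \<ge> 1 + x + x\<^sup>2 / 2" using exp_lower_Taylor_quadratic[of x] x by simp
  moreover have "x\<^sup>2 \<ge> 5 * x" using x by (simp add: power2_eq_square)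
  ultimately have e1: "exp x \<ge> 1 + x + 5 * x / 2" by linarith
  \<comment> \<open>Squaring the Taylor bound at \<open>x / 2\<close> yields
    \<open>exp x \<ge> 53/8 * (1 + 9/8 * x)\<close>, with \<open>53/8 = 1 + 9/8 * 5\<close>; this is
    enough to absorb \<open>x + 2 * pi\<close> and keep \<open>exp x / 8\<close>.\<close>
  have e2: "exp (x / 2) \<ge> 1 + x / 2 + (x / 2)\<^sup>2 / 2" using exp_lower_Taylor_quadratic[of "x / 2"] x by simp
  have "(x / 2)\<^sup>2 / 2 \<ge> 5 * x / 8" using x by (simp add: power2_eq_square)
  hence e3: "exp (x / 2) \<ge> 1 + 9 / 8 * x" using e2 by linarith
  have "exp x = exp (x / 2) * exp (x / 2)" by (simp add: exp_add[symmetric])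
  also have "\<dots> \<ge> (1 + 9 / 8 * x) * (1 + 9 / 8 * x)" using e3 x by (intro mult_mono) auto
  finally have "exp x \<ge> (1 + 9 / 8 * x) * (1 + 9 / 8 * x)" .
  moreover have "(1 + 9 / 8 * x) * (1 + 9 / 8 * x) \<ge> (1 + 9 / 8 * 5) * (1 + 9 / 8 * x)"
    using x by (intro mult_right_mono) auto
  ultimately have "exp x \<ge> 53 / 8 * (1 + 9 / 8 * x)" by simp
  moreover have "exp (- x) \<le> 1" using x by simp
  moreover have "pi < 4" by (rule pi_less_4)
  ultimately have "exp x / 8 \<le> cmod (sinh_defect t)"
    using u x unfolding diff_divide_distrib distrib_left by linarith
  hence "exp x / 8 \<le> cmod (cbrt_sinh t) ^ 3" using cbrt_sinh_cubed[OF assms(1)] by (metis norm_power)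
  moreover have "exp x / 8 = (exp (x / 3) / 2) ^ 3" by (simp add: power_divide exp_of_nat_mult[symmetric])
  ultimately have "(exp (x / 3) / 2) ^ 3 \<le> cmod (cbrt_sinh t) ^ 3" by simp
  thus ?thesis unfolding x_def by (rule power_mono_iff[THEN iffD1, rotated 3]) auto
qed

section \<open>The preimage of the imaginary axis under the cube root\<close>

text \<open>At \<open>t = x + i level_curve x\<close> the real part \<open>sinh x cos y - x\<close> of \<open>sinh t - t\<close> vanishes and its
  imaginary part is \<open>- rho x ^ 3\<close>.\<close>
definition level_curve :: "real \<Rightarrow> real" where "level_curve x = 2 * pi - arccos (x / sinh x)"

definition rho :: "real \<Rightarrow> real" where
  "rho x = root 3 (level_curve x + cosh x * sqrt (1 - (x / sinh x)\<^sup>2))"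

lemma x_div_sinh:
  fixes x :: real
  shows "x > 0 \<Longrightarrow> 0 < x / sinh x" "x > 0 \<Longrightarrow> x / sinh x < 1"
  using sinh_gt_self[of x] by auto

lemma level_curve_bounds:
  assumes "x > 0"
  shows "3 * pi / 2 < level_curve x" "level_curve x < 2 * pi"
proof -
  note w = x_div_sinh[OF assms]
  have "arccos (x / sinh x) < arccos 0" using w by (intro arccos_less_arccos) auto
  thus "3 * pi / 2 < level_curve x" by (simp add: level_curve_def)
  show "level_curve x < 2 * pi" using arccos_lt_bounded[of "x / sinh x"] w by (simp add: level_curve_def)
qed

lemma rho_cubed: "rho x ^ 3 = level_curve x + cosh x * sqrt (1 - (x / sinh x)\<^sup>2)"
  by (simp add: rho_def odd_real_root_pow)

lemma level_curve_le_rho_cubed: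
  assumes "x > 0" shows "level_curve x \<le> rho x ^ 3"
proof -
  have "(x / sinh x)\<^sup>2 \<le> 1" using x_div_sinh[OF assms] by (intro power_le_one) auto
  hence "0 \<le> cosh x * sqrt (1 - (x / sinh x)\<^sup>2)" by (intro mult_nonneg_nonneg) auto
  thus ?thesis unfolding rho_cubed by linarith
qed

lemma rho_cubed_gt_1:
  assumes "x > 0" shows "rho x ^ 3 > 1"
  using level_curve_le_rho_cubed[OF assms] level_curve_bounds[OF assms] pi_gt3 by linarith

lemma rho_gt_1: assumes "x > 0" shows "rho x > 1"
proof (rule ccontr)
  assume "\<not> rho x > 1"
  hence "rho x ^ 3 \<le> 1 ^ 3" by (intro power_mono_odd) auto
  thus False using rho_cubed_gt_1[OF assms] by simp
qed

lemma sinh_defect_level_curve: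
  assumes "x > 0"
  shows "sinh_defect (Complex x (level_curve x)) = - \<i> * of_real (rho x ^ 3)"
proof -
  note w = x_div_sinh[OF assms]
  have c: "cos (level_curve x) = x / sinh x" using w by (simp add: level_curve_def cos_diff)
  have s: "sin (level_curve x) = - sqrt (1 - (x / sinh x)\<^sup>2)" using w by (simp add: level_curve_def sin_diff sin_arccos)
  have "sinh x \<noteq> 0" using assms by simp
  thus ?thesis by (simp only: complex_eq_iff Re_sinh_defect Im_sinh_defect rho_cubed) (simp add: c s)
qed

text \<open>On the curve \<open>- sinh_defect\<close> is \<open>\<i>\<close> times a positive
  number, of argument \<open>pi / 2\<close>; adding \<open>pi\<close> and dividing by three returns
  to argument \<open>pi / 2\<close>. The left branch is the mirror image.\<close>

lemma cbrt_sinh_level_curve: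
  assumes "x > 0"
  shows "cbrt_sinh (Complex x (level_curve x)) = \<i> * of_real (rho x)" "cbrt_sinh (Complex (- x) (level_curve x)) = \<i> * of_real (rho x)"
proof -
  let ?t = "Complex x (level_curve x)"
  note Y = level_curve_bounds[OF assms]
  have Y0: "0 < level_curve x" using Y pi_gt_zero by linarith
  have r: "rho x > 1" by (rule rho_gt_1[OF assms])
  have "Ln (of_real (rho x ^ 3) * \<i>) = of_real (ln (rho x ^ 3)) + of_real (pi / 2) * \<i>"
    using rho_cubed_gt_1[OF assms] r Ln_times_of_real[of "rho x ^ 3" \<i>] by (simp add: Ln_of_real mult.commute del: of_real_power)
  hence l1: "Ln (- sinh_defect ?t) = of_real (3 * ln (rho x)) + of_real (pi / 2) * \<i>"
    using r by (simp add: sinh_defect_level_curve[OF assms] ln_realpow mult.commute)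
  have l2: "(of_real (3 * ln (rho x)) + of_real (pi / 2) * \<i> + \<i> * of_real pi) / 3
      = of_real (ln (rho x)) + of_real (pi / 2) * \<i>" by (simp add: field_simps)
  have l3: "exp (of_real (ln (rho x)) + of_real (pi / 2) * \<i>) = \<i> * of_real (rho x)"
    using r by (subst exp_eq_polar) simp
  have "cbrt_sinh ?t = exp ((Ln (- sinh_defect ?t) + \<i> * of_real pi) / 3)"
    using assms Y Y0 by (intro cbrt_sinh_quarter) auto
  thus 1: "cbrt_sinh ?t = \<i> * of_real (rho x)" unfolding l1 l2 l3 .
  have "Complex (- x) (level_curve x) = - cnj ?t" by (simp add: complex_eq_iff)
  moreover have "?t \<in> strip" "cnj ?t \<in> strip" using Y Y0 by (auto simp: strip_def)
  ultimately show "cbrt_sinh (Complex (- x) (level_curve x)) = \<i> * of_real (rho x)"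
    by (simp add: cbrt_sinh_minus cbrt_sinh_cnj 1)
qed

text \<open>The exponential growth in \<open>x\<close> is what makes every function of size
  \<open>O(1 / rho)\<close> integrable along the curve.\<close>

lemma rho_lower:
  assumes "x > 0"
  shows "exp (x / 3) / 6 \<le> rho x"
proof (cases "x \<ge> 5")
  case True
  have "Complex x (level_curve x) \<in> strip" using level_curve_bounds[OF assms] pi_gt_zero by (auto simp: strip_def)
  from norm_cbrt_sinh_lower[OF this] True have "exp (x / 3) / 2 \<le> rho x"
    using rho_gt_1[OF assms] by (simp add: cbrt_sinh_level_curve[OF assms] norm_mult)
  thus ?thesis using exp_gt_zero[of "x / 3"] by linarith
next
  case False
  \<comment> \<open>For \<open>x < 5\<close> crude numbers suffice: the left side is at most
    \<open>37/30\<close>, while \<open>rho x ^ 3 > 3 * pi / 2 > 27/8\<close> gives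
    \<open>rho x > 3/2\<close>.\<close>
  have "exp (x / 3) \<le> exp (2::real)" using False by simp
  also have "exp (2::real) = exp 1 * exp 1" by (simp add: exp_add[symmetric])
  also have "\<dots> \<le> 2.72 * (2.72 :: real)"
    using e_less_272 by (intro mult_mono) auto
  finally have "exp (x / 3) \<le> 37 / 5" by simp
  have "27 / 8 < rho x ^ 3"
    using level_curve_le_rho_cubed[OF assms] level_curve_bounds[OF assms] pi_gt3 by linarith
  hence "(3 / 2) ^ 3 < rho x ^ 3" by (simp add: power3_eq_cube)
  hence "3 / 2 < rho x" by (rule power_less_imp_less_base) (use rho_gt_1[OF assms] in simp)
  thus ?thesis using \<open>exp (x / 3) \<le> 37 / 5\<close> by simp
qed

lemma x_div_sinh_continuous: "continuous_on {0<..} (\<lambda>x. x / sinh (x::real))"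
  by (intro continuous_intros) auto

lemma level_curve_has_derivative:
  assumes "x > 0"
  shows "\<exists>y. (level_curve has_real_derivative y) (at x)"
proof -
  note w = x_div_sinh[OF assms]
  have "((\<lambda>x. x / sinh x) has_real_derivative (1 * sinh x - x * cosh x) / (sinh x * sinh x)) (at x)"
    using assms by (intro DERIV_divide DERIV_ident) (auto intro!: derivative_eq_intros)
  from DERIV_chain2[OF DERIV_arccos this] w
  have "((\<lambda>x. arccos (x / sinh x)) has_real_derivative
     inverse (- sqrt (1 - (x / sinh x)\<^sup>2)) * ((1 * sinh x - x * cosh x) / (sinh x * sinh x))) (at x)" by simp
  from DERIV_diff[OF DERIV_const[of "2 * pi"] this] show ?thesis unfolding level_curve_def[abs_def] by blast
qed

lemma level_curve_continuous: "continuous_on {0<..} level_curve"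
  using level_curve_has_derivative by (intro continuous_at_imp_continuous_on) (auto dest: DERIV_isCont)

lemma rho_continuous: "continuous_on {0<..} rho"
  unfolding rho_def[abs_def] by (intro continuous_intros level_curve_continuous x_div_sinh_continuous) auto

lemma level_curve_tendsto: "(level_curve \<longlongrightarrow> 2 * pi) (at_right 0)"
proof -
  have "((\<lambda>x::real. x / ((exp x - exp (- x)) / 2)) \<longlongrightarrow> 1) (at_right 0)" by real_asymp
  hence w: "((\<lambda>x::real. x / sinh x) \<longlongrightarrow> 1) (at_right 0)" by (simp add: sinh_field_def)
  \<comment> \<open>At the endpoint 1 \<open>arccos\<close> is continuous only relative to its
    domain, so the inner limit must be shown to stay inside it.\<close>
  have "continuous (at 1 within {-1..1}) arccos"
    using continuous_on_arccos' by (simp add: continuous_on_eq_continuous_within)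
  hence "(arccos \<longlongrightarrow> arccos 1) (at 1 within {-1..1})" by (simp add: continuous_within)
  moreover have "filterlim (\<lambda>x::real. x / sinh x) (at 1 within {-1..1}) (at_right 0)"
  proof -
    have "eventually (\<lambda>x::real. x / sinh x \<in> {-1..1} \<and> x / sinh x \<noteq> 1) (at_right 0)"
      using eventually_at_right_less[of 0]
    proof eventually_elim
      case (elim x)
      show ?case using x_div_sinh[OF elim] by auto
    qed
    thus ?thesis using w unfolding filterlim_at by blast
  qed
  ultimately have "((\<lambda>x. arccos (x / sinh x)) \<longlongrightarrow> arccos 1) (at_right 0)" by (rule filterlim_compose)
  from tendsto_diff[OF tendsto_const[of "2 * pi"] this] show ?thesis unfolding level_curve_def[abs_def] by simp
qed

lemma set_integrable_of_rho:
  fixes f :: "real \<Rightarrow> 'b::{banach, second_countable_topology}"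
  assumes "continuous_on {1<..} f" "\<And>s. s > 1 \<Longrightarrow> norm (f s) \<le> C / s"
  shows "set_integrable lborel {0<..} (\<lambda>x. f (rho x))"
proof (rule set_integrable_exp_decay[where a = 0 and c = "1/3" and C = "6 * C"])
  show "continuous_on {0<..} (\<lambda>x. f (rho x))"
    by (rule continuous_on_compose2[OF assms(1) rho_continuous]) (auto simp: rho_gt_1)
  fix x :: real assume "x \<in> {0<..}"
  hence x: "x > 0" by simp
  have r: "rho x > 1" by (rule rho_gt_1[OF x])
  have "0 \<le> norm (f (rho x))" by simp
  hence "0 \<le> C / rho x" using assms(2)[OF r] by linarith
  hence C: "C \<ge> 0" using r by (simp add: zero_le_divide_iff)
  have "norm (f (rho x)) \<le> C / rho x" by (rule assms(2)[OF r])
  also have "\<dots> \<le> C / (exp (x / 3) / 6)"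
    using rho_lower[OF x] C r by (intro divide_left_mono) auto
  also have "\<dots> = 6 * C * exp (- (1/3) * x)" by (simp add: exp_minus field_simps)
  finally show "norm (f (rho x)) \<le> 6 * C * exp (- (1/3) * x)" .
qed auto

definition ustrip :: "complex set" where "ustrip = {t. 0 < Im t} \<inter> {t. Im t < 2 * pi}"

lemma ustrip_props: "convex ustrip" "open ustrip" "ustrip \<subseteq> strip"
  unfolding ustrip_def
  by (intro convex_Int convex_halfspace_Im_lt convex_halfspace_Im_gt)
     (auto intro: open_halfspace_Im_lt open_halfspace_Im_gt simp: strip_def)

section \<open>An integral for the Hankel function on the ray \<open>arg = \<pi>/2\<close>\<close>

text \<open>The Bessel-Clifford function, \<open>X^(-mu/2) * I_mu (2 sqrt X)\<close> in classical
  notation. It is entire in \<open>X\<close>, so no branch of a root is involved, and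
  differentiation raises the order by one.\<close>

definition bessel_series :: "complex \<Rightarrow> complex \<Rightarrow> complex" where
  "bessel_series \<mu> X = (\<Sum>k. rGamma (\<mu> + of_nat k + 1) / fact k * X ^ k)"

lemma bessel_series_summable:
  fixes \<mu> X :: complex
  shows "summable (\<lambda>k. rGamma (\<mu> + of_nat k + 1) / fact k * X ^ k)"
proof -
  obtain m :: nat where m: "cmod \<mu> \<le> real m" using real_arch_simple by blast
  have "- cmod \<mu> \<le> Re \<mu>" using abs_Re_le_cmod[of \<mu>] by linarith
  hence re: "1 \<le> Re (\<mu> + of_nat m + 1)" using m by simp
  let ?C = "cmod (rGamma (\<mu> + of_nat m + 1))"
  show ?thesis
  proof (rule summable_comparison_test'[where N = m])
    show "summable (\<lambda>k. ?C * (inverse (fact k) * cmod X ^ k))"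
      by (intro summable_mult summable_exp)
    fix k assume "m \<le> k"
    hence "cmod (rGamma (\<mu> + of_nat k + 1)) \<le> ?C" using re by (rule norm_rGamma_shift_le)
    thus "norm (rGamma (\<mu> + of_nat k + 1) / fact k * X ^ k) \<le> ?C * (inverse (fact k) * cmod X ^ k)"
      by (simp add: norm_mult norm_divide norm_power divide_inverse mult.assoc mult_right_mono norm_inverse)
  qed
qed

lemma bessel_series_has_field_derivative: "(bessel_series \<mu> has_field_derivative bessel_series (\<mu> + 1) X) (at X)"
proof -
  have "diffs (\<lambda>k. rGamma (\<mu> + of_nat k + 1) / fact k) = (\<lambda>k. rGamma (\<mu> + 1 + of_nat k + 1) / fact k)"
  proof
    fix k :: nat
    have "of_nat (Suc k) \<noteq> (0::complex)" by (simp only: of_nat_eq_0_iff)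
    moreover have e: "\<mu> + of_nat (Suc k) + 1 = \<mu> + 1 + of_nat k + 1" by simp
    ultimately show "diffs (\<lambda>k. rGamma (\<mu> + of_nat k + 1) / fact k) k = rGamma (\<mu> + 1 + of_nat k + 1) / fact k"
      unfolding diffs_def e fact_Suc by (simp del: of_nat_Suc)
  qed
  thus ?thesis
    using termdiffs_strong_converges_everywhere[OF bessel_series_summable[of \<mu>], of X]
    unfolding bessel_series_def[abs_def] by simp
qed

text \<open>The functional equation of \<open>rGamma\<close> produces the factor
  \<open>\<mu> + 1 + k\<close>; its part \<open>k\<close> turns into the shifted series on the
  left.\<close>

lemma bessel_series_rec: "X * bessel_series (\<mu> + 2) X = bessel_series \<mu> X - (\<mu> + 1) * bessel_series (\<mu> + 1) X"
proof -
  define a where "a = (\<lambda>k::nat. rGamma (\<mu> + 1 + of_nat k + 1) / fact k * X ^ k)"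
  have a: "a sums bessel_series (\<mu> + 1) X"
    unfolding a_def bessel_series_def by (rule summable_sums[OF bessel_series_summable])
  have "(\<lambda>k. X * (rGamma (\<mu> + 2 + of_nat k + 1) / fact k * X ^ k)) sums (X * bessel_series (\<mu> + 2) X)"
    unfolding bessel_series_def by (intro sums_mult summable_sums[OF bessel_series_summable])
  moreover have "X * (rGamma (\<mu> + 2 + of_nat k + 1) / fact k * X ^ k) = of_nat (Suc k) * a (Suc k)" for k
  proof -
    have "of_nat (Suc k) \<noteq> (0::complex)" by (simp only: of_nat_eq_0_iff)
    moreover have e: "\<mu> + 1 + of_nat (Suc k) + 1 = \<mu> + 2 + of_nat k + 1" by simp
    ultimately show ?thesis unfolding a_def e fact_Suc power_Suc by (simp del: of_nat_Suc)
  qed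
  ultimately have "(\<lambda>k. of_nat (Suc k) * a (Suc k)) sums (X * bessel_series (\<mu> + 2) X)" by simp
  hence "(\<lambda>k. of_nat k * a k) sums (X * bessel_series (\<mu> + 2) X)"
    using sums_Suc_iff[of "\<lambda>k. of_nat k * a k" "X * bessel_series (\<mu> + 2) X"] by simp
  from sums_add[OF this sums_mult[OF a, of "\<mu> + 1"]]
  have "(\<lambda>k. of_nat k * a k + (\<mu> + 1) * a k) sums (X * bessel_series (\<mu> + 2) X + (\<mu> + 1) * bessel_series (\<mu> + 1) X)" .
  moreover have "of_nat k * a k + (\<mu> + 1) * a k = rGamma (\<mu> + of_nat k + 1) / fact k * X ^ k" for k
    unfolding a_def rGamma_plus1[of "\<mu> + of_nat k + 1", symmetric] by (simp add: algebra_simps add_divide_distrib)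
  ultimately have "(\<lambda>k. rGamma (\<mu> + of_nat k + 1) / fact k * X ^ k) sums
      (X * bessel_series (\<mu> + 2) X + (\<mu> + 1) * bessel_series (\<mu> + 1) X)" by simp
  from sums_unique[OF this] show ?thesis unfolding bessel_series_def by (simp add: algebra_simps)
qed

lemma bessel_series_0 [simp]: "bessel_series \<mu> 0 = rGamma (\<mu> + 1)"
  unfolding bessel_series_def by (subst powser_zero) simp

text \<open>The recurrence makes the derivative vanish; the constant is the value at
  \<open>X = 0\<close>, given by the reflection formula of the Gamma function.\<close>

lemma bessel_series_wronskian:
  "bessel_series (- \<mu> - 1) X * bessel_series \<mu> X - X * bessel_series (\<mu> + 1) X * bessel_series (- \<mu>) X = - sin (of_real pi * \<mu>) / of_real pi"
proof -
  let ?c = "\<lambda>X. bessel_series (- \<mu> - 1) X * bessel_series \<mu> X - X * bessel_series (\<mu> + 1) X * bessel_series (- \<mu>) X"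
  have "(?c has_field_derivative 0) (at X within UNIV)" for X
  proof -
    have s: "- \<mu> - 1 + 1 = - \<mu>" "- \<mu> + 1 = - \<mu> - 1 + 2" "\<mu> + 1 + 1 = \<mu> + 2" by simp_all
    have d: "(?c has_field_derivative
       (bessel_series (- \<mu> - 1 + 1) X * bessel_series \<mu> X + bessel_series (\<mu> + 1) X * bessel_series (- \<mu> - 1) X
        - ((1 * bessel_series (\<mu> + 1) X + bessel_series (\<mu> + 1 + 1) X * X) * bessel_series (- \<mu>) X
           + bessel_series (- \<mu> + 1) X * (X * bessel_series (\<mu> + 1) X)))) (at X)"
      by (intro DERIV_diff DERIV_mult' DERIV_mult bessel_series_has_field_derivative DERIV_ident)
    have r1: "bessel_series (\<mu> + 1 + 1) X * X = bessel_series \<mu> X - (\<mu> + 1) * bessel_series (\<mu> + 1) X"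
      using bessel_series_rec[of X \<mu>] unfolding s by (simp add: mult.commute)
    have r2: "bessel_series (- \<mu> + 1) X * X = bessel_series (- \<mu> - 1) X + \<mu> * bessel_series (- \<mu>) X"
      using bessel_series_rec[of X "- \<mu> - 1"] by (simp add: mult.commute)
    have e: "(bessel_series (- \<mu> - 1 + 1) X * bessel_series \<mu> X + bessel_series (\<mu> + 1) X * bessel_series (- \<mu> - 1) X
        - ((1 * bessel_series (\<mu> + 1) X + bessel_series (\<mu> + 1 + 1) X * X) * bessel_series (- \<mu>) X
           + bessel_series (- \<mu> + 1) X * (X * bessel_series (\<mu> + 1) X))) = 0"
      unfolding r1 mult.assoc[symmetric] r2 by (simp add: algebra_simps)
    show ?thesis using d unfolding e by simp
  qed
  from has_field_derivative_zero_constant[OF convex_UNIV this]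
  obtain c where c: "\<And>X. ?c X = c" by auto
  have "rGamma (- \<mu>) * rGamma (1 - (- \<mu>)) = sin (of_real pi * (- \<mu>)) / of_real pi"
    by (rule rGamma_reflection_complex)
  hence "?c 0 = - sin (of_real pi * \<mu>) / of_real pi" by (simp add: add.commute)
  thus ?thesis using c[of X] c[of 0] by simp
qed

section \<open>The Macdonald function: decay, recurrence, reflection and behaviour at zero\<close>

lemma exp_exp_bound:
  assumes "c > 0"
  obtains C where "C > 0" "\<And>s d::real. c \<le> d \<Longrightarrow> exp (a * s - exp s - d * exp (- s)) \<le> C * exp (- \<bar>s\<bar>)"
proof -
  define m where "m = min 1 c"
  define K where "K = \<bar>a\<bar> + 1"
  have m: "m > 0" "m \<le> 1" "m \<le> c" using assms by (auto simp: m_def)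
  have "exp (a * s - exp s - d * exp (- s)) \<le> exp (K\<^sup>2 / (2 * m)) * exp (- \<bar>s\<bar>)" if "c \<le> d" for s d
  proof -
    \<comment> \<open>Whichever of the two exponentials grows dominates \<open>m\<close> times the
      quadratic Taylor polynomial of \<open>exp \<bar>s\<bar>\<close>. The quadratic term beats
      \<open>K * \<bar>s\<bar>\<close>, where the extra 1 in \<open>K\<close> is the decay rate to
      be gained, and \<open>K\<^sup>2 / (2 * m)\<close> is what completing the square leaves
      over.\<close>
    have q: "m * (1 + \<bar>s\<bar> + \<bar>s\<bar>\<^sup>2 / 2) \<le> exp s + d * exp (- s)"
    proof (cases "s \<ge> 0")
      case True
      have "m * (1 + s + s\<^sup>2 / 2) \<le> 1 * exp s"
        using exp_lower_Taylor_quadratic[OF True] m True by (intro mult_mono) auto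
      thus ?thesis using True that assms by (smt (verit) exp_gt_zero mult_nonneg_nonneg abs_of_nonneg)
    next
      case False
      have "m * (1 + (- s) + (- s)\<^sup>2 / 2) \<le> d * exp (- s)"
        using exp_lower_Taylor_quadratic[of "- s"] m False that by (intro mult_mono) auto
      thus ?thesis using False by (smt (verit) exp_gt_zero)
    qed
    have "m * \<bar>s\<bar>\<^sup>2 / 2 \<le> m * (1 + \<bar>s\<bar> + \<bar>s\<bar>\<^sup>2 / 2)"
      using m by (simp add: algebra_simps)
    moreover have "K * \<bar>s\<bar> - m * \<bar>s\<bar>\<^sup>2 / 2 \<le> K\<^sup>2 / (2 * m)"
    proof -
      have "0 \<le> (m * \<bar>s\<bar> - K)\<^sup>2 / (2 * m)" using m by simp
      also have "\<dots> = K\<^sup>2 / (2 * m) - (K * \<bar>s\<bar> - m * \<bar>s\<bar>\<^sup>2 / 2)"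
        using m by (simp add: power2_eq_square field_simps)
      finally show ?thesis by simp
    qed
    moreover have "a * s \<le> (K - 1) * \<bar>s\<bar>"
      unfolding K_def using abs_ge_self[of "a * s"] by (simp add: abs_mult)
    ultimately have "a * s - exp s - d * exp (- s) \<le> K\<^sup>2 / (2 * m) + - \<bar>s\<bar>"
      using q by (simp add: algebra_simps)
    thus ?thesis unfolding exp_add[symmetric] by simp
  qed
  thus ?thesis using that[of "exp (K\<^sup>2 / (2 * m))"] by auto
qed

text \<open>In classical notation \<open>2 * X^(-mu/2) * K_mu (2 sqrt X)\<close>. In this form
  derivative and recurrence mirror those of \<open>bessel_series\<close> up to signs.\<close>

definition bessel_K_integral :: "complex \<Rightarrow> complex \<Rightarrow> complex" where
  "bessel_K_integral \<mu> X = (\<integral>s. exp (- \<mu> * of_real s - of_real (exp s) - X * of_real (exp (- s))) \<partial>lborel)"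

lemma bessel_K_integral_bound:
  assumes "c > 0"
  obtains C where "C > 0" "\<And>s X. c \<le> Re X \<Longrightarrow>
    cmod (exp (- \<mu> * of_real s - of_real (exp s) - X * of_real (exp (- s)))) \<le> C * exp (- \<bar>s\<bar>)"
proof -
  obtain C where "C > 0" "\<And>s d::real. c \<le> d \<Longrightarrow> exp (- Re \<mu> * s - exp s - d * exp (- s)) \<le> C * exp (- \<bar>s\<bar>)"
    using exp_exp_bound[OF assms] by blast
  thus ?thesis by (intro that[of C]) (simp_all add: norm_exp_eq_Re)
qed

lemma bessel_K_integral_integrable:
  assumes "Re X > 0"
  shows "integrable lborel (\<lambda>s. exp (- \<mu> * of_real s - of_real (exp s) - X * of_real (exp (- s))))"
proof -
  obtain C where "\<And>s. cmod (exp (- \<mu> * of_real s - of_real (exp s) - X * of_real (exp (- s)))) \<le> C * exp (- \<bar>s\<bar>)"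
    using bessel_K_integral_bound[OF assms] by (metis order_refl)
  thus ?thesis by (intro integrable_exp_decay[of _ C]) (auto intro!: continuous_intros)
qed

lemma bessel_K_integral_has_field_derivative:
  assumes "Re X > 0"
  shows "(bessel_K_integral \<mu> has_field_derivative - bessel_K_integral (\<mu> + 1) X) (at X)"
proof -
  let ?f = "\<lambda>s X. exp (- \<mu> * of_real s - of_real (exp s) - X * of_real (exp (- s)))"
  have c: "Re X / 2 > 0" using assms by simp
  obtain C where C: "\<And>s Y. Re X / 2 \<le> Re Y \<Longrightarrow> cmod (?f s Y) \<le> C * exp (- \<bar>s\<bar>)"
    using bessel_K_integral_bound[OF c] by blast
  have "(bessel_K_integral \<mu> has_field_derivative (\<integral>s. deriv (?f s) X \<partial>lborel)) (at X)"
    unfolding bessel_K_integral_def[abs_def]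
  proof (rule has_field_derivative_lebesgue_integral[OF c, where h = "\<lambda>s. C * exp (- \<bar>s\<bar>)"])
    show "integrable lborel (\<lambda>s::real. C * exp (- \<bar>s\<bar>))" using integrable_exp_minus_abs by simp
    fix s Y assume "Y \<in> ball X (Re X / 2)"
    hence "Re X - Re Y < Re X / 2" using complex_Re_le_cmod[of "X - Y"] by (simp add: dist_norm)
    thus "cmod (?f s Y) \<le> C * exp (- \<bar>s\<bar>)" by (intro C) simp
  qed (auto intro!: holomorphic_intros borel_measurable_continuous_onI continuous_intros)
  moreover have "deriv (?f s) X = - exp (- (\<mu> + 1) * of_real s - of_real (exp s) - X * of_real (exp (- s)))" for s
  proof (rule DERIV_imp_deriv)
    have "(?f s has_field_derivative ?f s X * (- of_real (exp (- s)))) (at X)"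
      by (auto intro!: derivative_eq_intros)
    also have "?f s X * (- of_real (exp (- s))) = - exp (- (\<mu> + 1) * of_real s - of_real (exp s) - X * of_real (exp (- s)))"
      unfolding exp_of_real[symmetric] by (simp add: exp_add[symmetric] algebra_simps)
    finally show "(?f s has_field_derivative \<dots>) (at X)" .
  qed
  ultimately show ?thesis by (simp add: bessel_K_integral_def)
qed

lemma exp_minus_abs_tendsto:
  "((\<lambda>s::real. C * exp (- \<bar>s\<bar>)) \<longlongrightarrow> 0) at_top" "((\<lambda>s::real. C * exp (- \<bar>s\<bar>)) \<longlongrightarrow> 0) at_bot"
proof -
  show "((\<lambda>s::real. C * exp (- \<bar>s\<bar>)) \<longlongrightarrow> 0) at_top"
    by (intro tendsto_mult_right_zero filterlim_compose[OF exp_at_bot])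
       (simp add: filterlim_uminus_at_bot filterlim_at_infinity_imp_norm_at_top[of "\<lambda>x::real. x", unfolded real_norm_def] filterlim_at_top_imp_at_infinity filterlim_ident)
  show "((\<lambda>s::real. C * exp (- \<bar>s\<bar>)) \<longlongrightarrow> 0) at_bot"
    by (intro tendsto_mult_right_zero filterlim_compose[OF exp_at_bot])
       (simp add: filterlim_uminus_at_bot filterlim_at_infinity_imp_norm_at_top[of "\<lambda>x::real. x", unfolded real_norm_def] filterlim_at_bot_imp_at_infinity filterlim_ident)
qed

text \<open>The \<open>s\<close>-derivative of the integrand for order \<open>\<mu> + 1\<close> is
  exactly the integrand of the claimed combination, and it has no boundary terms.\<close>

lemma bessel_K_integral_rec:
  assumes "Re X > 0"
  shows "X * bessel_K_integral (\<mu> + 2) X = (\<mu> + 1) * bessel_K_integral (\<mu> + 1) X + bessel_K_integral \<mu> X"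
proof -
  let ?E = "\<lambda>\<mu> s. exp (- \<mu> * of_real s - of_real (exp s) - X * of_real (exp (- s)))"
  let ?f = "\<lambda>s. X * ?E (\<mu> + 2) s - (\<mu> + 1) * ?E (\<mu> + 1) s - ?E \<mu> s"
  obtain C where C: "\<And>s. cmod (?E (\<mu> + 1) s) \<le> C * exp (- \<bar>s\<bar>)"
    using bessel_K_integral_bound[OF assms] by (metis order_refl)
  have i: "integrable lborel ?f" by (intro Bochner_Integration.integrable_diff Bochner_Integration.integrable_mult_right bessel_K_integral_integrable assms)
  have "(LBINT s=-\<infinity>..\<infinity>. ?f s) = 0 - 0"
  proof (rule interval_integral_FTC_integrable[where F = "?E (\<mu> + 1)"])
    fix s :: real
    have "(?E (\<mu> + 1) has_vector_derivative
        (- (\<mu> + 1) - of_real (exp s) + X * of_real (exp (- s))) * ?E (\<mu> + 1) s) (at s)"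
    proof -
      have "((\<lambda>z. exp (- (\<mu> + 1) * z - exp z - X * exp (- z))) has_field_derivative
        (- (\<mu> + 1) - exp z + X * exp (- z)) * exp (- (\<mu> + 1) * z - exp z - X * exp (- z))) (at z)" for z
        by (auto intro!: derivative_eq_intros simp: algebra_simps)
      from has_vector_derivative_real_field[OF this, of s UNIV]
      show ?thesis by (simp add: exp_of_real[symmetric])
    qed
    also have "(- (\<mu> + 1) - of_real (exp s) + X * of_real (exp (- s))) * ?E (\<mu> + 1) s = ?f s"
    proof -
      have "of_real (exp s) * ?E (\<mu> + 1) s = ?E \<mu> s" "of_real (exp (- s)) * ?E (\<mu> + 1) s = ?E (\<mu> + 2) s"
        unfolding exp_of_real[symmetric] exp_add[symmetric]
        by (rule arg_cong[where f = exp], simp add: algebra_simps)+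
      thus ?thesis by (simp add: algebra_simps)
    qed
    finally show "(?E (\<mu> + 1) has_vector_derivative ?f s) (at s)" .
    show "isCont ?f s" by (intro continuous_intros)
  next
    show "((?E (\<mu> + 1) \<circ> real_of_ereal) \<longlongrightarrow> 0) (at_right (- \<infinity>))"
      unfolding ereal_tendsto_simps by (rule Lim_null_comparison[OF _ exp_minus_abs_tendsto(2)[of C]]) (use C in auto)
    show "((?E (\<mu> + 1) \<circ> real_of_ereal) \<longlongrightarrow> 0) (at_left \<infinity>)"
      unfolding ereal_tendsto_simps by (rule Lim_null_comparison[OF _ exp_minus_abs_tendsto(1)[of C]]) (use C in auto)
  qed (use i in \<open>auto simp: set_integrable_def\<close>)
  hence "(\<integral>s. ?f s \<partial>lborel) = 0"
    by (simp add: interval_lebesgue_integral_def set_lebesgue_integral_def)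
  moreover have "(\<integral>s. ?f s \<partial>lborel) = X * bessel_K_integral (\<mu> + 2) X - (\<mu> + 1) * bessel_K_integral (\<mu> + 1) X - bessel_K_integral \<mu> X"
    by (simp only: bessel_K_integral_def Bochner_Integration.integral_diff Bochner_Integration.integrable_diff
        Bochner_Integration.integrable_mult_right bessel_K_integral_integrable[OF assms] integral_mult_right_zero)
  ultimately show ?thesis by (simp add: algebra_simps)
qed

text \<open>The substitution \<open>s \<mapsto> ln X - s\<close> exchanges the two exponentials;
  this is the evenness of the Macdonald function in its order.\<close>

lemma bessel_K_integral_reflect:
  assumes "X > 0"
  shows "of_real X powr \<mu> * bessel_K_integral \<mu> (of_real X) = bessel_K_integral (- \<mu>) (of_real X)"
proof -
  let ?E = "\<lambda>\<mu> s. exp (- \<mu> * of_real s - of_real (exp s) - of_real X * of_real (exp (- s))) :: complex"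
  have "bessel_K_integral (- \<mu>) (of_real X) = (\<integral>s. ?E (- \<mu>) (ln X + (-1) * s) \<partial>lborel)"
    unfolding bessel_K_integral_def using lborel_integral_real_affine[of "-1" "?E (- \<mu>)" "ln X"] by simp
  also have "(\<lambda>s. ?E (- \<mu>) (ln X + (-1) * s)) = (\<lambda>s. of_real X powr \<mu> * ?E \<mu> s)"
  proof
    fix s
    have x: "exp (ln X - s) = X * exp (- s)" "X * exp (- (ln X - s)) = exp s"
      using assms by (simp_all add: exp_diff exp_minus field_simps)
    have y: "of_real X * of_real (exp (- (ln X - s))) = (of_real (exp s) :: complex)"
      using x(2) by (metis of_real_mult)
    have z: "complex_of_real (exp (ln X - s)) = of_real X * of_real (exp (- s))" using x(1) by simp
    have "?E (- \<mu>) (ln X - s) = exp (\<mu> * of_real (ln X - s) - of_real X * of_real (exp (- s)) - of_real (exp s))"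
      unfolding y z by simp
    also have "\<dots> = of_real X powr \<mu> * ?E \<mu> s"
      using assms by (simp add: powr_def Ln_of_real exp_add[symmetric] algebra_simps)
    finally show "?E (- \<mu>) (ln X + (-1) * s) = of_real X powr \<mu> * ?E \<mu> s" by simp
  qed
  finally show ?thesis by (simp add: bessel_K_integral_def)
qed


lemma exp_minus_exp_bound: "exp (s - exp s) \<le> exp 2 * exp (- \<bar>s\<bar>)" for s :: real
proof (cases "s \<ge> 0")
  case True
  have "0 \<le> (s - 2)\<^sup>2" by simp
  hence "s - exp s \<le> 2 - s"
    using exp_lower_Taylor_quadratic[OF True] True by (simp add: power2_eq_square algebra_simps)
  thus ?thesis using True by (simp add: exp_add[symmetric])
next
  case False
  hence "s - exp s \<le> 2 + s" using exp_gt_zero[of s] by linarith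
  thus ?thesis using False by (simp add: exp_add[symmetric])
qed

text \<open>Euler's integral after \<open>t = exp s\<close>; on the line \<open>Re z = 1\<close> the
  integrand has modulus \<open>exp (s - exp s)\<close>.\<close>

lemma Gamma_eq_integral_exp:
  assumes "Re z = 1"
  shows "(\<integral>s. exp (z * of_real s - of_real (exp s)) \<partial>lborel) = Gamma z"
proof -
  let ?f = "\<lambda>t. of_real t powr (z - 1) / of_real (exp t) :: complex"
  let ?g = "\<lambda>s. exp (z * of_real s - of_real (exp s)) :: complex"
  have e: "exp s *\<^sub>R ?f (exp s) = ?g s" for s :: real
  proof -
    have "exp s *\<^sub>R ?f (exp s) = exp (of_real s) * (exp ((z - 1) * of_real s) / exp (of_real (exp s)))"
      by (simp add: powr_def Ln_of_real scaleR_conv_of_real exp_of_real)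
    also have "\<dots> = ?g s"
      unfolding times_divide_eq_right exp_add[symmetric] exp_diff[symmetric]
      by (rule arg_cong[where f = exp]) (simp add: algebra_simps)
    finally show ?thesis .
  qed
  have g: "integrable lborel ?g"
    by (rule integrable_exp_decay[where C = "exp 2"])
       (use exp_minus_exp_bound assms in \<open>auto intro!: continuous_intros simp: norm_exp_eq_Re\<close>)
  have "?f absolutely_integrable_on {0<..}"
    using absolutely_integrable_Gamma_integral'[of z] assms by simp
  moreover have m: "(\<lambda>x. indicator {0<..} x *\<^sub>R ?f x) \<in> borel_measurable lborel"
    using set_borel_measurable_continuous_on[of "{0<..}" ?f]
    by (auto intro!: continuous_intros simp: set_borel_measurable_def)
  ultimately have f: "set_integrable lborel {0<..} ?f"
    unfolding set_integrable_def using integrable_completion[OF m] by simp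
  have "(LBINT x=0..\<infinity>. ?f x) = (LBINT x=-\<infinity>..\<infinity>. exp x *\<^sub>R ?f (exp x))"
  proof (rule interval_integral_substitution_integrable)
    show "((ereal \<circ> exp \<circ> real_of_ereal) \<longlongrightarrow> 0) (at_right (- \<infinity>))"
      unfolding ereal_tendsto_simps unfolding comp_def zero_ereal_def lim_ereal by (rule exp_at_bot)
    show "((ereal \<circ> exp \<circ> real_of_ereal) \<longlongrightarrow> \<infinity>) (at_left \<infinity>)"
      unfolding ereal_tendsto_simps unfolding comp_def by (simp add: tendsto_PInfty_eq_at_top exp_at_top)
    show "set_integrable lborel (einterval 0 \<infinity>) ?f"
      using f by (simp add: zero_ereal_def)
    show "set_integrable lborel (einterval (- \<infinity>) \<infinity>) (\<lambda>x. exp x *\<^sub>R ?f (exp x))"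
      unfolding e using g by (simp add: set_integrable_def)
    show "isCont ?f (exp x)" for x
      by (intro continuous_intros) auto
  qed (auto intro!: derivative_eq_intros)
  hence "(LINT x:{0<..}|lborel. ?f x) = (\<integral>s. ?g s \<partial>lborel)"
    unfolding e by (simp add: interval_lebesgue_integral_def zero_ereal_def set_lebesgue_integral_def)
  moreover have "(LINT x:{0<..}|lborel. ?f x) = Gamma z"
    using set_borel_integral_eq_integral(2)[OF f] Gamma_integral_complex'[of z] assms
    by (simp add: integral_unique)
  ultimately show ?thesis by simp
qed

lemma bessel_K_integral_limit_Gamma:
  assumes "Re \<mu> = 0"
  shows "(\<lambda>n. bessel_K_integral (- \<mu> - 1) (of_real (inverse (real (Suc n))))) \<longlonglongrightarrow> Gamma (\<mu> + 1)"
  unfolding bessel_K_integral_def Gamma_eq_integral_exp[of "\<mu> + 1", symmetric, simplified, OF assms]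
proof (rule integral_dominated_convergence[where w = "\<lambda>s. exp 2 * exp (- \<bar>s\<bar>)"])
  show "integrable lborel (\<lambda>s::real. exp 2 * exp (- \<bar>s\<bar>))" using integrable_exp_minus_abs by simp
  show "AE s in lborel. (\<lambda>n. exp (- (- \<mu> - 1) * of_real s - of_real (exp s) - of_real (inverse (real (Suc n))) * of_real (exp (- s)))) \<longlonglongrightarrow> exp ((\<mu> + 1) * of_real s - of_real (exp s))"
  proof (rule AE_I2)
    fix s :: real
    have "(\<lambda>n. of_real (inverse (real (Suc n))) :: complex) \<longlonglongrightarrow> of_real 0"
      by (intro tendsto_of_real LIMSEQ_inverse_real_of_nat)
    hence "(\<lambda>n. exp (- (- \<mu> - 1) * of_real s - of_real (exp s) - of_real (inverse (real (Suc n))) * of_real (exp (- s)))) \<longlonglongrightarrow> exp (- (- \<mu> - 1) * of_real s - of_real (exp s) - of_real 0 * of_real (exp (- s)))"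
      by (intro tendsto_exp tendsto_diff tendsto_mult tendsto_const)
    thus "(\<lambda>n. exp (- (- \<mu> - 1) * of_real s - of_real (exp s) - of_real (inverse (real (Suc n))) * of_real (exp (- s)))) \<longlonglongrightarrow> exp ((\<mu> + 1) * of_real s - of_real (exp s))"
      by (simp add: algebra_simps)
  qed
  show "AE s in lborel. cmod (exp (- (- \<mu> - 1) * of_real s - of_real (exp s) - of_real (inverse (real (Suc n))) * of_real (exp (- s)))) \<le> exp 2 * exp (- \<bar>s\<bar>)" for n
  proof (rule AE_I2)
    fix s :: real
    have n: "cmod (exp (- (- \<mu> - 1) * of_real s - of_real (exp s) - of_real x * of_real (exp (- s)))) = exp (s - exp s - x * exp (- s))" for x
      using assms by (simp add: norm_exp_eq_Re)
    have "exp (s - exp s - inverse (real (Suc n)) * exp (- s)) \<le> exp (s - exp s)"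
      unfolding exp_le_cancel_iff by simp
    also have "\<dots> \<le> exp 2 * exp (- \<bar>s\<bar>)" by (rule exp_minus_exp_bound)
    finally show "cmod (exp (- (- \<mu> - 1) * of_real s - of_real (exp s) - of_real (inverse (real (Suc n))) * of_real (exp (- s)))) \<le> exp 2 * exp (- \<bar>s\<bar>)"
      unfolding n .
  qed
qed (auto intro!: borel_measurable_continuous_onI continuous_intros)

text \<open>For imaginary order the limit of the integrand without its prefactor is not integrable
  near minus infinity. The prefactor \<open>X\<close> repairs this through
  \<open>y * exp (- y) \<le> 1\<close> with \<open>y = X * exp (- s)\<close>, which leaves the
  majorant \<open>exp (s - exp s)\<close>.\<close>

lemma bessel_K_integral_limit_0:
  assumes "Re \<mu> = 0"
  shows "(\<lambda>n. of_real (inverse (real (Suc n))) * bessel_K_integral (- \<mu>) (of_real (inverse (real (Suc n))))) \<longlonglongrightarrow> 0"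
proof -
  let ?x = "\<lambda>n. inverse (real (Suc n))"
  let ?E = "\<lambda>n s. of_real (?x n) * exp (- (- \<mu>) * of_real s - of_real (exp s) - of_real (?x n) * of_real (exp (- s))) :: complex"
  have bd: "cmod (?E n s) \<le> exp 2 * exp (- \<bar>s\<bar>)" for n s
  proof -
    have y: "y * exp (- y) \<le> 1" for y :: real
    proof -
      have "y \<le> exp y" using exp_ge_add_one_self[of y] by linarith
      thus ?thesis by (simp add: exp_minus divide_inverse[symmetric])
    qed
    have "?x n * exp (- s) * exp (- (?x n * exp (- s))) \<le> 1" by (rule y)
    hence "?x n * exp (- s) * exp (- (?x n * exp (- s))) * exp (s - exp s) \<le> 1 * exp (s - exp s)"
      by (intro mult_right_mono) auto
    also have "?x n * exp (- s) * exp (- (?x n * exp (- s))) * exp (s - exp s) = cmod (?E n s)"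
    proof -
      have "exp (- s) * exp (- (?x n * exp (- s))) * exp (s - exp s) = exp (- exp s - ?x n * exp (- s))"
        unfolding exp_add[symmetric] by (rule arg_cong[where f = exp]) simp
      moreover have "cmod (of_real x * exp (- (- \<mu>) * of_real s - of_real (exp s) - of_real x * of_real (exp (- s)))) = x * exp (- exp s - x * exp (- s))" if "x > 0" for x
        using assms that by (simp add: norm_mult norm_exp_eq_Re)
      from this[of "?x n"] have "cmod (?E n s) = ?x n * exp (- exp s - ?x n * exp (- s))" by simp
      ultimately show ?thesis by (simp only: mult.assoc)
    qed
    finally show ?thesis using exp_minus_exp_bound[of s] by simp
  qed
  have "(\<lambda>n. \<integral>s. ?E n s \<partial>lborel) \<longlonglongrightarrow> (\<integral>s. (0::complex) \<partial>(lborel :: real measure))"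
  proof (rule integral_dominated_convergence[where w = "\<lambda>s. exp 2 * exp (- \<bar>s\<bar>)"])
    show "integrable lborel (\<lambda>s::real. exp 2 * exp (- \<bar>s\<bar>))" using integrable_exp_minus_abs by simp
    show "AE s in lborel. (\<lambda>n. ?E n s) \<longlonglongrightarrow> 0"
    proof (rule AE_I2)
      fix s :: real
      have x: "(\<lambda>n. of_real (?x n) :: complex) \<longlonglongrightarrow> of_real 0"
        by (intro tendsto_of_real LIMSEQ_inverse_real_of_nat)
      have "(\<lambda>n. ?E n s) \<longlonglongrightarrow> of_real 0 * exp (- (- \<mu>) * of_real s - of_real (exp s) - of_real 0 * of_real (exp (- s)))"
        by (intro tendsto_exp tendsto_diff tendsto_mult tendsto_const x)
      thus "(\<lambda>n. ?E n s) \<longlonglongrightarrow> 0" by simp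
    qed
    show "AE s in lborel. cmod (?E n s) \<le> exp 2 * exp (- \<bar>s\<bar>)" for n
      using bd by (intro AE_I2)
  qed (auto intro!: borel_measurable_continuous_onI continuous_intros)
  thus ?thesis by (simp add: bessel_K_integral_def del: of_nat_Suc)
qed

text \<open>The derivative cancels by the two recurrences. The constant is found by letting
  \<open>X\<close> tend to zero through reciprocals of integers: one product vanishes and the other
  gives \<open>Gamma (\<mu> + 1) * rGamma (\<mu> + 1)\<close>, where \<open>\<mu> + 1\<close> has
  real part 1 and so is no pole.\<close>

lemma bessel_K_integral_bessel_series_wronskian:
  assumes \<mu>: "Re \<mu> = 0" "\<mu> \<noteq> 0" and X: "Re X > 0"
  shows "X powr (\<mu> + 1) * (bessel_K_integral \<mu> X * bessel_series (\<mu> + 1) X + bessel_K_integral (\<mu> + 1) X * bessel_series \<mu> X) = 1"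
proof -
  let ?S = "{X. Re X > 0}"
  let ?W = "\<lambda>X. X powr (\<mu> + 1) * (bessel_K_integral \<mu> X * bessel_series (\<mu> + 1) X + bessel_K_integral (\<mu> + 1) X * bessel_series \<mu> X)"
  have "(?W has_field_derivative 0) (at X within ?S)" if "X \<in> ?S" for X
  proof -
    from that have X: "Re X > 0" by simp
    hence nz: "X \<notin> \<real>\<^sub>\<le>\<^sub>0" "X \<noteq> 0" by (auto simp: complex_nonpos_Reals_iff)
    have p: "((\<lambda>X. X powr (\<mu> + 1)) has_field_derivative (\<mu> + 1) * X powr \<mu>) (at X)"
      using has_field_derivative_powr[OF nz(1), of "\<mu> + 1"] by simp
    have d: "(?W has_field_derivative
        ((\<mu> + 1) * X powr \<mu> * (bessel_K_integral \<mu> X * bessel_series (\<mu> + 1) X + bessel_K_integral (\<mu> + 1) X * bessel_series \<mu> X)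
         + ((- bessel_K_integral (\<mu> + 1) X * bessel_series (\<mu> + 1) X + bessel_series (\<mu> + 1 + 1) X * bessel_K_integral \<mu> X)
             + (- bessel_K_integral (\<mu> + 1 + 1) X * bessel_series \<mu> X + bessel_series (\<mu> + 1) X * bessel_K_integral (\<mu> + 1) X)) * X powr (\<mu> + 1))) (at X)"
      by (intro DERIV_mult DERIV_add p bessel_series_has_field_derivative bessel_K_integral_has_field_derivative X)
    have s: "\<mu> + 1 + 1 = \<mu> + 2" "X powr (\<mu> + 1) = X * X powr \<mu>"
      using nz by (simp_all add: powr_add mult.commute)
    have "((\<mu> + 1) * X powr \<mu> * (bessel_K_integral \<mu> X * bessel_series (\<mu> + 1) X + bessel_K_integral (\<mu> + 1) X * bessel_series \<mu> X)
         + ((- bessel_K_integral (\<mu> + 1) X * bessel_series (\<mu> + 1) X + bessel_series (\<mu> + 1 + 1) X * bessel_K_integral \<mu> X)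
             + (- bessel_K_integral (\<mu> + 1 + 1) X * bessel_series \<mu> X + bessel_series (\<mu> + 1) X * bessel_K_integral (\<mu> + 1) X)) * X powr (\<mu> + 1))
       = X powr \<mu> * ((\<mu> + 1) * (bessel_K_integral \<mu> X * bessel_series (\<mu> + 1) X + bessel_K_integral (\<mu> + 1) X * bessel_series \<mu> X)
           + bessel_K_integral \<mu> X * (X * bessel_series (\<mu> + 2) X) - (X * bessel_K_integral (\<mu> + 2) X) * bessel_series \<mu> X)"
      unfolding s by (simp add: algebra_simps)
    also have "\<dots> = 0" unfolding bessel_series_rec bessel_K_integral_rec[OF X] by (simp add: algebra_simps)
    finally show ?thesis using d by (metis has_field_derivative_at_within)
  qed
  from has_field_derivative_zero_constant[OF convex_halfspace_Re_gt[of 0] this]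
  obtain c where c: "\<And>X. Re X > 0 \<Longrightarrow> ?W X = c" by auto
  let ?x = "\<lambda>n. complex_of_real (inverse (real (Suc n)))"
  \<comment> \<open>Reflection absorbs the powers of \<open>X\<close> and moves the orders to
    \<open>- \<mu>\<close> and \<open>- \<mu> - 1\<close>, for which the limits are known.\<close>
  have eq: "?W (?x n) = (?x n * bessel_K_integral (- \<mu>) (?x n)) * bessel_series (\<mu> + 1) (?x n) + bessel_K_integral (- \<mu> - 1) (?x n) * bessel_series \<mu> (?x n)" for n
  proof -
    have pos: "inverse (real (Suc n)) > 0" by simp
    have "?x n powr (\<mu> + 1) = ?x n * ?x n powr \<mu>" by (simp add: powr_add mult.commute)
    hence "?W (?x n) = (?x n * (?x n powr \<mu> * bessel_K_integral \<mu> (?x n))) * bessel_series (\<mu> + 1) (?x n)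
        + (?x n powr (\<mu> + 1) * bessel_K_integral (\<mu> + 1) (?x n)) * bessel_series \<mu> (?x n)"
      by (simp add: algebra_simps del: of_nat_Suc)
    thus ?thesis unfolding bessel_K_integral_reflect[OF pos] by simp
  qed
  have x0: "?x \<longlonglongrightarrow> 0"
    using tendsto_of_real[OF LIMSEQ_inverse_real_of_nat, where 'a = complex] by simp
  have J: "(\<lambda>n. bessel_series \<nu> (?x n)) \<longlonglongrightarrow> rGamma (\<nu> + 1)" for \<nu>
    using isCont_tendsto_compose[OF DERIV_isCont[OF bessel_series_has_field_derivative] x0, of \<nu>] by simp
  have "(\<lambda>n. ?W (?x n)) \<longlonglongrightarrow> 0 * rGamma (\<mu> + 1 + 1) + Gamma (\<mu> + 1) * rGamma (\<mu> + 1)"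
    unfolding eq by (intro tendsto_add tendsto_mult J bessel_K_integral_limit_0 bessel_K_integral_limit_Gamma \<mu>)
  moreover have "(\<lambda>n. ?W (?x n)) = (\<lambda>n. c)" using c by auto
  ultimately have "c = Gamma (\<mu> + 1) * rGamma (\<mu> + 1)"
    using LIMSEQ_unique[OF tendsto_const] by fastforce
  moreover have "\<mu> + 1 \<notin> \<int>\<^sub>\<le>\<^sub>0"
  proof
    assume "\<mu> + 1 \<in> \<int>\<^sub>\<le>\<^sub>0"
    then obtain n where "\<mu> + 1 = of_int n" "n \<le> 0" by (elim nonpos_Ints_cases)
    hence "Re (\<mu> + 1) = of_int n" by simp
    with \<mu> \<open>n \<le> 0\<close> show False by simp
  qed
  ultimately have "c = 1" by (simp add: Gamma_def rGamma_eq_zero_iff)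
  thus ?thesis using c[OF X] by simp
qed

text \<open>Eliminates \<open>bessel_K_integral (\<mu> + 1)\<close> between the Wronskian relations for \<open>\<mu>\<close> and \<open>- \<mu>\<close>.\<close>
lemma bessel_K_integral_eq_bessel_series:
  assumes \<mu>: "Re \<mu> = 0" "\<mu> \<noteq> 0" and X: "X > 0"
  defines "Y \<equiv> complex_of_real X"
  shows "bessel_K_integral \<mu> Y * Y powr \<mu> * (sin (of_real pi * \<mu>) / of_real pi) = bessel_series (- \<mu>) Y - Y powr \<mu> * bessel_series \<mu> Y"
proof -
  have Y: "Re Y > 0" "Y \<noteq> 0" using X by (auto simp: Y_def)
  have a: "Y * Y powr \<mu> * (bessel_K_integral \<mu> Y * bessel_series (\<mu> + 1) Y + bessel_K_integral (\<mu> + 1) Y * bessel_series \<mu> Y) = 1"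
    using bessel_K_integral_bessel_series_wronskian[OF \<mu> Y(1)] Y by (simp add: powr_add mult.commute)
  have "Y powr (1 - \<mu>) * (bessel_K_integral (- \<mu>) Y * bessel_series (- \<mu> + 1) Y + bessel_K_integral (1 - \<mu>) Y * bessel_series (- \<mu>) Y) = 1"
    using bessel_K_integral_bessel_series_wronskian[of "- \<mu>" Y] \<mu> Y by (simp add: add.commute)
  moreover have "bessel_K_integral (- \<mu>) Y = Y powr \<mu> * bessel_K_integral \<mu> Y" "bessel_K_integral (1 - \<mu>) Y = Y powr (\<mu> - 1) * bessel_K_integral (\<mu> - 1) Y"
    unfolding Y_def bessel_K_integral_reflect[OF X] by simp_all
  moreover have "Y powr (1 - \<mu>) = Y / Y powr \<mu>" "Y powr (\<mu> - 1) = Y powr \<mu> / Y"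
    using Y by (simp_all add: powr_diff)
  ultimately have st: "Y / Y powr \<mu> * (Y powr \<mu> * bessel_K_integral \<mu> Y * bessel_series (- \<mu> + 1) Y + Y powr \<mu> / Y * bessel_K_integral (\<mu> - 1) Y * bessel_series (- \<mu>) Y) = 1"
    by simp
  have gen: "Y / p * (p * a * a' + p / Y * b * b') = Y * a * a' + b * b'" if "p \<noteq> 0" for p a b a' b'
    using that Y by (simp add: field_simps)
  have b: "Y * bessel_K_integral \<mu> Y * bessel_series (- \<mu> + 1) Y + bessel_K_integral (\<mu> - 1) Y * bessel_series (- \<mu>) Y = 1"
    by (rule trans[OF gen[symmetric] st]) (use Y in simp)
  have r1: "bessel_K_integral (\<mu> - 1) Y = Y * bessel_K_integral (\<mu> + 1) Y - \<mu> * bessel_K_integral \<mu> Y"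
    using bessel_K_integral_rec[OF Y(1), of "\<mu> - 1"] by (simp add: algebra_simps)
  have r2: "Y * bessel_series (- \<mu> + 1) Y = bessel_series (- \<mu> - 1) Y + \<mu> * bessel_series (- \<mu>) Y"
    using bessel_series_rec[of Y "- \<mu> - 1"] by simp
  have b': "bessel_K_integral \<mu> Y * bessel_series (- \<mu> - 1) Y + Y * bessel_K_integral (\<mu> + 1) Y * bessel_series (- \<mu>) Y = 1"
  proof -
    have "bessel_K_integral \<mu> Y * (Y * bessel_series (- \<mu> + 1) Y) + bessel_K_integral (\<mu> - 1) Y * bessel_series (- \<mu>) Y = 1"
      using b by (simp add: algebra_simps)
    thus ?thesis unfolding r1 r2 by (simp add: algebra_simps)
  qed
  let ?p = "Y powr \<mu>"
  have "bessel_K_integral \<mu> Y * ?p * (sin (of_real pi * \<mu>) / of_real pi)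
      = - (bessel_K_integral \<mu> Y * ?p * (bessel_series (- \<mu> - 1) Y * bessel_series \<mu> Y - Y * bessel_series (\<mu> + 1) Y * bessel_series (- \<mu>) Y))"
    unfolding bessel_series_wronskian by simp
  also have "\<dots> = bessel_series (- \<mu>) Y * (Y * ?p * (bessel_K_integral \<mu> Y * bessel_series (\<mu> + 1) Y + bessel_K_integral (\<mu> + 1) Y * bessel_series \<mu> Y))
      - ?p * bessel_series \<mu> Y * (bessel_K_integral \<mu> Y * bessel_series (- \<mu> - 1) Y + Y * bessel_K_integral (\<mu> + 1) Y * bessel_series (- \<mu>) Y)"
    by (simp add: algebra_simps)
  also have "\<dots> = bessel_series (- \<mu>) Y - ?p * bessel_series \<mu> Y" unfolding a b' by simp
  finally show ?thesis .
qed

text \<open>The classical connection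
  \<open>H_mu^(1)(i v) = 2 / (pi i) * exp(- pi i mu / 2) * K_mu(v)\<close> at
  \<open>mu = i v\<close>. The half argument squared is \<open>- v^2 / 4\<close>, which turns the
  alternating Bessel series into \<open>bessel_series\<close> at \<open>X = v^2 / 4\<close>.\<close>

lemma hankel1_diag_imaginary:
  assumes v: "v > 0"
  shows "hankel1_diag (Complex (ln v) (pi / 2)) =
     of_real (exp (pi * v / 2)) / (of_real pi * \<i>) * (\<integral>s. exp (- of_real (v * cosh s) - \<i> * of_real (v * s)) \<partial>lborel)"
proof -
  define \<mu> where "\<mu> = \<i> * of_real v"
  define l where "l = ln (v / 2)"
  define X where "X = v\<^sup>2 / 4"
  define \<zeta> where "\<zeta> = Complex (ln v) (pi / 2)"
  have \<zeta>: "\<zeta> = of_real (ln v) + of_real (pi / 2) * \<i>" by (simp add: \<zeta>_def complex_eq_iff)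
  have ez: "exp \<zeta> = \<mu>"
    using v by (subst exp_eq_polar) (simp add: \<zeta>_def \<mu>_def mult.commute)
  have X: "X > 0" using v by (simp add: X_def)
  have lX: "ln X = 2 * l" using v 
  proof -
    have "X = (v / 2)\<^sup>2" by (simp add: X_def power_divide)
    thus ?thesis using v by (simp add: l_def ln_realpow)
  qed
  have el: "exp l = v / 2" using v by (simp add: l_def)
  have \<mu>: "Re \<mu> = 0" "\<mu> \<noteq> 0" using v by (auto simp: \<mu>_def)
  have nint: "\<mu> \<notin> \<int>" using v by (auto simp: \<mu>_def complex_eq_iff elim!: Ints_cases)
  have zl: "\<zeta> - of_real (ln 2) = of_real l + of_real (pi / 2) * \<i>"
    using v by (simp add: \<zeta> l_def ln_div)
  have J: "bessel_J \<nu> \<zeta> = exp (\<nu> * (of_real l + of_real (pi / 2) * \<i>)) * bessel_series \<nu> (of_real X)" for \<nu>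
  proof -
    have t: "(-1) ^ k / fact k * rGamma (\<nu> + of_nat k + 1) * (exp \<zeta> / 2) ^ (2 * k)
        = rGamma (\<nu> + of_nat k + 1) / fact k * of_real X ^ k" for k
    proof -
      have "(exp \<zeta> / 2)\<^sup>2 = - of_real X"
        unfolding ez \<mu>_def X_def by (simp add: power_divide power_mult_distrib)
      hence "(exp \<zeta> / 2) ^ (2 * k) = (- of_real X) ^ k" by (simp only: power_mult)
      also have "\<dots> = (-1) ^ k * of_real X ^ k" by (rule power_minus)
      finally show ?thesis by (simp add: power_mult_distrib[symmetric] mult.assoc[symmetric])
    qed
    show ?thesis unfolding bessel_J_def zl bessel_series_def t ..
  qed
  let ?Y = "complex_of_real X"
  have pw: "?Y powr \<mu> = exp (2 * \<mu> * of_real l)"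
    using X by (simp add: powr_def Ln_of_real lX mult_ac)
  have s0: "sin (of_real pi * \<mu>) \<noteq> 0" using nint by (simp add: sin_pi_times_eq_0_iff)
  have e1: "exp (- \<mu> * (of_real l + of_real (pi / 2) * \<i>)) = exp (- (of_real pi * \<i> * \<mu> / 2)) * exp (- \<mu> * of_real l)"
    unfolding exp_add[symmetric] by (rule arg_cong[where f = exp]) (simp add: algebra_simps)
  have e2: "exp (- (of_real pi * \<i> * \<mu>)) * exp (\<mu> * (of_real l + of_real (pi / 2) * \<i>))
      = exp (- (of_real pi * \<i> * \<mu> / 2)) * exp (- \<mu> * of_real l) * ?Y powr \<mu>"
    unfolding pw exp_add[symmetric] by (rule arg_cong[where f = exp]) (simp add: algebra_simps)
  have e3: "exp (- (of_real pi * \<i> * \<mu> / 2)) = of_real (exp (pi * v / 2))"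
    by (simp add: \<mu>_def exp_of_real[symmetric] field_simps)
  have "hankel1_diag \<zeta> = hankel1_quotient \<mu> \<zeta>"
    using nint by (simp add: hankel1_diag_def hankel1_def ez)
  also have "\<dots> = exp (- (of_real pi * \<i> * \<mu> / 2)) * exp (- \<mu> * of_real l) *
      (bessel_series (- \<mu>) ?Y - ?Y powr \<mu> * bessel_series \<mu> ?Y) / (\<i> * sin (of_real pi * \<mu>))"
    unfolding hankel1_quotient_def J e1 mult.assoc[symmetric] e2 by (simp add: algebra_simps)
  also have "\<dots> = exp (- (of_real pi * \<i> * \<mu> / 2)) * exp (- \<mu> * of_real l) * (bessel_K_integral \<mu> ?Y * ?Y powr \<mu>) / (\<i> * of_real pi)"
    unfolding bessel_K_integral_eq_bessel_series[OF \<mu> X, symmetric] using s0 by (simp add: field_simps)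
  also have "\<dots> = of_real (exp (pi * v / 2)) / (of_real pi * \<i>) * (exp (\<mu> * of_real l) * bessel_K_integral \<mu> ?Y)"
  proof -
    have "exp (- \<mu> * of_real l) * ?Y powr \<mu> = exp (\<mu> * of_real l)"
      unfolding pw exp_add[symmetric] by (rule arg_cong[where f = exp]) (simp add: algebra_simps)
    thus ?thesis unfolding e3 by (simp add: field_simps)
  qed
  also have "exp (\<mu> * of_real l) * bessel_K_integral \<mu> ?Y = (\<integral>s. exp (- of_real (v * cosh s) - \<i> * of_real (v * s)) \<partial>lborel)"
  proof -
    let ?E = "\<lambda>s. exp (- \<mu> * of_real s - of_real (exp s) - ?Y * of_real (exp (- s)))"
    \<comment> \<open>The shift by \<open>l = ln (v / 2)\<close> symmetrises the two exponentials
      \<open>exp s\<close> and \<open>X * exp (- s)\<close> into \<open>v * cosh s\<close>.\<close>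
    have "exp (\<mu> * of_real l) * bessel_K_integral \<mu> ?Y = exp (\<mu> * of_real l) * (\<integral>s. ?E (l + 1 * s) \<partial>lborel)"
      unfolding bessel_K_integral_def using lborel_integral_real_affine[of 1 ?E l] by simp
    also have "\<dots> = (\<integral>s. exp (\<mu> * of_real l) * ?E (l + 1 * s) \<partial>lborel)" by simp
    also have "\<dots> = (\<integral>s. exp (- of_real (v * cosh s) - \<i> * of_real (v * s)) \<partial>lborel)"
    proof (rule Bochner_Integration.integral_cong[OF refl])
      fix s
      have "exp (l + s) + X * exp (- (l + s)) = v * cosh s"
        using v unfolding exp_add minus_add_distrib exp_minus el
        by (simp add: cosh_def X_def field_simps power2_eq_square exp_minus)
      hence "of_real (exp (l + s)) + ?Y * of_real (exp (- (l + s))) = complex_of_real (v * cosh s)"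
        by (metis of_real_add of_real_mult)
      hence "- \<mu> * of_real (l + s) - of_real (exp (l + s)) - ?Y * of_real (exp (- (l + s)))
          = - \<mu> * of_real (l + s) - complex_of_real (v * cosh s)" by (simp add: algebra_simps)
      hence "exp (\<mu> * of_real l) * ?E (l + 1 * s) = exp (\<mu> * of_real l) * exp (- \<mu> * of_real (l + s) - complex_of_real (v * cosh s))"
        by (simp only: mult_1_left)
      also have "\<dots> = exp (- of_real (v * cosh s) - \<i> * of_real (v * s))"
        unfolding exp_add[symmetric] by (rule arg_cong[where f = exp]) (simp add: \<mu>_def algebra_simps)
      finally show "exp (\<mu> * of_real l) * ?E (l + 1 * s) = exp (- of_real (v * cosh s) - \<i> * of_real (v * s))" .
    qed
    finally show ?thesis .
  qed
  finally show ?thesis by (simp add: \<zeta>_def)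
qed

section \<open>The Jacobian and the coefficients as integrals over the preimage\<close>

lemma holomorphic_primitive_exists:
  assumes "convex S" "open S" "f holomorphic_on S"
  shows "\<exists>F. \<forall>t\<in>S. (F has_field_derivative f t) (at t)"
proof (rule holomorphic_convex_primitive'[OF assms])
  fix F assume F: "\<And>t. t \<in> S \<Longrightarrow> (F has_field_derivative f t) (at t within S)"
  have "(F has_field_derivative f t) (at t)" if "t \<in> S" for t
    using F[OF that] unfolding at_within_open[OF that assms(2)] .
  thus ?thesis by (intro exI ballI)
qed

text \<open>A primitive of \<open>G \<circ> cbrt_sinh\<close> on the upper half strip replaces
  deformation of paths. Its difference \<open>D x\<close> between the two curve points over
  \<open>- x\<close> and \<open>x\<close> grows at rate \<open>2 * f x\<close>, starts at 0 at the
  tip \<open>2 pi i\<close> of the curve, and differs from the integral over the horizontal line by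
  two short vertical pieces.\<close>

lemma boundary_integral:
  assumes G: "G holomorphic_on {z. Im z > 0}"
    and bnd: "\<And>z. Im z > 0 \<Longrightarrow> cmod z \<ge> R \<Longrightarrow> cmod (G z) \<le> C / cmod z"
    and h: "0 < h" "h < 2 * pi"
  shows "set_integrable lborel {0<..} (\<lambda>x. G (\<i> * of_real (rho x)))"
    and "((\<lambda>X. contour_integral (linepath (Complex (- X) h) (Complex X h)) (\<lambda>t. G (cbrt_sinh t)))
           \<longlongrightarrow> 2 * (LINT x:{0<..}|lborel. G (\<i> * of_real (rho x)))) at_top"
proof -
  have Gc: "continuous_on {z. Im z > 0} G" using G by (rule holomorphic_on_imp_continuous_on)
  define f where "f = (\<lambda>x. G (\<i> * of_real (rho x)))"
  define R' where "R' = max 1 R"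
  have Gi: "continuous_on {0<..} (\<lambda>s. G (\<i> * of_real s))"
    by (rule continuous_on_compose2[OF Gc]) (auto intro!: continuous_intros)
  have "bounded ((\<lambda>s. G (\<i> * of_real s)) ` {1..R'})"
    by (intro compact_imp_bounded compact_continuous_image continuous_on_subset[OF Gi]) auto
  then obtain B where Bb: "\<forall>z\<in>(\<lambda>s. G (\<i> * of_real s)) ` {1..R'}. cmod z \<le> B"
    unfolding bounded_iff by blast
  have B: "cmod (G (\<i> * of_real s)) \<le> B" if "1 \<le> s" "s \<le> R'" for s
    by (rule bspec[OF Bb], rule imageI) (use that in simp)
  have Gb: "cmod (G (\<i> * of_real s)) \<le> (\<bar>C\<bar> + \<bar>B\<bar> * R') / s" if "s > 1" for s
  proof (cases "s \<ge> R'")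
    case True
    hence "cmod (G (\<i> * of_real s)) \<le> C / s"
      using bnd[of "\<i> * of_real s"] that by (simp add: R'_def norm_mult)
    also have "\<dots> \<le> (\<bar>C\<bar> + \<bar>B\<bar> * R') / s"
      using that by (intro divide_right_mono) (auto simp: R'_def intro: order_trans[OF abs_ge_self])
    finally show ?thesis .
  next
    case False
    have "cmod (G (\<i> * of_real s)) \<le> \<bar>B\<bar> * 1" using B[of s] that False by auto
    also have "\<dots> \<le> \<bar>B\<bar> * (R' / s)" using that False by (intro mult_left_mono) auto
    also have "\<dots> \<le> (\<bar>C\<bar> + \<bar>B\<bar> * R') / s" using that by (simp add: divide_right_mono)
    finally show ?thesis .
  qed
  show int: "set_integrable lborel {0<..} (\<lambda>x. G (\<i> * of_real (rho x)))"
    by (rule set_integrable_of_rho[OF _ Gb]) (auto intro: continuous_on_subset[OF Gi])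
  have img: "cbrt_sinh ` ustrip \<subseteq> {z. Im z > 0}" using Im_cbrt_sinh_pos by (auto simp: ustrip_def)
  have hol: "(\<lambda>t. G (cbrt_sinh t)) holomorphic_on ustrip"
    by (rule holomorphic_on_compose_gen[OF holomorphic_on_subset[OF cbrt_sinh_holomorphic ustrip_props(3)] G img, unfolded comp_def])
  from holomorphic_primitive_exists[OF ustrip_props(1,2) hol]
  obtain \<Psi> where \<Psi>: "\<forall>t\<in>ustrip. (\<Psi> has_field_derivative G (cbrt_sinh t)) (at t)" ..
  note \<Psi> = bspec[OF \<Psi>]
  have tU: "Complex a (level_curve x) \<in> ustrip" if "x > 0" for x a
    using level_curve_bounds[OF that] pi_gt_zero unfolding ustrip_def by auto
  define D where "D = (\<lambda>x. \<Psi> (Complex x (level_curve x)) - \<Psi> (Complex (- x) (level_curve x)))"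
  have D: "(D has_vector_derivative 2 * f x) (at x)" if x: "x > 0" for x
  proof -
    obtain y where "(level_curve has_real_derivative y) (at x)" using level_curve_has_derivative[OF x] by blast
    hence Y: "(level_curve has_vector_derivative y) (at x)" by (simp add: has_real_derivative_iff_has_vector_derivative)
    have "((\<lambda>x. Complex (c * x) (level_curve x)) has_vector_derivative Complex c y) (at x)" for c
      unfolding has_vector_derivative_complex_iff using Y
      by (auto intro!: derivative_eq_intros simp: has_real_derivative_iff_has_vector_derivative[symmetric])
    from this[of 1] this[of "-1"]
    have 1: "((\<lambda>x. Complex x (level_curve x)) has_vector_derivative Complex 1 y) (at x)"
     and 2: "((\<lambda>x. Complex (- x) (level_curve x)) has_vector_derivative Complex (- 1) y) (at x)" by simp_all
    have "(D has_vector_derivative Complex 1 y * f x - Complex (- 1) y * f x) (at x)"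
      unfolding D_def
      using field_vector_diff_chain_at[OF 1 \<Psi>[OF tU[OF x]]] field_vector_diff_chain_at[OF 2 \<Psi>[OF tU[OF x]]]
      by (intro has_vector_derivative_diff) (simp_all add: f_def cbrt_sinh_level_curve[OF x] comp_def)
    \<comment> \<open>The cube root agrees at mirror points, so the vertical components of the two
      tangents cancel and the slope of the curve drops out.\<close>
    moreover have "Complex 1 y * f x - Complex (- 1) y * f x = 2 * f x"
      by (simp add: left_diff_distrib[symmetric]) (simp add: complex_eq_iff)
    ultimately show ?thesis by simp
  qed
  \<comment> \<open>\<open>G \<circ> cbrt_sinh\<close> stays bounded near the branch point \<open>2 \<pi> i\<close> of the boundary curve.\<close>
  obtain \<epsilon> M where \<epsilon>: "\<epsilon> > 0" and M: "\<And>t. t \<in> ustrip \<Longrightarrow> dist t (2 * of_real pi * \<i>) < \<epsilon> \<Longrightarrow> cmod (G (cbrt_sinh t)) \<le> M"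
  proof -
    let ?p = "2 * of_real pi * \<i>"
    let ?e = "\<lambda>t. exp ((Ln (- sinh_defect t) + \<i> * of_real pi) / 3)"
    have up: "- sinh_defect ?p = 2 * of_real pi * \<i>" by (simp add: complex_eq_iff Re_sinh_defect Im_sinh_defect)
    have "- sinh_defect ?p \<notin> \<real>\<^sub>\<le>\<^sub>0" unfolding up by (simp add: complex_nonpos_Reals_iff)
    hence ce: "isCont ?e ?p"
      unfolding sinh_defect_def by (intro continuous_intros) auto
    have "Ln (of_real (2 * pi) * \<i>) = of_real (ln (2 * pi)) + of_real (pi / 2) * \<i>"
      using Ln_times_of_real[of "2 * pi" \<i>] by (simp add: Ln_of_real mult.commute del: of_real_mult)
    hence "Im (Ln (- sinh_defect ?p) + \<i> * of_real pi) = 3 * (pi / 2)"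
      unfolding up by (simp add: mult.commute)
    hence "Im ((Ln (- sinh_defect ?p) + \<i> * of_real pi) / 3) = pi / 2" by simp
    hence ip: "Im (?e ?p) > 0" by (simp only: Im_exp) simp
    have Gat: "isCont G z" if "Im z > 0" for z
      using Gc that by (simp add: continuous_on_eq_continuous_at open_halfspace_Im_gt)
    have 1: "isCont (\<lambda>t. G (?e t)) ?p"
      by (rule continuous_within_compose3[OF Gat[OF ip] ce])
    have 2: "isCont (\<lambda>t. G (- cnj (?e t))) ?p"
      by (rule continuous_within_compose3[OF Gat]) (use ip ce in \<open>auto intro!: continuous_intros\<close>)
    have ex: "\<exists>d>0. \<forall>t. dist t ?p < d \<longrightarrow> cmod (F t) \<le> cmod (F ?p) + 1" if F: "isCont F ?p" for F :: "complex \<Rightarrow> complex"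
    proof -
      obtain d where "d > 0" and d: "\<And>t. dist t ?p < d \<Longrightarrow> dist (F t) (F ?p) < 1"
      proof -
        have "eventually (\<lambda>t. dist (F t) (F ?p) < 1) (at ?p)"
          using F unfolding isCont_def by (rule tendstoD) simp
        then obtain d where "d > 0" "\<And>t. t \<noteq> ?p \<Longrightarrow> dist t ?p < d \<Longrightarrow> dist (F t) (F ?p) < 1"
          unfolding eventually_at by blast
        thus thesis by (intro that[of d]) (metis dist_self zero_less_one)+
      qed
      have "cmod (F t) \<le> cmod (F ?p) + 1" if "dist t ?p < d" for t
        using norm_triangle_sub[of "F t" "F ?p"] d[OF that] by (simp add: dist_norm)
      with \<open>d > 0\<close> show ?thesis by blast
    qed
    obtain d1 where d1: "d1 > 0" "\<And>t. dist t ?p < d1 \<Longrightarrow> cmod (G (?e t)) \<le> cmod (G (?e ?p)) + 1"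
      using ex[OF 1] by blast
    obtain d2 where d2: "d2 > 0" "\<And>t. dist t ?p < d2 \<Longrightarrow> cmod (G (- cnj (?e t))) \<le> cmod (G (- cnj (?e ?p))) + 1"
      using ex[OF 2] by blast
    show thesis
    proof (rule that[of "min d1 d2" "max (cmod (G (?e ?p)) + 1) (cmod (G (- cnj (?e ?p))) + 1)"])
      show "min d1 d2 > 0" using d1 d2 by simp
      fix t assume t: "t \<in> ustrip" "dist t ?p < min d1 d2"
      show "cmod (G (cbrt_sinh t)) \<le> max (cmod (G (?e ?p)) + 1) (cmod (G (- cnj (?e ?p))) + 1)"
      proof (cases "0 \<le> Re t")
        case True
        hence "cbrt_sinh t = ?e t" using t by (intro cbrt_sinh_quarter) (auto simp: ustrip_def)
        thus ?thesis using d1(2)[of t] t(2) by auto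
      next
        case False
        let ?s = "- cnj t"
        have "cbrt_sinh ?s = ?e ?s" using t False by (intro cbrt_sinh_quarter) (auto simp: ustrip_def)
        moreover have "cbrt_sinh ?s = - cnj (cbrt_sinh t)"
          using t by (subst cbrt_sinh_minus) (auto simp: ustrip_def strip_def cbrt_sinh_cnj)
        ultimately have q: "cbrt_sinh t = - cnj (?e ?s)" by (metis complex_cnj_cnj complex_cnj_minus minus_minus)
        have sp: "?s - ?p = cnj (- (t - ?p))" by (simp add: complex_eq_iff)
        have "dist ?s ?p = cmod (cnj (- (t - ?p)))" unfolding dist_norm sp ..
        also have "\<dots> = dist t ?p" unfolding complex_mod_cnj norm_minus_cancel dist_norm ..
        finally show ?thesis using d2(2)[of ?s] t(2) unfolding q by auto
      qed
    qed
  qed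
  \<comment> \<open>Both branches run into \<open>2 pi i\<close>, and the integrand is bounded
    there, so the difference of the primitive is of the order of the distance
    \<open>2 * x\<close>.\<close>
  have D0: "(D \<longlongrightarrow> 0) (at_right 0)"
  proof (rule Lim_null_comparison)
    have p: "Complex 0 (2 * pi) = 2 * of_real pi * \<i>" "Complex (- 0) (2 * pi) = 2 * of_real pi * \<i>"
      by (simp_all add: complex_eq_iff)
    have "((\<lambda>x. Complex x (level_curve x)) \<longlongrightarrow> 2 * of_real pi * \<i>) (at_right 0)"
      unfolding p(1)[symmetric] by (intro tendsto_Complex level_curve_tendsto tendsto_ident_at)
    hence e1: "eventually (\<lambda>x. dist (Complex x (level_curve x)) (2 * of_real pi * \<i>) < \<epsilon>) (at_right 0)"
      using \<epsilon> by (rule tendstoD)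
    have "((\<lambda>x. Complex (- x) (level_curve x)) \<longlongrightarrow> 2 * of_real pi * \<i>) (at_right 0)"
      unfolding p(2)[symmetric] by (intro tendsto_Complex level_curve_tendsto tendsto_minus tendsto_ident_at)
    hence e2: "eventually (\<lambda>x. dist (Complex (- x) (level_curve x)) (2 * of_real pi * \<i>) < \<epsilon>) (at_right 0)"
      using \<epsilon> by (rule tendstoD)
    from e1 e2 show "eventually (\<lambda>x. norm (D x) \<le> M * (2 * x)) (at_right 0)"
      using eventually_at_right_less[of 0]
    proof eventually_elim
      case (elim x)
      let ?S = "ustrip \<inter> ball (2 * of_real pi * \<i>) \<epsilon>"
      have "cmod (\<Psi> (Complex x (level_curve x)) - \<Psi> (Complex (- x) (level_curve x)))
          \<le> M * cmod (Complex x (level_curve x) - Complex (- x) (level_curve x))"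
      proof (rule field_differentiable_bound[where S = ?S])
        show "convex ?S" by (intro convex_Int ustrip_props convex_ball)
        show "(\<Psi> has_field_derivative G (cbrt_sinh t)) (at t within ?S)" if "t \<in> ?S" for t
          using \<Psi> that by (auto intro: has_field_derivative_at_within)
        show "cmod (G (cbrt_sinh t)) \<le> M" if "t \<in> ?S" for t
          using M[of t] that by (auto simp: dist_commute)
      qed (use elim tU in \<open>auto simp: dist_commute\<close>)
      also have "Complex x (level_curve x) - Complex (- x) (level_curve x) = of_real (2 * x)" by (simp add: complex_eq_iff)
      finally show ?case using elim by (simp only: norm_of_real D_def)
    qed
    have "((\<lambda>x. M * (2 * x)) \<longlongrightarrow> M * (2 * 0)) (at_right 0)" by (intro tendsto_intros)
    thus "((\<lambda>x. M * (2 * x)) \<longlongrightarrow> 0) (at_right 0)" by simp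
  qed
  have DX: "D X = 2 * (LINT x:{0<..X}|lborel. f x)" if X: "X > 0" for X
  proof -
    \<comment> \<open>At \<open>0\<close>, where \<open>level_curve\<close> takes a default value,
      the limit just found is inserted, so that the fundamental theorem applies on the closed
      interval.\<close>
    define E where "E = (\<lambda>x. if x \<le> 0 then 0 else D x)"
    have Eder: "(E has_vector_derivative 2 * f x) (at x)" if "x > 0" for x
      by (rule has_vector_derivative_transform_within_open[OF D[OF that], of "{0<..}"]) (use that in \<open>auto simp: E_def\<close>)
    have "((\<lambda>x. 2 * f x) has_integral E X - E 0) {0..X}"
    proof (rule fundamental_theorem_of_calculus_interior)
      show "continuous_on {0..X} E"
        unfolding continuous_on_eq_continuous_within
      proof
        fix x assume x: "x \<in> {0..X}"
        show "continuous (at x within {0..X}) E"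
        proof (cases "x = 0")
          case True
          have "(E \<longlongrightarrow> 0) (at_right 0)"
            by (rule Lim_transform_eventually[OF D0]) (auto simp: E_def eventually_at_right_less[THEN eventually_mono])
          thus ?thesis using True X by (simp add: continuous_within at_within_Icc_at_right E_def)
        next
          case False
          thus ?thesis using Eder[of x] x
            by (auto intro: continuous_at_imp_continuous_at_within has_vector_derivative_continuous)
        qed
      qed
    qed (use X Eder in auto)
    hence "((\<lambda>x. 2 * f x) has_integral D X) {0..X}" using X by (simp add: E_def)
    moreover have "negligible {x \<in> {0..X} - {0<..X}. 2 * f x \<noteq> 0}"
      by (rule negligible_subset[of "{0}"]) auto
    moreover have "negligible {x \<in> {0<..X} - {0..X}. 2 * f x \<noteq> 0}"
      by (rule negligible_subset[of "{0}"]) auto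
    ultimately have "((\<lambda>x. 2 * f x) has_integral D X) {0<..X}"
      using has_integral_spike_set_eq[of "{0..X}" "{0<..X}" "\<lambda>x. 2 * f x" "D X"] by simp
    hence "integral {0<..X} (\<lambda>x. 2 * f x) = D X" by (rule integral_unique)
    moreover have "set_integrable lborel {0<..X} (\<lambda>x. 2 * f x)"
      by (rule set_integrable_subset[of _ "{0<..}"]) (use int in \<open>auto simp: f_def intro!: set_integrable_mult_right\<close>)
    hence "(LINT x:{0<..X}|lborel. 2 * f x) = integral {0<..X} (\<lambda>x. 2 * f x)"
      by (rule set_borel_integral_eq_integral(2))
    ultimately have "(LINT x:{0<..X}|lborel. 2 * f x) = D X" by (rule trans[rotated])
    thus ?thesis by simp
  qed
  have Dlim: "(D \<longlongrightarrow> 2 * (LINT x:{0<..}|lborel. f x)) at_top"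
  proof -
    have "((\<lambda>X. \<integral>x. indicator {..X} x *\<^sub>R (indicator {0<..} x *\<^sub>R f x) \<partial>lborel) \<longlongrightarrow> (\<integral>x. indicator {0<..} x *\<^sub>R f x \<partial>lborel)) at_top"
      by (rule tendsto_integral_at_top) (use int in \<open>auto simp: set_integrable_def f_def\<close>)
    moreover have "(\<lambda>x. indicator {..X} x *\<^sub>R (indicator {0<..} x *\<^sub>R f x)) = (\<lambda>x. indicator {0<..X} x *\<^sub>R f x)" for X
      by (auto simp: indicator_def)
    ultimately have "((\<lambda>X. LINT x:{0<..X}|lborel. f x) \<longlongrightarrow> (LINT x:{0<..}|lborel. f x)) at_top"
      by (simp add: set_lebesgue_integral_def)
    hence "((\<lambda>X. 2 * (LINT x:{0<..X}|lborel. f x)) \<longlongrightarrow> 2 * (LINT x:{0<..}|lborel. f x)) at_top"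
      by (intro tendsto_intros)
    thus ?thesis
      by (rule Lim_transform_eventually) (use DX in \<open>auto intro: eventually_mono[OF eventually_gt_at_top[of 0]]\<close>)
  qed
  let ?I = "\<lambda>X. contour_integral (linepath (Complex (- X) h) (Complex X h)) (\<lambda>t. G (cbrt_sinh t))"
  have hU: "Complex x h \<in> ustrip" for x using h by (simp add: ustrip_def)
  have I: "?I X = \<Psi> (Complex X h) - \<Psi> (Complex (- X) h)" for X
  proof -
    have "closed_segment (Complex (- X) h) (Complex X h) \<subseteq> ustrip"
      using hU ustrip_props(1) by (simp add: closed_segment_subset)
    from contour_integral_primitive[of ustrip \<Psi> "\<lambda>t. G (cbrt_sinh t)" "linepath (Complex (- X) h) (Complex X h)"] this
    show ?thesis using \<Psi> by (intro contour_integral_unique) (auto intro: has_field_derivative_at_within)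
  qed
  \<comment> \<open>On the vertical pieces, of length below \<open>2 pi\<close>, the growth of the
    cube root makes the integrand at most
    \<open>2 * \<bar>C\<bar> * exp (- (X / 3))\<close>.\<close>
  have "((\<lambda>X. ?I X - D X) \<longlongrightarrow> 0) at_top"
  proof (rule Lim_null_comparison)
    have "eventually (\<lambda>X::real. exp (X / 3) / 2 \<ge> R') at_top" by real_asymp
    thus "eventually (\<lambda>X. norm (?I X - D X) \<le> 2 * (2 * \<bar>C\<bar> * exp (- (X / 3)) * (2 * pi))) at_top"
      using eventually_ge_at_top[of 5]
    proof eventually_elim
      case (elim X)
      have b: "cmod (\<Psi> (Complex c h) - \<Psi> (Complex c (level_curve X))) \<le> 2 * \<bar>C\<bar> * exp (- (X / 3)) * (2 * pi)"
        if c: "\<bar>c\<bar> = X" for c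
      proof -
        let ?S = "ustrip \<inter> ({t. Re t \<le> c} \<inter> {t. Re t \<ge> c})"
        have "cmod (\<Psi> (Complex c h) - \<Psi> (Complex c (level_curve X))) \<le> 2 * \<bar>C\<bar> * exp (- (X / 3)) * cmod (Complex c h - Complex c (level_curve X))"
        proof (rule field_differentiable_bound[where S = ?S])
          show "convex ?S"
            by (intro convex_Int ustrip_props convex_halfspace_Re_le convex_halfspace_Re_ge)
          show "(\<Psi> has_field_derivative G (cbrt_sinh t)) (at t within ?S)" if "t \<in> ?S" for t
            using \<Psi> that by (auto intro: has_field_derivative_at_within)
          fix t assume t: "t \<in> ?S"
          hence "Re t = c" by auto
          hence q: "exp (X / 3) / 2 \<le> cmod (cbrt_sinh t)"
            using norm_cbrt_sinh_lower[of t] t ustrip_props(3) c elim by auto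
          hence "R \<le> cmod (cbrt_sinh t)" using elim by (simp add: R'_def)
          hence "cmod (G (cbrt_sinh t)) \<le> C / cmod (cbrt_sinh t)" using img t by (intro bnd) auto
          also have "\<dots> \<le> \<bar>C\<bar> / (exp (X / 3) / 2)"
            using q by (intro frac_le) auto
          also have "\<dots> = 2 * \<bar>C\<bar> * exp (- (X / 3))" by (simp add: exp_minus field_simps)
          finally show "cmod (G (cbrt_sinh t)) \<le> 2 * \<bar>C\<bar> * exp (- (X / 3))" .
        qed (use hU tU[of X] elim in auto)
        also have "Complex c h - Complex c (level_curve X) = of_real (h - level_curve X) * \<i>" by (simp add: complex_eq_iff)
        also have "cmod (of_real (h - level_curve X) * \<i>) = \<bar>h - level_curve X\<bar>" by (simp only: norm_mult norm_of_real) simp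
        also have "2 * \<bar>C\<bar> * exp (- (X / 3)) * \<bar>h - level_curve X\<bar> \<le> 2 * \<bar>C\<bar> * exp (- (X / 3)) * (2 * pi)"
          using h level_curve_bounds[of X] elim pi_gt_zero by (intro mult_left_mono) auto
        finally show ?thesis .
      qed
      have "?I X - D X = (\<Psi> (Complex X h) - \<Psi> (Complex X (level_curve X))) - (\<Psi> (Complex (- X) h) - \<Psi> (Complex (- X) (level_curve X)))"
        by (simp add: I D_def)
      also have "norm \<dots> \<le> 2 * \<bar>C\<bar> * exp (- (X / 3)) * (2 * pi) + 2 * \<bar>C\<bar> * exp (- (X / 3)) * (2 * pi)"
        by (rule order_trans[OF norm_triangle_ineq4 add_mono]; rule b) (use elim in auto)
      finally show ?case by (simp add: mult_ac)
    qed
    have "((\<lambda>X::real. exp (- (X / 3))) \<longlongrightarrow> 0) at_top" by real_asymp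
    hence "((\<lambda>X::real. 2 * (2 * \<bar>C\<bar> * exp (- (X / 3)) * (2 * pi))) \<longlongrightarrow> 2 * (2 * \<bar>C\<bar> * 0 * (2 * pi))) at_top"
      by (intro tendsto_intros)
    thus "((\<lambda>X. 2 * (2 * \<bar>C\<bar> * exp (- (X / 3)) * (2 * pi))) \<longlongrightarrow> 0) at_top" by simp
  qed
  from tendsto_add[OF this Dlim]
  show "((\<lambda>X. contour_integral (linepath (Complex (- X) h) (Complex X h)) (\<lambda>t. G (cbrt_sinh t)))
           \<longlongrightarrow> 2 * (LINT x:{0<..}|lborel. G (\<i> * of_real (rho x)))) at_top" by (simp add: f_def)
qed


text \<open>Residue theorem on a box around \<open>p\<close>: oddness of \<open>cbrt_sinh\<close>
  turns the lower edge into the upper edge with \<open>G (- z)\<close> in place of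
  \<open>G z\<close>, and the vertical edges vanish in the limit. What remains is
  \<open>boundary_integral\<close> for \<open>G2\<close>.\<close>

lemma residue_boundary_integral:
  assumes G: "G holomorphic_on - {cbrt_sinh (of_real p)}"
    and bnd: "\<And>z. cmod z \<ge> R \<Longrightarrow> cmod (G z) \<le> C / cmod z"
    and inj: "\<And>x. cbrt_sinh (of_real x) = cbrt_sinh (of_real p) \<Longrightarrow> x = p"
  shows "2 * of_real pi * \<i> * residue (\<lambda>t. G (cbrt_sinh t)) (of_real p) =
     2 * (LINT x:{0<..}|lborel. G (- \<i> * of_real (rho x)) - G (\<i> * of_real (rho x)))"
    and "set_integrable lborel {0<..} (\<lambda>x. G (- \<i> * of_real (rho x)) - G (\<i> * of_real (rho x)))"
proof -
  define w where "w = cbrt_sinh (of_real p)"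
  define G2 where "G2 = (\<lambda>z. G (- z) - G z)"
  have w: "Im w = 0" by (simp add: w_def cbrt_sinh_of_real)
  have "(\<lambda>z. G (- z)) holomorphic_on {z. Im z > 0}"
    by (rule holomorphic_on_compose_gen[of uminus _ G, unfolded comp_def, OF _ G])
       (use w in \<open>auto intro!: holomorphic_intros simp: w_def[symmetric]\<close>)
  moreover have "G holomorphic_on {z. Im z > 0}"
    by (rule holomorphic_on_subset[OF G]) (use w in \<open>auto simp: w_def[symmetric]\<close>)
  ultimately have G2: "G2 holomorphic_on {z. Im z > 0}"
    unfolding G2_def by (intro holomorphic_intros)
  have G2b: "cmod (G2 z) \<le> (2 * C) / cmod z" if "cmod z \<ge> R" for z
    using norm_triangle_ineq4[of "G (- z)" "G z"] bnd[of z] bnd[of "- z"] that by (simp add: G2_def)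
  let ?J = "LINT x:{0<..}|lborel. G2 (\<i> * of_real (rho x))"
  have int: "set_integrable lborel {0<..} (\<lambda>x. G2 (\<i> * of_real (rho x)))"
    and lim: "((\<lambda>X. contour_integral (linepath (Complex (- X) 1) (Complex X 1)) (\<lambda>t. G2 (cbrt_sinh t))) \<longlongrightarrow> 2 * ?J) at_top"
    using boundary_integral[OF G2, of R "2 * C" 1] G2b pi_gt3 by auto
  show "set_integrable lborel {0<..} (\<lambda>x. G (- \<i> * of_real (rho x)) - G (\<i> * of_real (rho x)))"
    using int by (simp add: G2_def)
  define g where "g = (\<lambda>t. G (cbrt_sinh t))"
  have ne: "cbrt_sinh t \<noteq> w" if "t \<in> strip - {of_real p}" for t
  proof (cases "Im t = 0")
    case True
    hence "t = of_real (Re t)" by (simp add: complex_eq_iff)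
    thus ?thesis using inj[of "Re t"] that by (auto simp: w_def)
  next
    case False
    have "Im (cbrt_sinh t) \<noteq> 0"
    proof (cases "Im t > 0")
      case True thus ?thesis using Im_cbrt_sinh_pos[of t] that by (auto simp: strip_def)
    next
      case False
      hence "Im (cbrt_sinh (- t)) > 0" using Im_cbrt_sinh_pos[of "- t"] that \<open>Im t \<noteq> 0\<close> by (auto simp: strip_def)
      thus ?thesis using that by (simp add: cbrt_sinh_minus)
    qed
    thus ?thesis using w by auto
  qed
  have g: "g holomorphic_on strip - {of_real p}"
    unfolding g_def
    by (rule holomorphic_on_compose_gen[of cbrt_sinh _ G, unfolded comp_def, OF holomorphic_on_subset[OF cbrt_sinh_holomorphic] G])
       (use ne in \<open>auto simp: w_def[symmetric]\<close>)
  let ?r = "2 * of_real pi * \<i> * residue g (of_real p)"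
  let ?T = "\<lambda>X. contour_integral (linepath (Complex (- X) 1) (Complex X 1)) (\<lambda>t. G2 (cbrt_sinh t))"
  let ?V = "\<lambda>X. contour_integral (linepath (Complex X (-1)) (Complex X 1)) g + contour_integral (linepath (Complex (- X) 1) (Complex (- X) (-1))) g"
  have eq: "?r = ?T X + ?V X" if X: "X > \<bar>p\<bar>" for X
  proof -
    let ?a1 = "Complex (- X) (-1)" and ?a2 = "Complex X (-1)" and ?a3 = "Complex X 1" and ?a4 = "Complex (- X) 1"
    have box: "path_image (rectpath ?a1 ?a3) \<subseteq> cbox ?a1 ?a3"
      using X by (intro path_image_rectpath_subset_cbox) auto
    have sub: "cbox ?a1 ?a3 \<subseteq> strip" using pi_gt3 by (auto simp: in_cbox_complex_iff strip_def)
    have pi': "path_image (rectpath ?a1 ?a3) \<subseteq> strip - {of_real p}"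
    proof -
      have "of_real p \<in> box ?a1 ?a3" using X by (auto simp: in_box_complex_iff)
      thus ?thesis using box sub X by (auto simp: path_image_rectpath_cbox_minus_box)
    qed
    have "contour_integral (rectpath ?a1 ?a3) g = 2 * pi * \<i> * (\<Sum>q\<in>{complex_of_real p}. winding_number (rectpath ?a1 ?a3) q * residue g q)"
    proof (rule Residue_theorem)
      show "connected strip" using strip_props(1) by (rule convex_connected)
      show "\<forall>z. z \<notin> strip \<longrightarrow> winding_number (rectpath ?a1 ?a3) z = 0"
        using sub X by (auto intro!: winding_number_rectpath_outside)
    qed (use strip_props(2) g pi' in auto)
    moreover have "winding_number (rectpath ?a1 ?a3) (of_real p) = 1"
      by (rule winding_number_rectpath) (use X in \<open>auto simp: in_box_complex_iff\<close>)
    ultimately have r: "contour_integral (rectpath ?a1 ?a3) g = ?r" by simp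
    have segs: "closed_segment ?a1 ?a2 \<subseteq> strip - {of_real p}" "closed_segment ?a2 ?a3 \<subseteq> strip - {of_real p}"
      "closed_segment ?a3 ?a4 \<subseteq> strip - {of_real p}" "closed_segment ?a4 ?a1 \<subseteq> strip - {of_real p}"
    proof -
      have "path_image (rectpath ?a1 ?a3) = closed_segment ?a1 ?a2 \<union> (closed_segment ?a2 ?a3 \<union> (closed_segment ?a3 ?a4 \<union> closed_segment ?a4 ?a1))"
        by (simp add: rectpath_def Let_def path_image_join)
      with pi' show "closed_segment ?a1 ?a2 \<subseteq> strip - {of_real p}" "closed_segment ?a2 ?a3 \<subseteq> strip - {of_real p}"
        "closed_segment ?a3 ?a4 \<subseteq> strip - {of_real p}" "closed_segment ?a4 ?a1 \<subseteq> strip - {of_real p}"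
        by blast+
    qed
    have gc: "continuous_on (strip - {of_real p}) g" using g by (rule holomorphic_on_imp_continuous_on)
    have ci: "g contour_integrable_on linepath ?a1 ?a2" "g contour_integrable_on linepath ?a2 ?a3"
      "g contour_integrable_on linepath ?a3 ?a4" "g contour_integrable_on linepath ?a4 ?a1"
      using segs by (auto intro!: contour_integrable_continuous_linepath continuous_on_subset[OF gc])
    have "contour_integral (rectpath ?a1 ?a3) g = contour_integral (linepath ?a1 ?a2) g + (contour_integral (linepath ?a2 ?a3) g
      + (contour_integral (linepath ?a3 ?a4) g + contour_integral (linepath ?a4 ?a1) g))"
      unfolding rectpath_def Let_def
      using ci by (simp add: contour_integral_join valid_path_join contour_integrable_join)
    moreover have "contour_integral (linepath ?a1 ?a2) g + contour_integral (linepath ?a3 ?a4) g = ?T X"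
    proof -
      have 1: "contour_integral (linepath ?a1 ?a2) g = contour_integral (linepath ?a4 ?a3) (\<lambda>t. G (- cbrt_sinh t))"
      proof -
        have "contour_integral (linepath ?a3 ?a4) (\<lambda>t. G (- cbrt_sinh t)) = - contour_integral (linepath ?a1 ?a2) g"
        proof -
          have Geq: "G (- cbrt_sinh (linepath ?a3 ?a4 s)) = g (linepath ?a1 ?a2 s)" if s: "s \<in> {0..1}" for s
          proof -
            have l: "linepath ?a3 ?a4 s = - linepath ?a1 ?a2 s"
              by (simp add: linepath_def complex_eq_iff algebra_simps)
            have "linepath ?a1 ?a2 s \<in> strip"
              using segs(1) s linepath_in_path[of s] by auto
            thus ?thesis unfolding l by (simp add: cbrt_sinh_minus g_def)
          qed
          have veq: "?a4 - ?a3 = - (?a2 - ?a1)" by (simp add: complex_eq_iff)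
          have "integral {0..1} (\<lambda>s. G (- cbrt_sinh (linepath ?a3 ?a4 s)) * (?a4 - ?a3))
              = integral {0..1} (\<lambda>s. - (g (linepath ?a1 ?a2 s) * (?a2 - ?a1)))"
            by (intro integral_cong) (simp only: Geq veq mult_minus_right)
          also have "\<dots> = - integral {0..1} (\<lambda>s. g (linepath ?a1 ?a2 s) * (?a2 - ?a1))"
            by (rule integral_neg)
          finally show ?thesis
            unfolding contour_integral_integral vector_derivative_linepath_at .
        qed
        moreover have "contour_integral (linepath ?a3 ?a4) (\<lambda>t. G (- cbrt_sinh t)) = - contour_integral (linepath ?a4 ?a3) (\<lambda>t. G (- cbrt_sinh t))"
          using contour_integral_reversepath[of "linepath ?a4 ?a3" "\<lambda>t. G (- cbrt_sinh t)"] by simp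
        ultimately show ?thesis by simp
      qed
      have 2: "contour_integral (linepath ?a3 ?a4) g = - contour_integral (linepath ?a4 ?a3) g"
        using contour_integral_reversepath[of "linepath ?a4 ?a3" g] by simp
      have seg: "closed_segment ?a4 ?a3 \<subseteq> strip - {of_real p}"
        using segs(3) by (simp add: closed_segment_commute)
      have i1: "g contour_integrable_on linepath ?a4 ?a3"
        using seg by (intro contour_integrable_continuous_linepath continuous_on_subset[OF gc])
      have i2: "(\<lambda>t. G (- cbrt_sinh t)) contour_integrable_on linepath ?a4 ?a3"
      proof (intro contour_integrable_continuous_linepath)
        have im: "- t \<in> strip - {of_real p}" if "t \<in> closed_segment ?a4 ?a3" for t
        proof -
          have "closed_segment ?a4 ?a3 \<subseteq> {t. Im t \<le> 1} \<inter> {t. Im t \<ge> 1}"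
            by (intro closed_segment_subset convex_Int convex_halfspace_Im_le convex_halfspace_Im_ge) auto
          from subsetD[OF this that] have "Im t = 1" by simp
          hence "- t \<noteq> of_real p" by (auto simp: complex_eq_iff)
          with \<open>Im t = 1\<close> show ?thesis using pi_gt3 by (auto simp: strip_def)
        qed
        have "continuous_on (closed_segment ?a4 ?a3) (\<lambda>t. g (- t))"
          by (rule continuous_on_compose2[OF gc]) (use im in \<open>auto intro!: continuous_intros\<close>)
        moreover have "g (- t) = G (- cbrt_sinh t)" if "t \<in> closed_segment ?a4 ?a3" for t
          using seg that by (auto simp: g_def cbrt_sinh_minus)
        ultimately show "continuous_on (closed_segment ?a4 ?a3) (\<lambda>t. G (- cbrt_sinh t))"
          by (simp cong: continuous_on_cong)
      qed
      show ?thesis unfolding 1 2 G2_def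
        using contour_integral_diff[OF i2 i1] by (simp add: g_def)
    qed
    ultimately show ?thesis using r by (simp add: algebra_simps)
  qed
  have "(?V \<longlongrightarrow> 0) at_top"
  proof (rule Lim_null_comparison)
    have "eventually (\<lambda>X::real. exp (X / 3) / 2 \<ge> R) at_top" by real_asymp
    thus "eventually (\<lambda>X. norm (?V X) \<le> 2 * (2 * \<bar>C\<bar> * exp (- (X / 3)) * 2)) at_top"
      using eventually_ge_at_top[of 5] eventually_gt_at_top[of "\<bar>p\<bar>"]
    proof eventually_elim
      case (elim X)
      have b: "cmod (contour_integral (linepath (Complex c a) (Complex c b)) g) \<le> 2 * \<bar>C\<bar> * exp (- (X / 3)) * cmod (Complex c b - Complex c a)"
        if c: "\<bar>c\<bar> = X" and ab: "\<bar>a\<bar> \<le> 1" "\<bar>b\<bar> \<le> 1" for a b c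
      proof (rule contour_integral_bound_linepath)
        have "closed_segment (Complex c a) (Complex c b) \<subseteq> {t. Re t \<le> c} \<inter> {t. Re t \<ge> c} \<inter> strip"
        proof (rule closed_segment_subset)
          show "convex ({t. Re t \<le> c} \<inter> {t. Re t \<ge> c} \<inter> strip)"
            by (intro convex_Int strip_props convex_halfspace_Re_le convex_halfspace_Re_ge)
        qed (use ab pi_gt3 in \<open>auto simp: strip_def\<close>)
        hence "t \<in> {t. Re t \<le> c} \<inter> {t. Re t \<ge> c} \<inter> strip" if "t \<in> closed_segment (Complex c a) (Complex c b)" for t
          using that by (rule subsetD)
        hence seg: "Re t = c" "t \<in> strip" if "t \<in> closed_segment (Complex c a) (Complex c b)" for t
          using that by fastforce+
        show "g contour_integrable_on linepath (Complex c a) (Complex c b)"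
          by (rule contour_integrable_continuous_linepath, rule continuous_on_subset[OF holomorphic_on_imp_continuous_on[OF g]])
             (use seg seg(1)[of "of_real p"] c elim in auto)
        fix t assume t: "t \<in> closed_segment (Complex c a) (Complex c b)"
        hence q: "exp (X / 3) / 2 \<le> cmod (cbrt_sinh t)"
          using norm_cbrt_sinh_lower[of t] seg[OF t] c elim by auto
        hence "cmod (G (cbrt_sinh t)) \<le> C / cmod (cbrt_sinh t)" using elim by (intro bnd) auto
        also have "\<dots> \<le> \<bar>C\<bar> / (exp (X / 3) / 2)"
          using q by (intro frac_le) auto
        also have "\<dots> = 2 * \<bar>C\<bar> * exp (- (X / 3))" by (simp add: exp_minus field_simps)
        finally show "cmod (g t) \<le> 2 * \<bar>C\<bar> * exp (- (X / 3))" by (simp add: g_def)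
      qed auto
      have n: "Complex X 1 - Complex X (-1) = 2 * \<i>" "Complex (- X) (-1) - Complex (- X) 1 = - (2 * \<i>)"
        by (simp_all add: complex_eq_iff)
      have "norm (?V X) \<le> 2 * \<bar>C\<bar> * exp (- (X / 3)) * cmod (Complex X 1 - Complex X (-1))
          + 2 * \<bar>C\<bar> * exp (- (X / 3)) * cmod (Complex (- X) (-1) - Complex (- X) 1)"
        by (rule order_trans[OF norm_triangle_ineq add_mono]; rule b) (use elim in auto)
      thus ?case unfolding n by (simp add: norm_mult)
    qed
    have "((\<lambda>X::real. exp (- (X / 3))) \<longlongrightarrow> 0) at_top" by real_asymp
    hence "((\<lambda>X::real. 2 * (2 * \<bar>C\<bar> * exp (- (X / 3)) * 2)) \<longlongrightarrow> 2 * (2 * \<bar>C\<bar> * 0 * 2)) at_top"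
      by (intro tendsto_intros)
    thus "((\<lambda>X. 2 * (2 * \<bar>C\<bar> * exp (- (X / 3)) * 2)) \<longlongrightarrow> 0) at_top" by simp
  qed
  from tendsto_add[OF lim this] have "((\<lambda>X. ?T X + ?V X) \<longlongrightarrow> 2 * ?J) at_top" by simp
  hence "((\<lambda>X::real. ?r) \<longlongrightarrow> 2 * ?J) at_top"
    by (rule Lim_transform_eventually) (use eq in \<open>auto intro: eventually_mono[OF eventually_gt_at_top[of "\<bar>p\<bar>"]]\<close>)
  hence "?r = 2 * ?J" by (rule tendsto_unique[OF trivial_limit_at_top_linorder tendsto_const])
  thus "2 * of_real pi * \<i> * residue (\<lambda>t. G (cbrt_sinh t)) (of_real p) =
     2 * (LINT x:{0<..}|lborel. G (- \<i> * of_real (rho x)) - G (\<i> * of_real (rho x)))"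
    by (simp add: g_def G2_def)
qed

section \<open>The two residues needed: a simple pole on the positive axis and a multiple pole at
  the origin\<close>

lemma sinh_minus_self_strict_mono:
  assumes "0 \<le> x" "x < y"
  shows "sinh x - x < sinh y - (y::real)"
proof (rule DERIV_pos_imp_increasing_open[OF assms(2)])
  fix z assume x: "x < z" "z < y"
  have "((\<lambda>y. sinh y - y) has_real_derivative cosh z - 1) (at z)"
    by (auto intro!: derivative_eq_intros)
  moreover have "cosh z - 1 > 0" using x assms cosh_real_nonneg_less_iff[of 0 z] by simp
  ultimately show "\<exists>d. ((\<lambda>y. sinh y - y) has_real_derivative d) (at z) \<and> d > 0" by blast
qed (auto intro!: continuous_intros)

lemma cbrt_sinh_of_real_inj:
  assumes "s \<ge> 0" "cbrt_sinh (of_real x) = cbrt_sinh (of_real s)"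
  shows "x = s"
proof -
  have e: "sinh x - x = sinh s - s" using assms(2) by (simp add: cbrt_sinh_of_real)
  have "0 \<le> sinh s - s" using sinh_minus_self_strict_mono[of 0 s] assms(1) by (cases "s = 0") auto
  have "x \<ge> 0"
  proof (rule ccontr)
    assume "\<not> x \<ge> 0"
    hence "- x < sinh (- x)" by (intro sinh_gt_self) auto
    thus False using e \<open>0 \<le> sinh s - s\<close> by simp
  qed
  thus ?thesis using sinh_minus_self_strict_mono[of x s] sinh_minus_self_strict_mono[of s x] e assms(1)
    by (cases x s rule: linorder_cases) auto
qed

definition cbrt_sinh_real :: "real \<Rightarrow> real" where "cbrt_sinh_real s = root 3 (sinh s - s)"

lemma cbrt_sinh_real_pos: "s > 0 \<Longrightarrow> cbrt_sinh_real s > 0"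
  using sinh_gt_self[of s] by (simp add: cbrt_sinh_real_def)

lemma cbrt_sinh_real_cubed: "cbrt_sinh_real s ^ 3 = sinh s - s"
  by (simp add: cbrt_sinh_real_def odd_real_root_pow)

lemma cbrt_sinh_has_derivative_real:
  assumes "s > 0"
  shows "(cbrt_sinh has_field_derivative of_real ((cosh s - 1) / (3 * cbrt_sinh_real s ^ 2))) (at (of_real s))"
proof -
  define d where "d = deriv cbrt_sinh (of_real s)"
  have d: "(cbrt_sinh has_field_derivative d) (at (of_real s))"
    unfolding d_def by (rule holomorphic_derivI[OF cbrt_sinh_holomorphic strip_props(2,4)])
  have "((\<lambda>t. cbrt_sinh t ^ 3) has_field_derivative 3 * cbrt_sinh (of_real s) ^ 2 * d) (at (of_real s))"
    using DERIV_power[OF d, of 3] by (simp add: mult_ac)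
  moreover have "eventually (\<lambda>t. t \<in> strip) (nhds (complex_of_real s))"
    using strip_props(2,4) by (rule eventually_nhds_in_open)
  hence "eventually (\<lambda>t. cbrt_sinh t ^ 3 = sinh_defect t) (nhds (complex_of_real s))"
    by (rule eventually_mono) (rule cbrt_sinh_cubed)
  ultimately have "(sinh_defect has_field_derivative 3 * cbrt_sinh (of_real s) ^ 2 * d) (at (of_real s))"
    by (subst (asm) DERIV_cong_ev[OF refl _ refl])
  moreover have "(sinh_defect has_field_derivative cosh (of_real s) - 1) (at (of_real s))"
    unfolding sinh_defect_def[abs_def] by (auto intro!: derivative_eq_intros)
  ultimately have e: "3 * cbrt_sinh (of_real s) ^ 2 * d = cosh (of_real s) - 1" by (rule DERIV_unique)
  have "cosh (complex_of_real s) = of_real (cosh s)" by (simp add: cosh_def exp_of_real[symmetric] scaleR_conv_of_real)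
  hence "3 * of_real (cbrt_sinh_real s) ^ 2 * d = of_real (cosh s - 1)"
    using e by (simp add: cbrt_sinh_of_real cbrt_sinh_real_def)
  hence "d = of_real ((cosh s - 1) / (3 * cbrt_sinh_real s ^ 2))"
    using cbrt_sinh_real_pos[OF assms] by (simp add: field_simps)
  thus ?thesis using d by simp
qed

text \<open>The residue formula for \<open>G z = 1 / (z - w)\<close> with
  \<open>w = cbrt_sinh_real s\<close>: the residue is the reciprocal of the derivative of the cube
  root, that is \<open>ds/dw\<close>, and the boundary values combine to
  \<open>2 \<i> rho / (rho^2 + w^2)\<close>.\<close>

lemma inverse_derivative_eq_integral_rho:
  assumes s: "s > 0"
  shows "(2 / pi) * (LINT x:{0<..}|lborel. rho x / (rho x ^ 2 + cbrt_sinh_real s ^ 2)) = 3 * cbrt_sinh_real s ^ 2 / (cosh s - 1)"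
proof -
  let ?q = "cbrt_sinh_real s"
  let ?w = "complex_of_real ?q"
  have q: "?q > 0" by (rule cbrt_sinh_real_pos[OF s])
  have w: "cbrt_sinh (of_real s) = ?w" by (simp add: cbrt_sinh_of_real cbrt_sinh_real_def)
  have cosh: "cosh s - 1 > 0" using cosh_real_nonneg_less_iff[of 0 s] s by simp
  define G where "G = (\<lambda>z. 1 / (z - ?w))"
  have G: "G holomorphic_on - {cbrt_sinh (of_real s)}" unfolding G_def w by (intro holomorphic_intros) auto
  have bnd: "cmod (G z) \<le> 2 / cmod z" if "cmod z \<ge> 2 * ?q" for z
  proof -
    have "cmod z - ?q \<le> cmod (z - ?w)" using norm_triangle_ineq2[of z ?w] q by simp
    hence "cmod z / 2 \<le> cmod (z - ?w)" using that by linarith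
    moreover have "cmod z > 0" using that q by linarith
    ultimately have "1 / cmod (z - ?w) \<le> 1 / (cmod z / 2)" by (intro frac_le) auto
    thus ?thesis by (simp add: G_def norm_divide)
  qed
  have "residue (\<lambda>t. G (cbrt_sinh t)) (of_real s) = residue (\<lambda>t. 1 / (cbrt_sinh t - ?w)) (of_real s)" by (simp add: G_def)
  also have "\<dots> = 1 / of_real ((cosh s - 1) / (3 * ?q ^ 2))"
  proof (rule residue_simple_pole_deriv)
    show "(\<lambda>t. cbrt_sinh t - ?w) holomorphic_on strip" by (intro holomorphic_intros cbrt_sinh_holomorphic)
    show "connected strip" using strip_props(1) by (rule convex_connected)
    show "((\<lambda>t. cbrt_sinh t - ?w) has_field_derivative of_real ((cosh s - 1) / (3 * ?q ^ 2))) (at (of_real s))"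
      using DERIV_diff[OF cbrt_sinh_has_derivative_real[OF s] DERIV_const[of ?w]] by simp
    show "complex_of_real ((cosh s - 1) / (3 * ?q ^ 2)) \<noteq> 0" unfolding of_real_eq_0_iff using cosh q s by simp
  qed (use strip_props w in auto)
  finally have r: "residue (\<lambda>t. G (cbrt_sinh t)) (of_real s) = of_real (3 * ?q ^ 2 / (cosh s - 1))" by simp
  have "G (- \<i> * of_real (rho x)) - G (\<i> * of_real (rho x)) = 2 * \<i> * of_real (rho x / (rho x ^ 2 + ?q ^ 2))" if "x > 0" for x
  proof -
    let ?a = "\<i> * of_real (rho x)"
    have pos: "rho x ^ 2 + ?q ^ 2 > 0" using q by (intro add_nonneg_pos) auto
    have e: "(?a - ?w) * (- ?a - ?w) = of_real (rho x ^ 2 + ?q ^ 2)"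
      by (simp add: algebra_simps power2_eq_square)
    hence "(?a - ?w) * (- ?a - ?w) \<noteq> 0" using pos by (metis of_real_eq_0_iff less_irrefl)
    hence "?a - ?w \<noteq> 0" "- ?a - ?w \<noteq> 0" by auto
    hence "1 / (- ?a - ?w) - 1 / (?a - ?w) = (1 * (?a - ?w) - 1 * (- ?a - ?w)) / ((- ?a - ?w) * (?a - ?w))"
      by (intro diff_frac_eq)
    also have "\<dots> = 2 * ?a / ((?a - ?w) * (- ?a - ?w))" by (simp add: mult.commute)
    finally have "1 / (- ?a - ?w) - 1 / (?a - ?w) = 2 * ?a / ((?a - ?w) * (- ?a - ?w))" .
    thus ?thesis unfolding e G_def by simp
  qed
  hence "(LINT x:{0<..}|lborel. G (- \<i> * of_real (rho x)) - G (\<i> * of_real (rho x)))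
      = (LINT x:{0<..}|lborel. 2 * \<i> * of_real (rho x / (rho x ^ 2 + ?q ^ 2)))"
    by (intro set_lebesgue_integral_cong) auto
  also have "\<dots> = 2 * \<i> * of_real (LINT x:{0<..}|lborel. rho x / (rho x ^ 2 + ?q ^ 2))"
    by (simp only: set_integral_mult_right set_integral_complex_of_real)
  finally have fin: "2 * of_real pi * \<i> * of_real (3 * ?q ^ 2 / (cosh s - 1))
      = 2 * (2 * \<i> * of_real (LINT x:{0<..}|lborel. rho x / (rho x ^ 2 + ?q ^ 2)))"
    using residue_boundary_integral(1)[OF G bnd cbrt_sinh_of_real_inj[of s]] s r by simp
  have gen: "p * a = 2 * b" if "2 * p * \<i> * a = 2 * (2 * \<i> * b)" for p a b :: complex
  proof -
    have "2 * \<i> * (p * a) = 2 * \<i> * (2 * b)" using that by (simp only: mult_ac)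
    thus ?thesis by (simp add: mult.commute)
  qed
  from gen[OF fin] have "complex_of_real (pi * (3 * ?q ^ 2 / (cosh s - 1))) = of_real (2 * (LINT x:{0<..}|lborel. rho x / (rho x ^ 2 + ?q ^ 2)))"
    by (simp only: of_real_mult of_real_numeral)
  hence "pi * (3 * ?q ^ 2 / (cosh s - 1)) = 2 * (LINT x:{0<..}|lborel. rho x / (rho x ^ 2 + ?q ^ 2))"
    by (simp only: of_real_eq_iff)
  thus ?thesis by (simp add: field_simps)
qed

definition rho_moment :: "nat \<Rightarrow> real" where "rho_moment n = (LINT x:{0<..}|lborel. 1 / rho x ^ (2 * n + 1))"

lemma rho_moment_integrable: "set_integrable lborel {0<..} (\<lambda>x. 1 / rho x ^ (2 * n + 1))"
proof (rule set_integrable_of_rho[where f = "\<lambda>s. 1 / s ^ (2 * n + 1)" and C = 1])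
  fix s :: real assume s: "s > 1"
  hence "s ^ 1 \<le> s ^ (2 * n + 1)" by (intro power_increasing) auto
  thus "norm (1 / s ^ (2 * n + 1)) \<le> 1 / s" using s by (simp add: frac_le)
qed (auto intro!: continuous_intros)

text \<open>The residue formula for \<open>G z = 1 / z ^ (2n + 1)\<close>. The residue is a Taylor
  coefficient of \<open>(t / cbrt_sinh t) ^ (2n + 1)\<close>, a power of \<open>B_base\<close> up to
  a power of 6, and the sign comes from \<open>\<i> ^ (2n + 1)\<close>. Since the moment is
  nonnegative, it is also the modulus of the coefficient, so later integral bounds come out as
  \<open>b_term\<close> itself.\<close>

lemma B0_eq_rho_moment: "of_real (6 powr ((2 * real n + 1) / 3)) * B0 (2 * n) = of_real ((-1) ^ n * (2 / pi) * rho_moment n)"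
proof -
  let ?m = "2 * n + 1"
  define G where "G = (\<lambda>z::complex. 1 / z ^ ?m)"
  define f where "f = (\<lambda>t. (of_real (root 3 6) * exp (- ln_sinh_defect_quot t / 3)) ^ ?m)"
  define P where "P = (\<lambda>t. B_base t powr (of_nat (2 * n + 1) / 3))"
  have f: "f holomorphic_on strip" unfolding f_def by (intro holomorphic_intros ln_sinh_defect_quot_holomorphic) auto
  have G: "G holomorphic_on - {cbrt_sinh (of_real 0)}" unfolding G_def by (auto intro!: holomorphic_intros)
  have bnd: "cmod (G z) \<le> 1 / cmod z" if "cmod z \<ge> 1" for z
  proof -
    have "cmod z ^ 1 \<le> cmod z ^ ?m" using that by (intro power_increasing) auto
    hence "1 / cmod z ^ ?m \<le> 1 / cmod z" using that by (intro frac_le) auto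
    thus ?thesis by (simp only: G_def norm_divide norm_power norm_one)
  qed
  have fG: "G (cbrt_sinh t) = f t / t ^ Suc (2 * n)" for t
    by (simp add: G_def f_def cbrt_sinh_def exp_minus power_mult_distrib power_divide field_simps)
  have r: "residue (\<lambda>t. G (cbrt_sinh t)) (of_real 0) = (deriv ^^ (2 * n)) f 0 / fact (2 * n)"
    unfolding fG using residue_holomorphic_over_power'[OF strip_props(2,3) f, of "2 * n"] by simp
  have root6: "root 3 6 ^ ?m = 6 powr ((2 * real n + 1) / 3)"
    by (simp add: root_powr_inverse powr_realpow[symmetric] powr_powr field_simps del: power_Suc)
  \<comment> \<open>Near the origin the chosen logarithm is the principal one, so that the
    \<open>powr\<close> in \<open>B0\<close> is the power taken in \<open>f\<close>.\<close>
  have "eventually (\<lambda>t. t \<in> strip \<and> \<bar>Im (ln_sinh_defect_quot t)\<bar> < pi) (nhds 0)"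
  proof (rule eventually_conj)
    show "eventually (\<lambda>t. t \<in> strip) (nhds (0::complex))"
      using strip_props(2,3) by (rule eventually_nhds_in_open)
    have "isCont (\<lambda>t. \<bar>Im (ln_sinh_defect_quot t)\<bar>) 0"
      using holomorphic_on_imp_continuous_on[OF ln_sinh_defect_quot_holomorphic] strip_props
      by (intro continuous_intros) (simp add: continuous_on_eq_continuous_at)
    hence "((\<lambda>t. \<bar>Im (ln_sinh_defect_quot t)\<bar>) \<longlongrightarrow> \<bar>Im (ln_sinh_defect_quot 0)\<bar>) (nhds 0)"
      unfolding isCont_def by (rule tendsto_at_iff_tendsto_nhds[of "\<lambda>t. \<bar>Im (ln_sinh_defect_quot t)\<bar>", THEN iffD1])
    thus "eventually (\<lambda>t. \<bar>Im (ln_sinh_defect_quot t)\<bar> < pi) (nhds 0)"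
      by (rule order_tendstoD(2)) simp
  qed
  hence "eventually (\<lambda>t. f t = of_real (6 powr ((2 * real n + 1) / 3)) * P t) (nhds 0)"
  proof eventually_elim
    case (elim t)
    have "B_base t = exp (- ln_sinh_defect_quot t)"
      using exp_ln_sinh_defect_quot[of t] elim by (simp add: B_base_def sinh_defect_quot_def sinh_defect_def exp_minus)
    moreover have "Ln (exp (- ln_sinh_defect_quot t)) = - ln_sinh_defect_quot t" using elim by (intro Ln_exp) auto
    ultimately have "P t = exp (of_nat ?m / 3 * - ln_sinh_defect_quot t)" by (simp add: P_def powr_def)
    also have "\<dots> = exp (- ln_sinh_defect_quot t / 3) ^ ?m"
      unfolding exp_of_nat_mult[symmetric] by (rule arg_cong[where f = exp]) simp
    finally show ?case unfolding f_def power_mult_distrib of_real_power[symmetric] root6 by simp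
  qed
  hence "(deriv ^^ (2 * n)) f 0 = (deriv ^^ (2 * n)) (\<lambda>t. of_real (6 powr ((2 * real n + 1) / 3)) * P t) 0"
    by (rule higher_deriv_cong_ev) simp
  also have "\<dots> = of_real (6 powr ((2 * real n + 1) / 3)) * (deriv ^^ (2 * n)) P 0"
  proof -
    \<comment> \<open>Pulling the constant out of the derivative requires \<open>P\<close> to be
      holomorphic near the origin, which is inherited from \<open>f\<close>.\<close>
    have "eventually (\<lambda>t. P t = f t / of_real (6 powr ((2 * real n + 1) / 3))) (nhds 0)"
      using \<open>eventually (\<lambda>t. f t = _ * P t) (nhds 0)\<close> by (rule eventually_mono) simp
    then obtain S where S: "open S" "0 \<in> S" "\<And>t. t \<in> S \<Longrightarrow> P t = f t / of_real (6 powr ((2 * real n + 1) / 3))"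
      unfolding eventually_nhds by blast
    have "P holomorphic_on S \<inter> strip"
      by (rule holomorphic_transform[of "\<lambda>t. f t / of_real (6 powr ((2 * real n + 1) / 3))"])
         (use S in \<open>auto intro!: holomorphic_intros intro: holomorphic_on_subset[OF f]\<close>)
    thus ?thesis using S strip_props
      by (intro higher_deriv_cmult[of P "S \<inter> strip"]) auto
  qed
  finally have "(deriv ^^ (2 * n)) f 0 / fact (2 * n) = of_real (6 powr ((2 * real n + 1) / 3)) * B0 (2 * n)"
    by (simp add: B0_def P_def)
  hence B: "of_real (6 powr ((2 * real n + 1) / 3)) * B0 (2 * n) = residue (\<lambda>t. G (cbrt_sinh t)) (of_real 0)" using r by simp
  have "G (- \<i> * of_real (rho x)) - G (\<i> * of_real (rho x)) = 2 * \<i> * (-1) ^ n * of_real (1 / rho x ^ ?m)" for x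
  proof -
    have i: "\<i> ^ ?m = (-1) ^ n * \<i>" by (simp add: power_mult)
    have m1: "(- \<i> * of_real (rho x)) ^ ?m = - ((-1) ^ n * \<i> * of_real (rho x ^ ?m))"
      unfolding i[symmetric] by (simp add: power_mult_distrib power_minus_odd)
    have m2: "(\<i> * of_real (rho x)) ^ ?m = (-1) ^ n * \<i> * of_real (rho x ^ ?m)"
      unfolding i[symmetric] by (simp add: power_mult_distrib)
    have m3: "1 / (- (c * \<i> * y)) - 1 / (c * \<i> * y) = 2 * \<i> * c * (1 / y)" if "c * c = 1" for c y :: complex
    proof (cases "y = 0")
      case False
      have "c \<noteq> 0" using that by auto
      thus ?thesis using False that by (simp add: field_simps)
    qed auto
    have m4: "(-1) ^ n * (-1) ^ n = (1::complex)" by (simp add: power_mult_distrib[symmetric])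
    show ?thesis by (simp only: G_def m1 m2 m3[OF m4] of_real_divide of_real_1)
  qed
  hence "(LINT x:{0<..}|lborel. G (- \<i> * of_real (rho x)) - G (\<i> * of_real (rho x))) = 2 * \<i> * (-1) ^ n * of_real (rho_moment n)"
    by (simp only: set_integral_mult_right set_integral_complex_of_real rho_moment_def)
  hence "2 * of_real pi * \<i> * residue (\<lambda>t. G (cbrt_sinh t)) (of_real 0) = 2 * (2 * \<i> * (-1) ^ n * of_real (rho_moment n))"
    using residue_boundary_integral(1)[OF G bnd cbrt_sinh_of_real_inj[of 0]] by simp
  hence "residue (\<lambda>t. G (cbrt_sinh t)) (of_real 0) = (-1) ^ n * (2 / of_real pi) * of_real (rho_moment n)"
    by (simp add: field_simps)
  thus ?thesis using B by simp
qed

section \<open>The remainder as a double integral\<close>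

lemma power_le_fact_mult_exp:
  assumes "0 \<le> (x::real)"
  shows "x ^ n \<le> fact n * exp x"
proof -
  have "(\<Sum>k\<in>{n}. x ^ k /\<^sub>R fact k) \<le> (\<Sum>k. x ^ k /\<^sub>R fact k)"
    by (rule sum_le_suminf) (use assms summable_exp_generic[of x] in auto)
  hence "x ^ n / fact n \<le> exp x" by (simp add: exp_def divide_inverse mult.commute)
  thus ?thesis by (simp add: divide_le_eq mult.commute)
qed

text \<open>Half of the rate \<open>c\<close> pays for the power, through
  \<open>w ^ m \<le> (2 / c) ^ m * fact m * exp (c * w / 2)\<close>, after
  \<open>w \<le> 1 + w ^ 3\<close> has weakened the cube to a linear exponent.\<close>

lemma set_integrable_power_exp_cube:
  assumes c: "c > 0"
  shows "set_integrable lborel {0<..} (\<lambda>w::real. w ^ m * exp (- c * w ^ 3))"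
proof (rule set_integrable_exp_decay[where a = 0 and c = "c / 2" and C = "(2 / c) ^ m * fact m * exp c"])
  fix w :: real assume "w \<in> {0<..}"
  hence w: "w > 0" by simp
  have "w ^ m = (2 / c) ^ m * (c * w / 2) ^ m"
    unfolding power_mult_distrib[symmetric] using c by simp
  also have "\<dots> \<le> (2 / c) ^ m * (fact m * exp (c * w / 2))"
    using c w by (intro mult_left_mono power_le_fact_mult_exp) auto
  finally have 1: "w ^ m \<le> (2 / c) ^ m * fact m * exp (c * w / 2)" by simp
  have "w \<le> 1 + w ^ 3"
  proof (cases "w \<le> 1")
    case False
    hence "w ^ 1 \<le> w ^ 3" by (intro power_increasing) auto
    thus ?thesis by simp
  qed (use w zero_le_power[of w 3] in linarith)
  hence "c * w \<le> c * (1 + w ^ 3)" using c by (intro mult_left_mono) auto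
  hence "exp (- c * w ^ 3) \<le> exp (c - c * w)" by (simp add: algebra_simps)
  hence "w ^ m * exp (- c * w ^ 3) \<le> (2 / c) ^ m * fact m * exp (c * w / 2) * exp (c - c * w)"
    using 1 w c by (intro mult_mono) auto
  also have "\<dots> = (2 / c) ^ m * fact m * (exp (c * w / 2) * exp (c - c * w))" by simp
  also have "exp (c * w / 2) * exp (c - c * w) = exp c * exp (- (c / 2) * w)"
    unfolding exp_add[symmetric] by (rule arg_cong[where f = exp]) (simp add: field_simps)
  finally show "norm (w ^ m * exp (- c * w ^ 3)) \<le> (2 / c) ^ m * fact m * exp c * exp (- (c / 2) * w)"
    using w by simp
qed (use c in \<open>auto intro!: continuous_intros\<close>)

text \<open>Euler's integral under \<open>t = c * w ^ 3\<close>; the Jacobian is the origin of the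
  factor 3.\<close>

lemma integral_power_exp_cube:
  assumes c: "c > 0"
  shows "(LINT w:{0<..}|lborel. w ^ m * exp (- c * w ^ 3)) = Gamma ((real m + 1) / 3) / (3 * c powr ((real m + 1) / 3))"
proof -
  define p where "p = (real m + 1) / 3"
  have p: "p > 0" by (simp add: p_def)
  let ?f = "\<lambda>t. t powr (p - 1) / exp t"
  have e: "?f (c * w ^ 3) * (3 * c * w ^ 2) = 3 * c powr p * (w ^ m * exp (- c * w ^ 3))" if w: "w > 0" for w :: real
  proof -
    have w3: "w ^ 3 = w powr 3" using w by (simp add: powr_numeral)
    have "(c * w ^ 3) powr (p - 1) = c powr (p - 1) * (w ^ 3) powr (p - 1)"
      using c w by (simp add: powr_mult)
    also have "(w ^ 3) powr (p - 1) = w powr (3 * (p - 1))" unfolding w3 by (rule powr_powr)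
    also have "3 * (p - 1) = real m - 2" by (simp add: p_def field_simps)
    finally have "(c * w ^ 3) powr (p - 1) * (3 * c * w ^ 2) = 3 * (c powr (p - 1) * c powr 1) * (w powr (real m - 2) * w powr 2)"
      using c w by (simp add: powr_numeral)
    also have "\<dots> = 3 * c powr p * w ^ m"
      unfolding powr_add[symmetric] using w by (simp add: powr_realpow)
    finally show ?thesis by (simp add: exp_minus field_simps)
  qed
  have int: "set_integrable lborel {0<..} (\<lambda>w. 3 * c powr p * (w ^ m * exp (- c * w ^ 3)))"
    by (intro set_integrable_mult_right set_integrable_power_exp_cube c)
  have "(LBINT t=0..\<infinity>. ?f t) = (LBINT w=0..\<infinity>. ?f (c * w ^ 3) * (3 * c * w ^ 2))"
  proof (rule interval_integral_substitution_nonneg(2))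
    show "DERIV (\<lambda>w. c * w ^ 3) w :> 3 * c * w ^ 2" for w
      by (auto intro!: derivative_eq_intros)
    show "isCont ?f (c * w ^ 3)" if "0 < ereal w" for w
      using that c by (intro continuous_intros) auto
    show "((ereal \<circ> (\<lambda>w. c * w ^ 3) \<circ> real_of_ereal) \<longlongrightarrow> 0) (at_right 0)"
      unfolding zero_ereal_def ereal_tendsto_simps by (auto intro!: tendsto_eq_intros simp: comp_def)
    have "filterlim (\<lambda>w. c * w ^ 3) at_top at_top"
      using c by (intro filterlim_tendsto_pos_mult_at_top[OF tendsto_const] filterlim_pow_at_top filterlim_ident) auto
    thus "((ereal \<circ> (\<lambda>w. c * w ^ 3) \<circ> real_of_ereal) \<longlongrightarrow> \<infinity>) (at_left \<infinity>)"
      unfolding ereal_tendsto_simps by (simp add: comp_def tendsto_PInfty_eq_at_top)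
    show "set_integrable lborel (einterval 0 \<infinity>) (\<lambda>w. ?f (c * w ^ 3) * (3 * c * w ^ 2))"
    proof (subst set_integrable_cong)
      show "set_integrable lborel {0<..} (\<lambda>w. 3 * c powr p * (w ^ m * exp (- c * w ^ 3)))" by (rule int)
    qed (use e in \<open>auto simp: zero_ereal_def einterval_iff\<close>)
  qed (use c in \<open>auto intro!: continuous_intros mult_nonneg_nonneg\<close>)
  hence "(LINT t:{0<..}|lborel. ?f t) = (LINT w:{0<..}|lborel. ?f (c * w ^ 3) * (3 * c * w ^ 2))"
    by (simp add: interval_lebesgue_integral_def zero_ereal_def)
  also have "\<dots> = (LINT w:{0<..}|lborel. 3 * c powr p * (w ^ m * exp (- c * w ^ 3)))"
    by (intro set_lebesgue_integral_cong) (use e in auto)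
  also have "\<dots> = 3 * c powr p * (LINT w:{0<..}|lborel. w ^ m * exp (- c * w ^ 3))"
    by (rule set_integral_mult_right)
  finally have *: "(LINT t:{0<..}|lborel. ?f t) = 3 * c powr p * (LINT w:{0<..}|lborel. w ^ m * exp (- c * w ^ 3))" .
  have "(?f has_integral Gamma p) {0..}" by (rule Gamma_integral_real[OF p])
  moreover have "negligible {t \<in> {0..} - {0<..}. ?f t \<noteq> 0}" by (rule negligible_subset[of "{0}"]) auto
  moreover have "negligible {t \<in> {0<..} - {0..}. ?f t \<noteq> 0}" by (rule negligible_subset[of "{0}"]) auto
  ultimately have "(?f has_integral Gamma p) {0<..}"
    using has_integral_spike_set_eq[of "{0..}" "{0<..}" ?f "Gamma p"] by simp
  hence "(LINT t:{0<..}|lborel. ?f t) = Gamma p"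
    by (rule set_integrable_lborel_nonneg(2)[rotated 2]) (auto intro!: continuous_intros)
  with * show ?thesis using c by (simp add: p_def field_simps)
qed

abbreviation quadrant :: "(real \<times> real) set" where "quadrant \<equiv> {0<..} \<times> {0<..}"

lemma quadrant_sets: "quadrant \<in> sets borel" "quadrant \<in> sets lborel" "open quadrant"
  by (auto intro!: borel_open open_Times)

lemma set_integrable_quadrant_product:
  fixes f g :: "real \<Rightarrow> real"
  assumes f: "set_integrable lborel {0<..} f" and g: "set_integrable lborel {0<..} g"
  shows "set_integrable lborel quadrant (\<lambda>(x, w). f x * g w)"
    and "(LINT (x, w):quadrant|lborel. f x * g w) = (LINT x:{0<..}|lborel. f x) * (LINT w:{0<..}|lborel. g w)"
proof -
  let ?f = "\<lambda>x. indicator {0<..} x * f x" and ?g = "\<lambda>w. indicator {0<..} w * g w"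
  have fi: "integrable lborel ?f" and gi: "integrable lborel ?g"
    using f g by (simp_all add: set_integrable_def)
  note [measurable] = borel_measurable_integrable[OF fi] borel_measurable_integrable[OF gi]
  have i: "integrable (lborel \<Otimes>\<^sub>M lborel) (\<lambda>(x, w). ?f x * ?g w)"
  proof (rule lborel_pair.Fubini_integrable)
    show "(\<lambda>(x, w). ?f x * ?g w) \<in> borel_measurable (lborel \<Otimes>\<^sub>M lborel)" by measurable
    show "AE x in lborel. integrable lborel (\<lambda>w. case (x, w) of (x, w) \<Rightarrow> ?f x * ?g w)"
      unfolding prod.case by (intro AE_I2 integrable_mult_right gi)
    have "integrable lborel (\<lambda>x. norm (?f x) * (\<integral>w. norm (?g w) \<partial>lborel))"
      using fi by (intro integrable_mult_left integrable_norm)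
    thus "integrable lborel (\<lambda>x. \<integral>w. norm (case (x, w) of (x, w) \<Rightarrow> ?f x * ?g w) \<partial>lborel)"
      by (simp add: abs_mult mult.assoc)
  qed
  have eq: "(\<lambda>p. indicator quadrant p *\<^sub>R (case p of (x, w) \<Rightarrow> f x * g w)) = (\<lambda>(x, w). ?f x * ?g w)"
    by (auto simp: indicator_def fun_eq_iff)
  show "set_integrable lborel quadrant (\<lambda>(x, w). f x * g w)"
    unfolding set_integrable_def eq using i by (simp add: lborel_prod)
  have "(LINT (x, w):quadrant|lborel. f x * g w) = (\<integral>x. (\<integral>w. ?f x * ?g w \<partial>lborel) \<partial>lborel)"
    unfolding set_lebesgue_integral_def eq lborel_pair.integral_fst[OF i] by (simp add: lborel_prod)
  also have "\<dots> = (LINT x:{0<..}|lborel. f x) * (LINT w:{0<..}|lborel. g w)"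
    by (simp add: set_lebesgue_integral_def)
  finally show "(LINT (x, w):quadrant|lborel. f x * g w) = (LINT x:{0<..}|lborel. f x) * (LINT w:{0<..}|lborel. g w)" .
qed

text \<open>Modulus of the remainder kernels up to constants. The two variables separate, and the
  integral is a moment times a Gamma value, as in \<open>b_term\<close>.\<close>

definition majorant :: "nat \<Rightarrow> real \<Rightarrow> real \<times> real \<Rightarrow> real" where
  "majorant N c = (\<lambda>(x, w). 1 / rho x ^ (2 * N + 1) * (w ^ (2 * N) * exp (- c * w ^ 3)))"

lemma majorant_integrable: "c > 0 \<Longrightarrow> set_integrable lborel quadrant (majorant N c)"
  unfolding majorant_def by (rule set_integrable_quadrant_product[OF rho_moment_integrable set_integrable_power_exp_cube])

lemma majorant_integral:
  assumes "c > 0"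
  shows "(LINT p:quadrant|lborel. majorant N c p) = rho_moment N * (Gamma ((2 * real N + 1) / 3) / (3 * c powr ((2 * real N + 1) / 3)))"
proof -
  have "(LINT p:quadrant|lborel. majorant N c p) = (LINT (x, w):quadrant|lborel. 1 / rho x ^ (2 * N + 1) * (w ^ (2 * N) * exp (- c * w ^ 3)))"
    by (simp add: majorant_def)
  thus ?thesis
    using set_integrable_quadrant_product(2)[OF rho_moment_integrable set_integrable_power_exp_cube[OF assms], of N "2 * N"]
      integral_power_exp_cube[OF assms, of "2 * N"] by (simp add: rho_moment_def)
qed

text \<open>The squared modulus is \<open>(1 + q)^2 cos^2 (b/2) + (1 - q)^2 sin^2 (b/2)\<close>.
  This bound serves for integrability; the sharper one for a product of two denominators is
  \<open>kernel_lower_bound\<close>.\<close>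

lemma norm_one_plus_ge:
  assumes "0 \<le> q"
  shows "\<bar>cos (b / 2)\<bar> \<le> cmod (1 + of_real q * cis b)"
proof -
  have c: "cos b = 2 * cos (b / 2) ^ 2 - 1" using cos_double_cos[of "b / 2"] by simp
  have "cmod (1 + of_real q * cis b) ^ 2 = (1 + q * cos b) ^ 2 + (q * sin b) ^ 2"
    by (simp add: cmod_power2)
  also have "\<dots> = 1 + 2 * q * cos b + q ^ 2 * (cos b ^ 2 + sin b ^ 2)"
    by algebra
  also have "\<dots> = 1 + 2 * q * cos b + q ^ 2" by simp
  also have "\<dots> = (1 + q)\<^sup>2 * cos (b / 2) ^ 2 + (1 - q)\<^sup>2 * (1 - cos (b / 2) ^ 2)"
    unfolding c by (simp add: power2_eq_square algebra_simps)
  also have "\<dots> \<ge> 1 * cos (b / 2) ^ 2 + 0"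
  proof (rule add_mono)
    show "1 * cos (b / 2) ^ 2 \<le> (1 + q)\<^sup>2 * cos (b / 2) ^ 2"
      using assms one_le_power[of "1 + q" 2] by (intro mult_right_mono) auto
    show "0 \<le> (1 - q)\<^sup>2 * (1 - cos (b / 2) ^ 2)"
      using abs_square_le_1[of "cos (b / 2)"] by (intro mult_nonneg_nonneg) auto
  qed
  finally have "\<bar>cos (b / 2)\<bar> ^ 2 \<le> cmod (1 + of_real q * cis b) ^ 2" by simp
  thus ?thesis by (rule power2_le_imp_le) simp
qed

text \<open>Up to the sign \<open>(-1) ^ N\<close>, the tail after \<open>N\<close> terms of the
  geometric expansion of \<open>rho / (rho^2 + w^2)\<close>, with its exponential weight, after
  rotating \<open>w\<close>. In the first exponent \<open>2 * N\<close> comes from the power of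
  \<open>w\<close> and 1 from \<open>dw\<close>.\<close>

definition remainder_kernel :: "nat \<Rightarrow> complex \<Rightarrow> complex \<Rightarrow> real \<times> real \<Rightarrow> complex" where
  "remainder_kernel N \<zeta> \<psi> = (\<lambda>(x, w). exp (of_nat (2 * N + 1) * ((\<psi> - \<zeta>) / 3)) * of_real (w ^ (2 * N) / rho x ^ (2 * N + 1)) *
     exp (- exp \<psi> * of_real (w ^ 3)) / (1 + exp (2 * ((\<psi> - \<zeta>) / 3)) * of_real ((w / rho x) ^ 2)))"

text \<open>\<open>half_remainder N \<zeta> \<psi>\<close> is the remainder after \<open>N\<close> terms of the integral of \<open>exp (- e\<^sup>\<zeta> (sinh s - s))\<close>
  over \<open>[0, \<infinity>)\<close>, after the substitution \<open>w \<mapsto> exp ((\<psi> - \<zeta>) / 3) w\<close>: the imaginary part of \<open>\<psi>\<close> rotates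
  the ray of integration, and on the admissible range the value does not depend on \<open>\<psi>\<close>.\<close>
definition half_remainder :: "nat \<Rightarrow> complex \<Rightarrow> complex \<Rightarrow> complex" where
  "half_remainder N \<zeta> \<psi> = of_real ((-1) ^ N * (2 / pi)) * (LINT p:quadrant|lborel. remainder_kernel N \<zeta> \<psi> p)"

lemma norm_denominator_ge:
  assumes "0 \<le> q"
  shows "\<bar>cos (Im a)\<bar> \<le> cmod (1 + exp (2 * a) * of_real q)"
proof -
  have "exp (2 * a) * of_real q = of_real (exp (2 * Re a) * q) * cis (2 * Im a)"
    by (subst exp_eq_polar) (simp add: mult_ac)
  moreover have "\<bar>cos (2 * Im a / 2)\<bar> \<le> cmod (1 + of_real (exp (2 * Re a) * q) * cis (2 * Im a))"
    using assms by (intro norm_one_plus_ge) auto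
  ultimately show ?thesis by (simp only: nonzero_mult_div_cancel_left)
qed

lemma cos_pos_of_abs_less: "\<bar>x\<bar> < pi / 2 \<Longrightarrow> cos x > 0"
  by (intro cos_gt_zero_pi) auto

text \<open>The constants \<open>c\<close>, \<open>d\<close>, \<open>B\<close> are kept free so that
  one majorant can serve a whole neighbourhood of \<open>\<zeta>\<close> and
  \<open>\<psi>\<close>.\<close>

lemma norm_remainder_kernel_le:
  assumes "p \<in> quadrant" "\<bar>Im \<psi> - Im \<zeta>\<bar> < 3 * pi / 2" "c \<le> Re (exp \<psi>)" "d > 0" "d \<le> cos ((Im \<psi> - Im \<zeta>) / 3)"
    "exp (real (2 * N + 1) * ((Re \<psi> - Re \<zeta>) / 3)) \<le> B"
  shows "cmod (remainder_kernel N \<zeta> \<psi> p) \<le> B / d * majorant N c p"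
proof -
  obtain x w where p: "p = (x, w)" "x > 0" "w > 0" using assms(1) by (cases p) auto
  have r: "rho x > 0" using rho_gt_1[OF p(2)] by simp
  let ?D = "1 + exp (2 * ((\<psi> - \<zeta>) / 3)) * of_real ((w / rho x) ^ 2)"
  have "\<bar>cos (Im ((\<psi> - \<zeta>) / 3))\<bar> \<le> cmod ?D" by (rule norm_denominator_ge) simp
  hence D: "d \<le> cmod ?D" using assms(5) by simp
  have e1: "cmod (exp (of_nat (2 * N + 1) * ((\<psi> - \<zeta>) / 3))) \<le> B"
  proof -
    have "Re (of_nat (2 * N + 1) * ((\<psi> - \<zeta>) / 3)) = real (2 * N + 1) * ((Re \<psi> - Re \<zeta>) / 3)"
      by (simp only: Re_divide_numeral complex_Re_of_nat complex_Im_of_nat times_complex.sel minus_complex.sel)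
    thus ?thesis using assms(6) by (simp only: norm_exp_eq_Re)
  qed
  have e2: "cmod (exp (- exp \<psi> * of_real (w ^ 3))) \<le> exp (- c * w ^ 3)"
    unfolding norm_exp_eq_Re exp_le_cancel_iff using assms(3) p by (simp add: mult_right_mono)
  have "B \<ge> 0" using e1 norm_ge_zero order_trans by blast
  have "cmod (remainder_kernel N \<zeta> \<psi> p) = cmod (exp (of_nat (2 * N + 1) * ((\<psi> - \<zeta>) / 3))) * (w ^ (2 * N) / rho x ^ (2 * N + 1)) *
      cmod (exp (- exp \<psi> * of_real (w ^ 3))) / cmod ?D"
    using p r by (simp only: remainder_kernel_def prod.case norm_mult norm_divide norm_of_real) (simp add: norm_mult)
  also have "\<dots> \<le> B * (w ^ (2 * N) / rho x ^ (2 * N + 1)) * exp (- c * w ^ 3) / d"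
    using e1 e2 D assms(4) \<open>B \<ge> 0\<close> p r
    by (intro frac_le mult_mono mult_nonneg_nonneg divide_nonneg_nonneg) auto
  also have "\<dots> = B / d * majorant N c p" using p by (simp add: majorant_def mult_ac)
  finally show ?thesis .
qed

lemma remainder_kernel_continuous:
  assumes "\<bar>Im \<psi> - Im \<zeta>\<bar> < 3 * pi / 2"
  shows "continuous_on quadrant (remainder_kernel N \<zeta> \<psi>)"
proof -
  have r: "continuous_on quadrant (\<lambda>p. rho (fst p))"
    by (rule continuous_on_compose2[OF rho_continuous]) (auto intro!: continuous_intros)
  have "cos ((Im \<psi> - Im \<zeta>) / 3) > 0" using assms by (intro cos_pos_of_abs_less) auto
  hence D: "1 + exp (2 * ((\<psi> - \<zeta>) / 3)) * of_real (q ^ 2) \<noteq> 0" for q :: real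
    using norm_denominator_ge[of "q ^ 2" "(\<psi> - \<zeta>) / 3"] by fastforce
  show ?thesis
    unfolding remainder_kernel_def case_prod_unfold
  proof (rule continuous_on_divide)
    have rn: "0 < x \<Longrightarrow> rho x \<noteq> 0" for x using rho_gt_1[of x] by auto
    show "continuous_on quadrant (\<lambda>p. exp (of_nat (2 * N + 1) * ((\<psi> - \<zeta>) / 3)) * of_real (snd p ^ (2 * N) / rho (fst p) ^ (2 * N + 1)) *
     exp (- exp \<psi> * of_real (snd p ^ 3)))"
      by (intro continuous_intros r) (auto simp: rn)
    show "continuous_on quadrant (\<lambda>p. 1 + exp (2 * ((\<psi> - \<zeta>) / 3)) * of_real ((snd p / rho (fst p)) ^ 2))"
      by (intro continuous_intros r) (auto simp: rn)
    show "\<forall>p\<in>quadrant. 1 + exp (2 * ((\<psi> - \<zeta>) / 3)) * of_real ((snd p / rho (fst p)) ^ 2) \<noteq> 0"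
      by (intro ballI D)
  qed
qed

lemma remainder_kernel_measurable:
  assumes "\<bar>Im \<psi> - Im \<zeta>\<bar> < 3 * pi / 2"
  shows "set_borel_measurable lborel quadrant (remainder_kernel N \<zeta> \<psi>)"
  by (rule set_borel_measurable_continuous_on[OF quadrant_sets(1) remainder_kernel_continuous[OF assms]])

text \<open>The first condition makes the exponential decay along the ray; the second keeps the
  cosine of a third of the angle positive and thereby the denominator away from zero.\<close>

definition ray_admissible :: "complex \<Rightarrow> complex \<Rightarrow> bool" where
  "ray_admissible \<zeta> \<psi> \<longleftrightarrow> \<bar>Im \<psi>\<bar> < pi / 2 \<and> \<bar>Im \<psi> - Im \<zeta>\<bar> < 3 * pi / 2"

lemma Re_exp_pos: "\<bar>Im \<psi>\<bar> < pi / 2 \<Longrightarrow> Re (exp \<psi>) > 0"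
  by (simp add: Re_exp cos_pos_of_abs_less)

lemma remainder_kernel_integrable:
  assumes "ray_admissible \<zeta> \<psi>"
  shows "set_integrable lborel quadrant (remainder_kernel N \<zeta> \<psi>)"
proof (rule set_integrable_bound)
  have a: "\<bar>Im \<psi> - Im \<zeta>\<bar> < 3 * pi / 2" "Re (exp \<psi>) > 0" using assms Re_exp_pos by (auto simp: ray_admissible_def)
  let ?d = "cos ((Im \<psi> - Im \<zeta>) / 3)" and ?B = "exp (real (2 * N + 1) * ((Re \<psi> - Re \<zeta>) / 3))"
  have d: "?d > 0" using a by (intro cos_pos_of_abs_less) auto
  show "set_integrable lborel quadrant (\<lambda>p. ?B / ?d * majorant N (Re (exp \<psi>)) p)"
    by (intro set_integrable_mult_right majorant_integrable a)
  show "set_borel_measurable lborel quadrant (remainder_kernel N \<zeta> \<psi>)" by (rule remainder_kernel_measurable[OF a(1)])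
  show "AE p in lborel. p \<in> quadrant \<longrightarrow> norm (remainder_kernel N \<zeta> \<psi> p) \<le> norm (?B / ?d * majorant N (Re (exp \<psi>)) p)"
  proof (intro AE_I2 impI)
    fix p assume "p \<in> quadrant"
    from norm_remainder_kernel_le[OF this a(1) order_refl d order_refl order_refl, of N]
    have "cmod (remainder_kernel N \<zeta> \<psi> p) \<le> ?B / ?d * majorant N (Re (exp \<psi>)) p" .
    also have "\<dots> \<le> norm (?B / ?d * majorant N (Re (exp \<psi>)) p)"
      by (simp only: real_norm_def abs_ge_self)
    finally show "norm (remainder_kernel N \<zeta> \<psi> p) \<le> norm (?B / ?d * majorant N (Re (exp \<psi>)) p)" .
  qed
qed

text \<open>Both arguments may move, which covers continuation in \<open>\<zeta>\<close> as well as
  rotation of the ray. Halving the positive quantities at \<open>z0\<close> and adding 1 to the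
  prefactor leaves room for a neighbourhood.\<close>

lemma half_remainder_holomorphic:
  assumes S: "open S" and f: "f holomorphic_on S" and g: "g holomorphic_on S"
    and adm: "\<And>z. z \<in> S \<Longrightarrow> ray_admissible (f z) (g z)"
  shows "(\<lambda>z. half_remainder N (f z) (g z)) holomorphic_on S"
  unfolding half_remainder_def
proof (intro holomorphic_on_mult holomorphic_on_const set_lebesgue_integral_holomorphic[OF quadrant_sets(2) S])
  fix p assume p: "p \<in> quadrant"
  obtain x w where xw: "p = (x, w)" by (cases p)
  have D: "1 + exp (2 * ((g z - f z) / 3)) * of_real (q ^ 2) \<noteq> 0" if "z \<in> S" for q z
  proof -
    have "cos ((Im (g z) - Im (f z)) / 3) > 0" using adm[OF that] by (intro cos_pos_of_abs_less) (auto simp: ray_admissible_def)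
    thus ?thesis using norm_denominator_ge[of "q ^ 2" "(g z - f z) / 3"] by fastforce
  qed
  show "(\<lambda>z. remainder_kernel N (f z) (g z) p) holomorphic_on S"
    unfolding remainder_kernel_def xw prod.case by (intro holomorphic_intros f g D) simp_all
next
  fix z assume "z \<in> S"
  thus "set_borel_measurable lborel quadrant (remainder_kernel N (f z) (g z))"
    using adm by (intro remainder_kernel_measurable) (auto simp: ray_admissible_def)
next
  fix z0 assume z0: "z0 \<in> S"
  note ad = adm[OF z0]
  define c where "c = Re (exp (g z0)) / 2"
  define d where "d = cos ((Im (g z0) - Im (f z0)) / 3) / 2"
  define B where "B = exp (real (2 * N + 1) * ((Re (g z0) - Re (f z0)) / 3)) + 1"
  have c: "c > 0" "c < Re (exp (g z0))" using ad Re_exp_pos[of "g z0"] by (auto simp: c_def ray_admissible_def)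
  have "cos ((Im (g z0) - Im (f z0)) / 3) > 0" using ad by (intro cos_pos_of_abs_less) (auto simp: ray_admissible_def)
  hence d: "d > 0" "d < cos ((Im (g z0) - Im (f z0)) / 3)" by (auto simp: d_def)
  have cf: "isCont f z0" "isCont g z0"
    using holomorphic_on_imp_continuous_on[OF f] holomorphic_on_imp_continuous_on[OF g] S z0
    by (auto simp: continuous_on_eq_continuous_at)
  have "isCont (\<lambda>z. Re (exp (g z))) z0" "isCont (\<lambda>z. cos ((Im (g z) - Im (f z)) / 3)) z0"
    "isCont (\<lambda>z. exp (real (2 * N + 1) * ((Re (g z) - Re (f z)) / 3))) z0"
    using cf by (auto intro!: continuous_intros)
  hence "((\<lambda>z. Re (exp (g z))) \<longlongrightarrow> Re (exp (g z0))) (nhds z0)"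
    "((\<lambda>z. cos ((Im (g z) - Im (f z)) / 3)) \<longlongrightarrow> cos ((Im (g z0) - Im (f z0)) / 3)) (nhds z0)"
    "((\<lambda>z. exp (real (2 * N + 1) * ((Re (g z) - Re (f z)) / 3))) \<longlongrightarrow> exp (real (2 * N + 1) * ((Re (g z0) - Re (f z0)) / 3))) (nhds z0)"
    by (simp_all only: isCont_def tendsto_at_iff_tendsto_nhds[of "\<lambda>z. Re (exp (g z))"]
        tendsto_at_iff_tendsto_nhds[of "\<lambda>z. cos ((Im (g z) - Im (f z)) / 3)"]
        tendsto_at_iff_tendsto_nhds[of "\<lambda>z. exp (real (2 * N + 1) * ((Re (g z) - Re (f z)) / 3))"])
  hence "eventually (\<lambda>z. c < Re (exp (g z))) (nhds z0)"
    "eventually (\<lambda>z. d < cos ((Im (g z) - Im (f z)) / 3)) (nhds z0)"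
    "eventually (\<lambda>z. exp (real (2 * N + 1) * ((Re (g z) - Re (f z)) / 3)) < B) (nhds z0)"
    using c d by (auto intro: order_tendstoD simp: B_def)
  hence "eventually (\<lambda>z. c < Re (exp (g z)) \<and> d < cos ((Im (g z) - Im (f z)) / 3) \<and>
     exp (real (2 * N + 1) * ((Re (g z) - Re (f z)) / 3)) < B) (nhds z0)"
    by (intro eventually_conj)
  then obtain r where r: "r > 0" "\<And>z. dist z z0 < r \<Longrightarrow> c < Re (exp (g z)) \<and> d < cos ((Im (g z) - Im (f z)) / 3) \<and>
     exp (real (2 * N + 1) * ((Re (g z) - Re (f z)) / 3)) < B"
    unfolding eventually_nhds_metric by blast
  show "\<exists>r h. 0 < r \<and> set_integrable lborel quadrant h \<and> (\<forall>p\<in>quadrant. \<forall>z\<in>ball z0 r \<inter> S. norm (remainder_kernel N (f z) (g z) p) \<le> h p)"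
  proof (intro exI conjI ballI)
    show "set_integrable lborel quadrant (\<lambda>p. B / d * majorant N c p)"
      by (intro set_integrable_mult_right majorant_integrable c)
    fix p z assume p: "p \<in> quadrant" and z: "z \<in> ball z0 r \<inter> S"
    show "norm (remainder_kernel N (f z) (g z) p) \<le> B / d * majorant N c p"
      using r(2)[of z] z adm[of z] d
      by (intro norm_remainder_kernel_le[OF p]) (auto simp: dist_commute ray_admissible_def)
  qed (rule r(1))
qed

text \<open>A real translation of \<open>\<psi>\<close> is the rescaling
  \<open>w \<mapsto> exp (a / 3) * w\<close> of the inner integral.\<close>

lemma half_remainder_shift:
  assumes "ray_admissible \<zeta> \<psi>"
  shows "half_remainder N \<zeta> (\<psi> + of_real a) = half_remainder N \<zeta> \<psi>"
proof -
  define k where "k = exp (a / 3)"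
  have k: "k > 0" by (simp add: k_def)
  have k3: "complex_of_real k = exp (of_real a / 3)" "exp (of_real a) = complex_of_real (k ^ 3)"
    by (simp_all add: k_def exp_of_real[symmetric] exp_of_nat_mult[symmetric])
  have adm': "ray_admissible \<zeta> (\<psi> + of_real a)" using assms by (simp add: ray_admissible_def)
  have s: "remainder_kernel N \<zeta> (\<psi> + of_real a) (x, w) = of_real k * remainder_kernel N \<zeta> \<psi> (x, k * w)" for x w
  proof -
    have 1: "exp (of_nat (2 * N + 1) * ((\<psi> + of_real a - \<zeta>) / 3)) = of_real k ^ (2 * N + 1) * exp (of_nat (2 * N + 1) * ((\<psi> - \<zeta>) / 3))"
      unfolding k3 exp_of_nat_mult[symmetric] exp_add[symmetric] by (rule arg_cong[where f = exp]) (simp add: field_simps)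
    have 2: "exp (2 * ((\<psi> + of_real a - \<zeta>) / 3)) = of_real k ^ 2 * exp (2 * ((\<psi> - \<zeta>) / 3))"
      unfolding k3 exp_of_nat_mult[symmetric] exp_add[symmetric] by (rule arg_cong[where f = exp]) (simp add: field_simps)
    have 3: "exp (\<psi> + of_real a) = exp \<psi> * of_real (k ^ 3)" unfolding exp_add k3(2) ..
    show ?thesis unfolding remainder_kernel_def prod.case 1 2 3
      by (simp add: power_mult_distrib power_divide mult_ac)
  qed
  let ?f = "\<lambda>x w. indicator {0<..} w *\<^sub>R remainder_kernel N \<zeta> \<psi> (x, w)"
  have int: "(LINT p:quadrant|lborel. remainder_kernel N \<zeta> \<psi>' p) = (\<integral>x. indicator {0<..} x *\<^sub>R (\<integral>w. indicator {0<..} w *\<^sub>R remainder_kernel N \<zeta> \<psi>' (x, w) \<partial>lborel) \<partial>lborel)"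
    if "ray_admissible \<zeta> \<psi>'" for \<psi>'
  proof -
    have eq: "(\<lambda>p. indicator quadrant p *\<^sub>R remainder_kernel N \<zeta> \<psi>' p) = (\<lambda>(x, w). indicator {0<..} x *\<^sub>R (indicator {0<..} w *\<^sub>R remainder_kernel N \<zeta> \<psi>' (x, w)))"
      by (auto simp: indicator_def fun_eq_iff)
    have "integrable (lborel \<Otimes>\<^sub>M lborel) (\<lambda>(x, w). indicator {0<..} x *\<^sub>R (indicator {0<..} w *\<^sub>R remainder_kernel N \<zeta> \<psi>' (x, w)))"
      using remainder_kernel_integrable[OF that, of N] unfolding set_integrable_def eq by (simp add: lborel_prod)
    from lborel_pair.integral_fst[OF this]
    have "(LINT p:quadrant|lborel. remainder_kernel N \<zeta> \<psi>' p) = (\<integral>x. (\<integral>w. indicator {0<..} x *\<^sub>R (indicator {0<..} w *\<^sub>R remainder_kernel N \<zeta> \<psi>' (x, w)) \<partial>lborel) \<partial>lborel)"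
      unfolding set_lebesgue_integral_def eq by (simp only: lborel_prod)
    thus ?thesis by (simp only: integral_scaleR_right)
  qed
  have "(\<integral>w. indicator {0<..} w *\<^sub>R remainder_kernel N \<zeta> (\<psi> + of_real a) (x, w) \<partial>lborel) = (\<integral>w. ?f x w \<partial>lborel)" for x
  proof -
    have "(\<integral>w. ?f x w \<partial>lborel) = \<bar>k\<bar> *\<^sub>R (\<integral>w. ?f x (0 + k * w) \<partial>lborel)"
      by (rule lborel_integral_real_affine) (use k in simp)
    also have "\<dots> = (\<integral>w. k *\<^sub>R ?f x (0 + k * w) \<partial>lborel)" by (simp only: integral_scaleR_right abs_of_pos[OF k])
    also have "(\<lambda>w. k *\<^sub>R ?f x (0 + k * w)) = (\<lambda>w. indicator {0<..} w *\<^sub>R remainder_kernel N \<zeta> (\<psi> + of_real a) (x, w))"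
      unfolding s using k by (auto simp: indicator_def fun_eq_iff zero_less_mult_iff scaleR_conv_of_real)
    finally show ?thesis ..
  qed
  thus ?thesis unfolding half_remainder_def int[OF assms] int[OF adm'] by simp
qed

text \<open>A holomorphic function of \<open>\<psi>\<close> that is invariant under real translations is constant.\<close>
lemma half_remainder_independent:
  assumes "ray_admissible \<zeta> \<psi>1" "ray_admissible \<zeta> \<psi>2"
  shows "half_remainder N \<zeta> \<psi>1 = half_remainder N \<zeta> \<psi>2"
proof -
  define S where "S = {\<psi>. ray_admissible \<zeta> \<psi>}"
  have eq: "S = ({\<psi>. Im \<psi> < pi / 2} \<inter> {\<psi>. Im \<psi> > - (pi / 2)}) \<inter>
      ({\<psi>. Im \<psi> < Im \<zeta> + 3 * pi / 2} \<inter> {\<psi>. Im \<psi> > Im \<zeta> - 3 * pi / 2})"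
    by (auto simp only: S_def ray_admissible_def mem_Collect_eq Int_iff abs_less_iff set_eq_iff; linarith)
  have S: "convex S" "open S" unfolding eq
    by (intro convex_Int open_Int convex_halfspace_Im_lt convex_halfspace_Im_gt open_halfspace_Im_lt open_halfspace_Im_gt)+
  have hol: "(\<lambda>\<psi>. half_remainder N \<zeta> \<psi>) holomorphic_on S"
    by (rule half_remainder_holomorphic[OF S(2)]) (auto simp: S_def)
  have "(half_remainder N \<zeta> has_field_derivative 0) (at \<psi> within S)" if "\<psi> \<in> S" for \<psi>
  proof -
    have d: "(half_remainder N \<zeta> has_field_derivative deriv (half_remainder N \<zeta>) \<psi>) (at \<psi>)"
      by (rule holomorphic_derivI[OF hol S(2) that])
    have "((\<lambda>a. \<psi> + of_real a) has_vector_derivative 1) (at 0)"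
      by (auto intro!: derivative_eq_intros has_vector_derivative_of_real)
    moreover have "(half_remainder N \<zeta> has_field_derivative deriv (half_remainder N \<zeta>) \<psi>) (at (\<psi> + of_real 0))" using d by simp
    ultimately have "(half_remainder N \<zeta> \<circ> (\<lambda>a. \<psi> + of_real a) has_vector_derivative 1 * deriv (half_remainder N \<zeta>) \<psi>) (at 0)"
      by (rule field_vector_diff_chain_at)
    moreover have "half_remainder N \<zeta> \<circ> (\<lambda>a. \<psi> + of_real a) = (\<lambda>a. half_remainder N \<zeta> \<psi>)"
      using half_remainder_shift[of \<zeta> \<psi> N] that by (auto simp: S_def)
    ultimately have "((\<lambda>a::real. half_remainder N \<zeta> \<psi>) has_vector_derivative deriv (half_remainder N \<zeta>) \<psi>) (at 0)" by simp
    hence "deriv (half_remainder N \<zeta>) \<psi> = 0" by (rule vector_derivative_unique_at) (rule has_vector_derivative_const)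
    thus ?thesis using d by (simp add: has_field_derivative_at_within)
  qed
  from has_field_derivative_zero_constant[OF S(1) this] obtain c where "\<forall>\<psi>\<in>S. half_remainder N \<zeta> \<psi> = c" by blast
  thus ?thesis using assms by (simp add: S_def)
qed

lemma half_remainder_cnj: "half_remainder N (cnj \<zeta>) (cnj \<psi>) = cnj (half_remainder N \<zeta> \<psi>)"
proof -
  have "remainder_kernel N (cnj \<zeta>) (cnj \<psi>) p = cnj (remainder_kernel N \<zeta> \<psi> p)" for p
    by (cases p) (simp add: remainder_kernel_def exp_cnj)
  hence "(\<lambda>p. indicator quadrant p *\<^sub>R remainder_kernel N (cnj \<zeta>) (cnj \<psi>) p) = (\<lambda>p. cnj (indicator quadrant p *\<^sub>R remainder_kernel N \<zeta> \<psi> p))"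
    by (simp add: fun_eq_iff scaleR_conv_of_real)
  hence "(LINT p:quadrant|lborel. remainder_kernel N (cnj \<zeta>) (cnj \<psi>) p) = cnj (LINT p:quadrant|lborel. remainder_kernel N \<zeta> \<psi> p)"
    unfolding set_lebesgue_integral_def by (simp only: Bochner_Integration.integral_cnj)
  thus ?thesis by (simp add: half_remainder_def)
qed

text \<open>Applying \<open>1 / (1 + z) = 1 - z / (1 + z)\<close> to the denominator splits off one
  term, whose double integral factorises.\<close>

lemma half_remainder_rec:
  assumes "ray_admissible \<zeta> 0"
  shows "half_remainder N \<zeta> 0 = of_real ((-1) ^ N * (2 / pi) * rho_moment N * (Gamma ((2 * real N + 1) / 3) / 3)) * exp (- of_real ((2 * real N + 1) / 3) * \<zeta>)
     + half_remainder (Suc N) \<zeta> 0"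
proof -
  let ?E = "exp (of_nat (2 * N + 1) * ((0 - \<zeta>) / 3))"
  have k: "remainder_kernel N \<zeta> 0 p = ?E * of_real (majorant N 1 p) - remainder_kernel (Suc N) \<zeta> 0 p" if pq: "p \<in> quadrant" for p
  proof -
    obtain x w where p: "p = (x, w)" "x > 0" "w > 0" using pq by (cases p) auto
    have r: "rho x > 0" using rho_gt_1[OF p(2)] by simp
    let ?z = "exp (2 * ((0 - \<zeta>) / 3)) * of_real ((w / rho x) ^ 2)"
    have "cos ((Im 0 - Im \<zeta>) / 3) > 0" using assms by (intro cos_pos_of_abs_less) (auto simp: ray_admissible_def)
    hence D: "1 + ?z \<noteq> 0" using norm_denominator_ge[of "(w / rho x) ^ 2" "(0 - \<zeta>) / 3"] by fastforce
    have g: "of_real (majorant N 1 p) = of_real (w ^ (2 * N) / rho x ^ (2 * N + 1)) * exp (- exp 0 * of_real (w ^ 3) :: complex)"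
      unfolding p majorant_def prod.case by (simp add: exp_of_real[symmetric])
    have E: "exp (of_nat (2 * Suc N + 1) * ((0 - \<zeta>) / 3)) = ?E * exp (2 * ((0 - \<zeta>) / 3))"
      unfolding exp_add[symmetric] by (rule arg_cong[where f = exp]) (simp add: field_simps)
    have a1: "remainder_kernel (Suc N) \<zeta> 0 p = ?E * of_real (majorant N 1 p) * ?z / (1 + ?z)"
      unfolding g unfolding p remainder_kernel_def prod.case E using r
      by (simp add: power_divide power2_eq_square mult_ac)
    have a2: "remainder_kernel N \<zeta> 0 p = ?E * of_real (majorant N 1 p) / (1 + ?z)"
      unfolding g unfolding p remainder_kernel_def prod.case by simp
    have "c / (1 + z) = c - c * z / (1 + z)" if "1 + z \<noteq> 0" for c z :: complex
      using that by (simp add: field_simps)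
    from this[OF D] show ?thesis unfolding a1 a2 .
  qed
  have g: "set_integrable lborel quadrant (\<lambda>p. ?E * of_real (majorant N 1 p))"
    using majorant_integrable[of 1 N] by (intro set_integrable_mult_right) (simp add: set_integrable_def complex_of_real_integrable_eq[symmetric] scaleR_conv_of_real)
  have "(LINT p:quadrant|lborel. remainder_kernel N \<zeta> 0 p) = (LINT p:quadrant|lborel. ?E * of_real (majorant N 1 p) - remainder_kernel (Suc N) \<zeta> 0 p)"
    by (rule set_lebesgue_integral_cong) (use k quadrant_sets in auto)
  also have "\<dots> = (LINT p:quadrant|lborel. ?E * of_real (majorant N 1 p)) - (LINT p:quadrant|lborel. remainder_kernel (Suc N) \<zeta> 0 p)"
    by (rule set_integral_diff(2)[OF g remainder_kernel_integrable[OF assms]])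
  also have "(LINT p:quadrant|lborel. ?E * of_real (majorant N 1 p)) = ?E * of_real (LINT p:quadrant|lborel. majorant N 1 p)"
    by (simp only: set_integral_mult_right set_integral_complex_of_real)
  also have "(LINT p:quadrant|lborel. majorant N 1 p) = rho_moment N * (Gamma ((2 * real N + 1) / 3) / 3)"
    by (simp add: majorant_integral)
  finally have lint: "(LINT p:quadrant|lborel. remainder_kernel N \<zeta> 0 p) = ?E * of_real (rho_moment N * (Gamma ((2 * real N + 1) / 3) / 3)) - (LINT p:quadrant|lborel. remainder_kernel (Suc N) \<zeta> 0 p)" .
  have c: "complex_of_real ((-1) ^ Suc N * (2 / pi)) = - of_real ((-1) ^ N * (2 / pi))" by simp
  have "c * (a - b) = c * a + (- c) * b" for a b c :: complex by (simp add: algebra_simps)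
  hence "half_remainder N \<zeta> 0 = of_real ((-1) ^ N * (2 / pi)) * (?E * of_real (rho_moment N * (Gamma ((2 * real N + 1) / 3) / 3))) + half_remainder (Suc N) \<zeta> 0"
    unfolding half_remainder_def lint c .
  moreover have "?E = exp (- of_real ((2 * real N + 1) / 3) * \<zeta>)"
    by (rule arg_cong[where f = exp]) (simp add: field_simps)
  ultimately show ?thesis by (simp add: mult_ac)
qed

text \<open>At \<open>w = cbrt_sinh_real s\<close> this is the Jacobian \<open>ds/dw\<close>. The
  integral form makes sense for every real \<open>w\<close> and yields the continuity and
  boundedness needed to change variables.\<close>

definition rho_transform :: "real \<Rightarrow> real" where
  "rho_transform w = (2 / pi) * (LINT x:{0<..}|lborel. rho x / (rho x ^ 2 + w ^ 2))"

lemma rho_transform_integrable: "set_integrable lborel {0<..} (\<lambda>x. rho x / (rho x ^ 2 + w ^ 2))"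
proof (rule set_integrable_of_rho[where f = "\<lambda>s. s / (s ^ 2 + w ^ 2)" and C = 1])
  have "s ^ 2 + w ^ 2 > 0" if "s > 1" for s :: real
    using that by (intro add_pos_nonneg) auto
  thus "continuous_on {1<..} (\<lambda>s. s / (s ^ 2 + w ^ 2))"
    by (intro continuous_intros) force
  fix s :: real assume s: "s > 1"
  have "s / (s ^ 2 + w ^ 2) \<le> s / s ^ 2" using s by (intro divide_left_mono mult_pos_pos add_pos_nonneg) auto
  thus "norm (s / (s ^ 2 + w ^ 2)) \<le> 1 / s" using s by (simp add: power2_eq_square)
qed

text \<open>The difference of the two fractions carries the factor \<open>w^2 - v^2\<close>, and
  what multiplies it is at most \<open>1 / rho\<close>; continuity follows.\<close>

lemma rho_transform_diff: "\<bar>rho_transform v - rho_transform w\<bar> \<le> (2 / pi) * rho_moment 0 * \<bar>v\<^sup>2 - w\<^sup>2\<bar>"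
proof -
  let ?f = "\<lambda>w x. rho x / (rho x ^ 2 + w ^ 2)"
  have i1: "set_integrable lborel {0<..} (\<lambda>x. ?f v x - ?f w x)"
    by (intro set_integral_diff(1) rho_transform_integrable)
  have i2: "set_integrable lborel {0<..} (\<lambda>x. \<bar>v\<^sup>2 - w\<^sup>2\<bar> * (1 / rho x ^ (2 * 0 + 1)))"
    by (intro set_integrable_mult_right rho_moment_integrable)
  have "norm (LINT x:{0<..}|lborel. ?f v x - ?f w x) \<le> (LINT x:{0<..}|lborel. \<bar>v\<^sup>2 - w\<^sup>2\<bar> * (1 / rho x ^ (2 * 0 + 1)))"
  proof (rule order_trans[OF set_integral_norm_bound set_integral_mono])
    fix x :: real assume "x \<in> {0<..}"
    hence r: "rho x > 1" by (simp add: rho_gt_1)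
    have p: "rho x ^ 2 \<le> rho x ^ 2 + v ^ 2" "rho x ^ 2 \<le> rho x ^ 2 + w ^ 2" "rho x ^ 2 > 0" using r by auto
    have pp: "rho x ^ 2 + v ^ 2 > 0" "rho x ^ 2 + w ^ 2 > 0" using p by linarith+
    have "?f v x - ?f w x = (rho x * (rho x ^ 2 + w ^ 2) - rho x * (rho x ^ 2 + v ^ 2)) / ((rho x ^ 2 + v ^ 2) * (rho x ^ 2 + w ^ 2))"
      using pp by (intro diff_frac_eq) auto
    also have "\<dots> = rho x * (w\<^sup>2 - v\<^sup>2) / ((rho x ^ 2 + v ^ 2) * (rho x ^ 2 + w ^ 2))"
      by (simp add: algebra_simps)
    finally have "?f v x - ?f w x = rho x * (w\<^sup>2 - v\<^sup>2) / ((rho x ^ 2 + v ^ 2) * (rho x ^ 2 + w ^ 2))" .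
    hence "norm (?f v x - ?f w x) = rho x * \<bar>v\<^sup>2 - w\<^sup>2\<bar> / ((rho x ^ 2 + v ^ 2) * (rho x ^ 2 + w ^ 2))"
      using pp r by (simp add: abs_mult abs_minus_commute)
    also have "\<dots> \<le> rho x * \<bar>v\<^sup>2 - w\<^sup>2\<bar> / (rho x ^ 2 * 1)"
    proof (intro divide_left_mono mult_mono p)
      show "1 \<le> rho x ^ 2 + w ^ 2" using r p one_le_power[of "rho x" 2] by linarith
      show "0 < (rho x ^ 2 + v ^ 2) * (rho x ^ 2 + w ^ 2) * (rho x ^ 2 * 1)"
        by (intro mult_pos_pos pp) (use p in auto)
    qed (use r pp p in auto)
    also have "\<dots> = \<bar>v\<^sup>2 - w\<^sup>2\<bar> * (1 / rho x ^ (2 * 0 + 1))" using r by (simp add: power2_eq_square)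
    finally show "norm (?f v x - ?f w x) \<le> \<bar>v\<^sup>2 - w\<^sup>2\<bar> * (1 / rho x ^ (2 * 0 + 1))" .
  qed (rule i1 set_integrable_norm[OF i1] i2)+
  also have "(LINT x:{0<..}|lborel. ?f v x - ?f w x) = (LINT x:{0<..}|lborel. ?f v x) - (LINT x:{0<..}|lborel. ?f w x)"
    by (intro set_integral_diff rho_transform_integrable)
  also have "(LINT x:{0<..}|lborel. \<bar>v\<^sup>2 - w\<^sup>2\<bar> * (1 / rho x ^ (2 * 0 + 1))) = \<bar>v\<^sup>2 - w\<^sup>2\<bar> * rho_moment 0"
    unfolding rho_moment_def by (rule set_integral_mult_right)
  finally have "\<bar>(LINT x:{0<..}|lborel. ?f v x) - (LINT x:{0<..}|lborel. ?f w x)\<bar> \<le> \<bar>v\<^sup>2 - w\<^sup>2\<bar> * rho_moment 0" by simp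
  hence "2 / pi * \<bar>(LINT x:{0<..}|lborel. ?f v x) - (LINT x:{0<..}|lborel. ?f w x)\<bar> \<le> 2 / pi * (\<bar>v\<^sup>2 - w\<^sup>2\<bar> * rho_moment 0)"
    by (intro mult_left_mono) auto
  moreover have "\<bar>rho_transform v - rho_transform w\<bar> = 2 / pi * \<bar>(LINT x:{0<..}|lborel. ?f v x) - (LINT x:{0<..}|lborel. ?f w x)\<bar>"
    unfolding rho_transform_def right_diff_distrib[symmetric] abs_mult by simp
  ultimately show ?thesis by (simp add: mult_ac)
qed

lemma rho_transform_isCont: "isCont rho_transform w"
proof -
  have "((\<lambda>v. (2 / pi) * rho_moment 0 * \<bar>v\<^sup>2 - w\<^sup>2\<bar>) \<longlongrightarrow> (2 / pi) * rho_moment 0 * \<bar>w\<^sup>2 - w\<^sup>2\<bar>) (at w)"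
    by (intro tendsto_intros)
  hence t: "((\<lambda>v. (2 / pi) * rho_moment 0 * \<bar>v\<^sup>2 - w\<^sup>2\<bar>) \<longlongrightarrow> 0) (at w)" by simp
  have "((\<lambda>v. rho_transform v - rho_transform w) \<longlongrightarrow> 0) (at w)"
  proof (rule Lim_null_comparison[OF _ t])
    show "eventually (\<lambda>v. norm (rho_transform v - rho_transform w) \<le> (2 / pi) * rho_moment 0 * \<bar>v\<^sup>2 - w\<^sup>2\<bar>) (at w)"
      unfolding real_norm_def by (intro always_eventually allI rho_transform_diff)
  qed
  thus ?thesis unfolding isCont_def by (rule LIM_zero_cancel)
qed

lemma rho_moment_nonneg: "rho_moment n \<ge> 0"
  unfolding rho_moment_def set_lebesgue_integral_def
  by (intro integral_nonneg_AE AE_I2) (auto simp: indicator_def dest: rho_gt_1)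

lemma rho_transform_bound: "\<bar>rho_transform w\<bar> \<le> (2 / pi) * rho_moment 0"
proof -
  let ?f = "\<lambda>x. rho x / (rho x ^ 2 + w ^ 2)"
  have b: "0 \<le> ?f x" "?f x \<le> 1 / rho x ^ (2 * 0 + 1)" if "x > 0" for x
  proof -
    have r: "rho x > 1" using that by (rule rho_gt_1)
    show "0 \<le> ?f x" using r by simp
    have "?f x \<le> rho x / rho x ^ 2" using r by (intro divide_left_mono mult_pos_pos add_pos_nonneg) auto
    thus "?f x \<le> 1 / rho x ^ (2 * 0 + 1)" using r by (simp add: power2_eq_square)
  qed
  have "(LINT x:{0<..}|lborel. ?f x) \<le> rho_moment 0"
    unfolding rho_moment_def by (rule set_integral_mono[OF rho_transform_integrable rho_moment_integrable]) (use b in auto)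
  moreover have "0 \<le> (LINT x:{0<..}|lborel. ?f x)"
    unfolding set_lebesgue_integral_def by (intro integral_nonneg_AE AE_I2) (use b in \<open>auto simp: indicator_def\<close>)
  ultimately show ?thesis by (simp add: rho_transform_def abs_mult mult_left_mono divide_right_mono)
qed

lemma half_remainder_0_eq_rho_transform:
  assumes "\<bar>Im \<psi>\<bar> < pi / 2"
  shows "half_remainder 0 \<psi> \<psi> = (LINT w:{0<..}|lborel. exp (- exp \<psi> * of_real (w ^ 3)) * of_real (rho_transform w))"
proof -
  have adm: "ray_admissible \<psi> \<psi>" using assms by (simp add: ray_admissible_def)
  let ?h = "\<lambda>w. exp (- exp \<psi> * of_real (w ^ 3))"
  have F: "remainder_kernel 0 \<psi> \<psi> (x, w) = ?h w * of_real (rho x / (rho x ^ 2 + w ^ 2))" if "x > 0" for x w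
  proof -
    have r: "rho x > 0" using rho_gt_1[OF that] by simp
    have "1 / rho x / (1 + (w / rho x) ^ 2) = rho x / (rho x ^ 2 + w ^ 2)"
    proof -
      have "rho x ^ 2 + w ^ 2 > 0" "1 + (w / rho x) ^ 2 > 0" using r by (auto intro: add_pos_nonneg)
      thus ?thesis using r by (simp add: power_divide field_simps power2_eq_square)
    qed
    hence "?h w * of_real (rho x / (rho x ^ 2 + w ^ 2)) = ?h w * of_real (1 / rho x / (1 + (w / rho x) ^ 2))" by simp
    thus ?thesis by (simp add: remainder_kernel_def field_simps)
  qed
  have eq: "(\<lambda>p. indicator quadrant p *\<^sub>R remainder_kernel 0 \<psi> \<psi> p) = (\<lambda>(x, w). (indicator {0<..} w *\<^sub>R ?h w) * (indicator {0<..} x *\<^sub>R of_real (rho x / (rho x ^ 2 + w ^ 2))))"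
    by (auto simp: indicator_def fun_eq_iff F)
  have i: "integrable (lborel \<Otimes>\<^sub>M lborel) (\<lambda>(x, w). (indicator {0<..} w *\<^sub>R ?h w) * (indicator {0<..} x *\<^sub>R of_real (rho x / (rho x ^ 2 + w ^ 2))))"
    using remainder_kernel_integrable[OF adm, of 0] unfolding set_integrable_def eq by (simp add: lborel_prod)
  have "(LINT p:quadrant|lborel. remainder_kernel 0 \<psi> \<psi> p) = (\<integral>w. (\<integral>x. (indicator {0<..} w *\<^sub>R ?h w) * (indicator {0<..} x *\<^sub>R of_real (rho x / (rho x ^ 2 + w ^ 2))) \<partial>lborel) \<partial>lborel)"
    unfolding set_lebesgue_integral_def eq lborel_pair.integral_snd[OF i] by (simp add: lborel_prod)
  also have "\<dots> = (\<integral>w. (indicator {0<..} w *\<^sub>R ?h w) * of_real (LINT x:{0<..}|lborel. rho x / (rho x ^ 2 + w ^ 2)) \<partial>lborel)"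
  proof -
    have "(\<integral>x. c * (indicator {0<..} x *\<^sub>R of_real (rho x / (rho x ^ 2 + w ^ 2))) \<partial>lborel) = c * of_real (LINT x:{0<..}|lborel. rho x / (rho x ^ 2 + w ^ 2))" for c :: complex and w
    proof -
      have "(\<integral>x. c * (indicator {0<..} x *\<^sub>R of_real (rho x / (rho x ^ 2 + w ^ 2))) \<partial>lborel) = c * (LINT x:{0<..}|lborel. of_real (rho x / (rho x ^ 2 + w ^ 2)))"
        unfolding set_lebesgue_integral_def by (rule integral_mult_right_zero)
      thus ?thesis by (simp only: set_integral_complex_of_real)
    qed
    thus ?thesis by (simp only:)
  qed
  finally have "half_remainder 0 \<psi> \<psi> = of_real (2 / pi) * \<dots>" by (simp add: half_remainder_def)
  also have "\<dots> = (\<integral>w. of_real (2 / pi) * ((indicator {0<..} w *\<^sub>R ?h w) * of_real (LINT x:{0<..}|lborel. rho x / (rho x ^ 2 + w ^ 2))) \<partial>lborel)"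
    by (rule integral_mult_right_zero[symmetric])
  also have "\<dots> = (LINT w:{0<..}|lborel. ?h w * of_real (rho_transform w))"
    unfolding set_lebesgue_integral_def 
    by (rule Bochner_Integration.integral_cong[OF refl])
       (simp only: rho_transform_def set_lebesgue_integral_def of_real_mult mult_scaleR_left mult_scaleR_right mult_ac)
  finally show ?thesis .
qed

section \<open>Returning from the cube root variable to the integral over \<open>s\<close>\<close>

lemma sinh_minus_self_lower: "s \<ge> 0 \<Longrightarrow> s - 9 / 4 \<le> sinh s - (s :: real)"
proof -
  assume s: "s \<ge> 0"
  have "exp s \<ge> 1 + s + s\<^sup>2 / 2" using exp_lower_Taylor_quadratic[OF s] .
  moreover have "exp (- s) \<le> 1" using s by simp
  \<comment> \<open>The constant \<open>9/4\<close> turns the quadratic that remains after Taylor's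
    bound into this square.\<close>
  moreover have "0 \<le> (s / 2 - 3 / 2)\<^sup>2" by simp
  hence "0 \<le> s\<^sup>2 / 4 - 3 / 2 * s + 9 / 4" by (simp add: power2_eq_square algebra_simps)
  ultimately show ?thesis unfolding sinh_field_def diff_divide_distrib by linarith
qed

lemma F1_integrable:
  assumes "Re \<nu> > 0"
  shows "set_integrable lborel {0..} (\<lambda>s. exp (- \<nu> * of_real (sinh s - s)))"
proof (rule set_integrable_exp_decay[where a = 0 and c = "Re \<nu>" and C = "exp (9 / 4 * Re \<nu>)"])
  fix s :: real assume "s \<in> {0..}"
  hence "Re \<nu> * (s - 9 / 4) \<le> Re \<nu> * (sinh s - s)"
    using sinh_minus_self_lower[of s] assms by (intro mult_left_mono) auto
  thus "norm (exp (- \<nu> * of_real (sinh s - s))) \<le> exp (9 / 4 * Re \<nu>) * exp (- Re \<nu> * s)"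
    unfolding exp_add[symmetric] norm_exp_eq_Re exp_le_cancel_iff by (simp add: algebra_simps)
qed (use assms in \<open>auto intro!: continuous_intros\<close>)

lemma LINT_Ioi_eq_Ici:
  fixes f :: "real \<Rightarrow> 'b::{banach, second_countable_topology}"
  assumes "set_integrable lborel {a..} f"
  shows "(LINT x:{a<..}|lborel. f x) = (LINT x:{a..}|lborel. f x)"
proof -
  have i: "set_integrable lborel {a<..} f" by (rule set_integrable_subset[OF assms]) auto
  show ?thesis unfolding set_lebesgue_integral_def
  proof (rule integral_cong_AE)
    show "AE x in lborel. indicator {a<..} x *\<^sub>R f x = indicator {a..} x *\<^sub>R f x"
      using AE_lborel_singleton[of a] by eventually_elim (auto simp: indicator_def)
  qed (use assms i in \<open>auto simp: set_integrable_def intro: borel_measurable_integrable\<close>)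
qed

text \<open>Substituting \<open>w = cbrt_sinh_real s\<close> makes the Jacobian cancel against
  \<open>rho_transform\<close>, leaving the bare exponential.\<close>

lemma half_remainder_0_eq_F1:
  assumes "\<bar>Im \<psi>\<bar> < pi / 2"
  shows "half_remainder 0 \<psi> \<psi> = (LINT s:{0..}|lborel. exp (- exp \<psi> * of_real (sinh s - s)))"
proof -
  let ?f = "\<lambda>w. exp (- exp \<psi> * of_real (w ^ 3)) * of_real (rho_transform w) :: complex"
  let ?g' = "\<lambda>s. (cosh s - 1) / (3 * cbrt_sinh_real s ^ 2)"
  have c: "Re (exp \<psi>) > 0" by (rule Re_exp_pos[OF assms])
  have e: "?g' s *\<^sub>R ?f (cbrt_sinh_real s) = exp (- exp \<psi> * of_real (sinh s - s))" if s: "s > 0" for s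
  proof -
    have "cosh s - 1 > 0" using cosh_real_nonneg_less_iff[of 0 s] s by simp
    hence one: "?g' s * rho_transform (cbrt_sinh_real s) = 1"
      using s cbrt_sinh_real_pos[OF s] inverse_derivative_eq_integral_rho[OF s] by (simp add: rho_transform_def)
    have "c *\<^sub>R (a * of_real m) = a * of_real (c * m)" for c m :: real and a :: complex
      by (simp add: scaleR_conv_of_real)
    thus ?thesis by (simp only: one cbrt_sinh_real_cubed of_real_1 mult_1_right)
  qed
  have int1: "set_integrable lborel {0<..} (\<lambda>s. exp (- exp \<psi> * of_real (sinh s - s)))"
    by (rule set_integrable_subset[OF F1_integrable[OF c]]) auto
  have int2: "set_integrable lborel {0<..} ?f"
  proof (rule set_integrable_bound)
    show "set_integrable lborel {0<..} (\<lambda>w. (2 / pi * rho_moment 0) * (w ^ 0 * exp (- Re (exp \<psi>) * w ^ 3)))"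
      by (intro set_integrable_mult_right set_integrable_power_exp_cube c)
    show "set_borel_measurable lborel {0<..} ?f"
      by (rule set_borel_measurable_continuous_on) (auto intro!: continuous_intros continuous_at_imp_continuous_on rho_transform_isCont)
    show "AE w in lborel. w \<in> {0<..} \<longrightarrow> norm (?f w) \<le> norm ((2 / pi * rho_moment 0) * (w ^ 0 * exp (- Re (exp \<psi>) * w ^ 3)))"
    proof (intro AE_I2 impI)
      fix w :: real
      have "norm (?f w) = exp (- Re (exp \<psi>) * w ^ 3) * \<bar>rho_transform w\<bar>"
        by (simp only: norm_mult norm_exp_eq_Re norm_of_real) simp
      also have "\<dots> \<le> exp (- Re (exp \<psi>) * w ^ 3) * (2 / pi * rho_moment 0)"
        using rho_transform_bound[of w] by (intro mult_left_mono) auto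
      also have "\<dots> \<le> norm ((2 / pi * rho_moment 0) * (w ^ 0 * exp (- Re (exp \<psi>) * w ^ 3)))"
        using rho_moment_nonneg[of 0] by (simp add: abs_mult mult_ac)
      finally show "norm (?f w) \<le> norm ((2 / pi * rho_moment 0) * (w ^ 0 * exp (- Re (exp \<psi>) * w ^ 3)))" .
    qed
  qed
  have "(LBINT w=0..\<infinity>. ?f w) = (LBINT s=0..\<infinity>. ?g' s *\<^sub>R ?f (cbrt_sinh_real s))"
  proof (rule interval_integral_substitution_integrable)
    fix s :: real assume "0 < ereal s"
    hence s: "s > 0" by simp
    have pos: "sinh s - s > 0" using sinh_gt_self[OF s] by simp
    have d1: "((\<lambda>s. sinh s - s) has_real_derivative cosh s - 1) (at s)" by (auto intro!: derivative_eq_intros)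
    have d2: "(root 3 has_real_derivative inverse (real 3 * root 3 (sinh s - s) ^ (3 - Suc 0))) (at (sinh s - s))"
      by (rule DERIV_real_root) (use pos in auto)
    have "((\<lambda>s. root 3 (sinh s - s)) has_real_derivative inverse (real 3 * root 3 (sinh s - s) ^ (3 - Suc 0)) * (cosh s - 1)) (at s)"
      by (rule DERIV_chain2[OF d2 d1])
    thus "DERIV cbrt_sinh_real s :> ?g' s" unfolding cbrt_sinh_real_def[abs_def] by (simp add: field_simps)
    show "isCont ?f (cbrt_sinh_real s)" by (intro continuous_intros rho_transform_isCont)
    have "isCont cbrt_sinh_real s" unfolding cbrt_sinh_real_def[abs_def] by (intro continuous_intros)
    thus "isCont ?g' s" using cbrt_sinh_real_pos[OF s] by (intro continuous_intros) auto
  next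
    have "((\<lambda>s. root 3 (sinh s - s)) \<longlongrightarrow> root 3 (sinh 0 - 0)) (at_right 0)" by (intro tendsto_intros)
    thus "((ereal \<circ> cbrt_sinh_real \<circ> real_of_ereal) \<longlongrightarrow> 0) (at_right 0)"
      unfolding zero_ereal_def ereal_tendsto_simps by (simp add: comp_def cbrt_sinh_real_def[abs_def])
    have "filterlim (\<lambda>s::real. s - 9 / 4) at_top at_top" by real_asymp
    hence u: "filterlim (\<lambda>s::real. sinh s - s) at_top at_top"
      by (rule filterlim_at_top_mono) (use sinh_minus_self_lower in \<open>auto intro: eventually_mono[OF eventually_ge_at_top[of 0]]\<close>)
    have "filterlim (\<lambda>s::real. root 3 (sinh s - s)) at_top at_top"
      unfolding filterlim_at_top
    proof
      fix Z :: real
      have "eventually (\<lambda>s::real. Z ^ 3 \<le> sinh s - s) at_top"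
        using u unfolding filterlim_at_top by (rule spec)
      thus "eventually (\<lambda>s::real. Z \<le> root 3 (sinh s - s)) at_top"
      proof eventually_elim
        case (elim s)
        from real_root_le_mono[OF _ elim, of 3] show ?case
          using odd_real_root_power_cancel[of 3 Z] by simp
      qed
    qed
    thus "((ereal \<circ> cbrt_sinh_real \<circ> real_of_ereal) \<longlongrightarrow> \<infinity>) (at_left \<infinity>)"
      unfolding ereal_tendsto_simps by (simp add: comp_def cbrt_sinh_real_def[abs_def] tendsto_PInfty_eq_at_top)
    show "set_integrable lborel (einterval 0 \<infinity>) (\<lambda>s. ?g' s *\<^sub>R ?f (cbrt_sinh_real s))"
    proof (subst set_integrable_cong)
      show "set_integrable lborel {0<..} (\<lambda>s. exp (- exp \<psi> * of_real (sinh s - s)))" by (rule int1)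
    qed (use e in \<open>auto simp: zero_ereal_def\<close>)
    show "set_integrable lborel (einterval 0 \<infinity>) ?f" using int2 by (simp add: zero_ereal_def)
  qed (auto simp: cosh_real_ge_1)
  hence "(LINT w:{0<..}|lborel. ?f w) = (LINT s:{0<..}|lborel. ?g' s *\<^sub>R ?f (cbrt_sinh_real s))"
    by (simp add: interval_lebesgue_integral_def zero_ereal_def)
  also have "\<dots> = (LINT s:{0<..}|lborel. exp (- exp \<psi> * of_real (sinh s - s)))"
    by (intro set_lebesgue_integral_cong) (use e in auto)
  also have "\<dots> = (LINT s:{0..}|lborel. exp (- exp \<psi> * of_real (sinh s - s)))"
    by (rule LINT_Ioi_eq_Ici[OF F1_integrable[OF c]])
  finally show ?thesis using half_remainder_0_eq_rho_transform[OF assms] by simp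
qed

text \<open>Contribution of the vertical leg \<open>t = \<i> y\<close>, where
  \<open>sinh t - t = \<i> (sin y - y)\<close>. The leg is compact, so this part is entire.\<close>

definition F2a :: "complex \<Rightarrow> complex" where
  "F2a \<zeta> = (LINT y:{0..pi/2}|lborel. \<i> * exp (- exp \<zeta> * (\<i> * of_real (sin y - y))))"

text \<open>Contribution of \<open>t = s + \<i> pi / 2\<close>, where
  \<open>sinh t = \<i> cosh s\<close>. It converges for \<open>Im (exp \<zeta>) < 0\<close> and so
  reaches \<open>Im \<zeta> = - pi / 2\<close>, where the integrand on the real axis has constant
  modulus.\<close>

definition F2b :: "complex \<Rightarrow> complex" where
  "F2b \<zeta> = (LINT s:{0..}|lborel. exp (- exp \<zeta> * (\<i> * of_real (cosh s) - of_real s - \<i> * of_real (pi / 2))))"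

lemma F2a_holomorphic: "F2a holomorphic_on UNIV"
  unfolding F2a_def[abs_def]
proof (rule set_lebesgue_integral_holomorphic)
  fix z0 :: complex
  have "eventually (\<lambda>z. cmod (exp z) < cmod (exp z0) + 1) (nhds z0)"
  proof (rule order_tendstoD(2))
    show "((\<lambda>z. cmod (exp z)) \<longlongrightarrow> cmod (exp z0)) (nhds z0)"
      by (intro tendsto_intros filterlim_ident)
  qed simp
  then obtain r where r: "r > 0" "\<And>z. dist z z0 < r \<Longrightarrow> cmod (exp z) < cmod (exp z0) + 1"
    unfolding eventually_nhds_metric by blast
  show "\<exists>r h. 0 < r \<and> set_integrable lborel {0..pi/2} h \<and> (\<forall>y\<in>{0..pi/2}. \<forall>z\<in>ball z0 r \<inter> UNIV.
      norm (\<i> * exp (- exp z * (\<i> * of_real (sin y - y)))) \<le> h y)"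
  proof (intro exI conjI ballI)
    show "set_integrable lborel {0..pi/2} (\<lambda>y::real. exp ((cmod (exp z0) + 1) * 4))"
      by (rule borel_integrable_atLeastAtMost') (intro continuous_intros)
    fix y z assume y: "y \<in> {0..pi/2}" and z: "z \<in> ball z0 r \<inter> UNIV"
    have "Re (- exp z * (\<i> * of_real (sin y - y))) \<le> cmod (- exp z * (\<i> * of_real (sin y - y)))"
      by (rule complex_Re_le_cmod)
    also have "\<dots> = cmod (exp z) * \<bar>sin y - y\<bar>" by (simp only: norm_mult norm_minus_cancel norm_of_real) simp
    also have "\<dots> \<le> (cmod (exp z0) + 1) * 4"
    proof (rule mult_mono)
      show "cmod (exp z) \<le> cmod (exp z0) + 1" using r(2)[of z] z by (simp add: dist_commute)
      show "\<bar>sin y - y\<bar> \<le> 4" using y sin_x_le_x[of y] sin_ge_zero[of y] pi_less_4 by auto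
    qed auto
    finally show "norm (\<i> * exp (- exp z * (\<i> * of_real (sin y - y)))) \<le> exp ((cmod (exp z0) + 1) * 4)"
      by (simp only: norm_mult norm_exp_eq_Re) simp
  qed (rule r(1))
qed (auto intro!: holomorphic_intros set_borel_measurable_continuous_on continuous_intros)

lemma F2b_bound:
  assumes "c > 0" "c \<le> - Im \<nu>" "cmod \<nu> \<le> B" "s \<ge> 0"
  shows "cmod (exp (- \<nu> * (\<i> * of_real (cosh s) - of_real s - \<i> * of_real (pi / 2)))) \<le> exp ((B + 1)\<^sup>2 / c + 2 * B) * exp (- 1 * s)"
proof -
  have "Re (- \<nu> * (\<i> * of_real (cosh s) - of_real s - \<i> * of_real (pi / 2)))
      = Im \<nu> * cosh s + Re \<nu> * s + - Im \<nu> * (pi / 2)" by (simp add: algebra_simps)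
  also have "\<dots> \<le> - c * (s\<^sup>2 / 4) + B * s + B * 2"
  proof (intro add_mono)
    have "exp s \<ge> 1 + s + s\<^sup>2 / 2" using exp_lower_Taylor_quadratic[OF assms(4)] .
    hence ch: "s\<^sup>2 / 4 \<le> cosh s" using assms(4) exp_gt_zero[of "- s"]
      unfolding cosh_field_def add_divide_distrib by linarith
    have "Im \<nu> * cosh s \<le> - c * cosh s" using assms(2) cosh_real_ge_1[of s] by (intro mult_right_mono) auto
    also have "\<dots> \<le> - c * (s\<^sup>2 / 4)" using ch assms(1) by simp
    finally show "Im \<nu> * cosh s \<le> - c * (s\<^sup>2 / 4)" .
    show "Re \<nu> * s \<le> B * s" using complex_Re_le_cmod[of \<nu>] assms by (intro mult_right_mono) auto
    show "- Im \<nu> * (pi / 2) \<le> B * 2"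
      using abs_Im_le_cmod[of \<nu>] assms pi_less_4 by (intro mult_mono) auto
  qed
  \<comment> \<open>Completing the square in \<open>s\<close>; the additional 1 in
    \<open>B + 1\<close> buys the decay \<open>exp (- s)\<close>.\<close>
  also have "\<dots> \<le> (B + 1)\<^sup>2 / c + 2 * B - s"
  proof -
    have "0 \<le> (c * s / 2 - (B + 1))\<^sup>2 / c" using assms(1) by simp
    also have "\<dots> = c * (s\<^sup>2 / 4) - (B + 1) * s + (B + 1)\<^sup>2 / c"
      using assms(1) by (simp add: power2_eq_square field_simps)
    finally show ?thesis by (simp add: algebra_simps)
  qed
  finally show ?thesis unfolding norm_exp_eq_Re exp_add[symmetric] exp_le_cancel_iff by simp
qed

lemma F2b_integrable:
  assumes "Im \<nu> < 0"
  shows "set_integrable lborel {0..} (\<lambda>s. exp (- \<nu> * (\<i> * of_real (cosh s) - of_real s - \<i> * of_real (pi / 2))))"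
  by (rule set_integrable_exp_decay[where a = 0 and c = 1])
     (use F2b_bound[of "- Im \<nu>" \<nu> "cmod \<nu>"] assms in \<open>auto intro!: continuous_intros\<close>)

lemma F2b_holomorphic: "F2b holomorphic_on {\<zeta>. Im (exp \<zeta>) < 0}"
  unfolding F2b_def[abs_def]
proof (rule set_lebesgue_integral_holomorphic)
  have "open (exp -` {z. Im z < 0})" by (rule open_vimage) (auto intro: open_halfspace_Im_lt continuous_on_exp)
  thus "open {\<zeta>. Im (exp \<zeta>) < 0}" by (simp add: vimage_def)
  fix z0 :: complex assume "z0 \<in> {\<zeta>. Im (exp \<zeta>) < 0}"
  hence z0: "Im (exp z0) < 0" by simp
  define c where "c = - Im (exp z0) / 2"
  have c: "c > 0" "c < - Im (exp z0)" using z0 by (auto simp: c_def)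
  have "eventually (\<lambda>z. cmod (exp z) < cmod (exp z0) + 1) (nhds z0)"
  proof (rule order_tendstoD(2))
    show "((\<lambda>z. cmod (exp z)) \<longlongrightarrow> cmod (exp z0)) (nhds z0)"
      by (intro tendsto_intros filterlim_ident)
  qed simp
  moreover have "eventually (\<lambda>z. c < - Im (exp z)) (nhds z0)"
  proof (rule order_tendstoD(1))
    show "((\<lambda>z. - Im (exp z)) \<longlongrightarrow> - Im (exp z0)) (nhds z0)"
      by (intro tendsto_intros filterlim_ident)
  qed (rule c)
  ultimately have "eventually (\<lambda>z. cmod (exp z) < cmod (exp z0) + 1 \<and> c < - Im (exp z)) (nhds z0)"
    by (rule eventually_conj)
  then obtain r where r: "r > 0" "\<And>z. dist z z0 < r \<Longrightarrow> cmod (exp z) < cmod (exp z0) + 1 \<and> c < - Im (exp z)"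
    unfolding eventually_nhds_metric by blast
  let ?C = "exp ((cmod (exp z0) + 1 + 1)\<^sup>2 / c + 2 * (cmod (exp z0) + 1))"
  show "\<exists>r h. 0 < r \<and> set_integrable lborel {0..} h \<and> (\<forall>s\<in>{0..}. \<forall>z\<in>ball z0 r \<inter> {\<zeta>. Im (exp \<zeta>) < 0}.
      norm (exp (- exp z * (\<i> * of_real (cosh s) - of_real s - \<i> * of_real (pi / 2)))) \<le> h s)"
  proof (intro exI conjI ballI)
    show "set_integrable lborel {0..} (\<lambda>s::real. ?C * exp (- 1 * s))"
      by (rule set_integrable_exp_decay[where a = 0 and c = 1 and C = ?C]) (auto intro!: continuous_intros)
    fix s z assume s: "s \<in> {0::real..}" and z: "z \<in> ball z0 r \<inter> {\<zeta>. Im (exp \<zeta>) < 0}"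
    have "dist z z0 < r" using z by (simp add: dist_commute)
    from r(2)[OF this] s c(1)
    show "norm (exp (- exp z * (\<i> * of_real (cosh s) - of_real s - \<i> * of_real (pi / 2)))) \<le> ?C * exp (- 1 * s)"
      by (intro F2b_bound) auto
  qed (rule r(1))
qed (auto intro!: holomorphic_intros set_borel_measurable_continuous_on continuous_intros)

lemma sinh_add_half_pi: "sinh (complex_of_real s + \<i> * of_real (pi / 2)) = \<i> * of_real (cosh s)"
proof -
  have "complex_of_real s + \<i> * of_real (pi / 2) = Complex s (pi / 2)" by (simp add: complex_eq_iff)
  thus ?thesis by (simp only: sinh_Complex) (simp add: complex_eq_iff)
qed

lemma sinh_i_times_of_real: "sinh (\<i> * complex_of_real y) = \<i> * of_real (sin y)"
proof -
  have "\<i> * complex_of_real y = Complex 0 y" by (simp add: complex_eq_iff)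
  thus ?thesis by (simp only: sinh_Complex) (simp add: complex_eq_iff)
qed

lemma sinh_of_real_complex: "sinh (complex_of_real s) = of_real (sinh s)"
  using sinh_Complex[of s 0] by (simp add: complex_eq_iff complex_of_real_def)

text \<open>Shifting the path of integration from the positive real axis to the path
  \<open>0 \<rightarrow> i pi/2 \<rightarrow> i pi/2 + \<infinity>\<close>.\<close>
lemma F1_eq_F2:
  assumes re: "Re (exp \<zeta>) > 0" and im: "Im (exp \<zeta>) < 0"
  shows "(LINT s:{0..}|lborel. exp (- exp \<zeta> * of_real (sinh s - s))) = F2a \<zeta> + F2b \<zeta>"
proof -
  define \<nu> where "\<nu> = exp \<zeta>"
  define f where "f = (\<lambda>t. exp (- \<nu> * (sinh t - t)))"
  have "f holomorphic_on UNIV" unfolding f_def sinh_field_def by (intro holomorphic_intros) auto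
  from holomorphic_primitive_exists[OF convex_UNIV open_UNIV this]
  obtain \<Phi> where "\<forall>t\<in>UNIV. (\<Phi> has_field_derivative f t) (at t)" ..
  hence \<Phi>: "(\<Phi> has_field_derivative f t) (at t)" for t by simp
  have f1: "f (of_real s) = exp (- \<nu> * of_real (sinh s - s))" for s
    by (simp add: f_def sinh_of_real_complex)
  have f2: "f (\<i> * of_real y) = exp (- \<nu> * (\<i> * of_real (sin y - y)))" for y
    by (simp add: f_def sinh_i_times_of_real algebra_simps)
  have f3: "f (of_real s + \<i> * of_real (pi / 2)) = exp (- \<nu> * (\<i> * of_real (cosh s) - of_real s - \<i> * of_real (pi / 2)))" for s
    unfolding f_def sinh_add_half_pi by (rule arg_cong[where f = exp]) (simp add: algebra_simps)
  have int1: "set_integrable lborel {0..} (\<lambda>s. f (of_real s))"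
    unfolding f1 by (rule F1_integrable) (use re in \<open>simp add: \<nu>_def\<close>)
  have int3: "set_integrable lborel {0..} (\<lambda>s. f (of_real s + \<i> * of_real (pi / 2)))"
    unfolding f3 by (rule F2b_integrable) (use im in \<open>simp add: \<nu>_def\<close>)
  have v1: "((\<lambda>s. \<Phi> (of_real s)) has_vector_derivative f (of_real s)) (at s within A)" for s A
    using has_vector_derivative_real_field[OF \<Phi>] .
  have "((\<lambda>t. \<Phi> (t + \<i> * of_real (pi / 2))) has_field_derivative f (t + \<i> * of_real (pi / 2))) (at t)" for t
  proof -
    have "((\<lambda>t. t + \<i> * of_real (pi / 2)) has_field_derivative 1) (at t)"
      by (auto intro!: derivative_eq_intros)
    from DERIV_chain2[OF \<Phi> this] show ?thesis by (simp only: mult_1_right)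
  qed
  hence v3: "((\<lambda>s. \<Phi> (of_real s + \<i> * of_real (pi / 2))) has_vector_derivative f (of_real s + \<i> * of_real (pi / 2))) (at s within A)" for s A
    using has_vector_derivative_real_field by blast
  have d2: "((\<lambda>t. \<Phi> (\<i> * t)) has_field_derivative \<i> * f (\<i> * t)) (at t)" for t
  proof -
    have "((\<lambda>t. \<i> * t) has_field_derivative \<i>) (at t)" by (auto intro!: derivative_eq_intros)
    from DERIV_chain2[OF \<Phi> this] show ?thesis by (simp add: mult.commute)
  qed
  have v2: "((\<lambda>y. \<Phi> (\<i> * of_real y)) has_vector_derivative \<i> * f (\<i> * of_real y)) (at y within A)" for y A
    using has_vector_derivative_real_field[OF d2] .
  have cf: "continuous_on UNIV f" unfolding f_def by (intro continuous_intros)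
  have i1: "(LINT s:{0..X}|lborel. f (of_real s)) = \<Phi> (of_real X) - \<Phi> 0" if "X \<ge> 0" for X
  proof -
    have "(LINT s:{0..X}|lborel. f (of_real s)) = \<Phi> (of_real X) - \<Phi> (of_real 0)"
      unfolding set_lebesgue_integral_def
      by (rule integral_FTC_Icc[OF that v1]) (rule continuous_on_compose2[OF cf], auto intro!: continuous_intros)
    thus ?thesis by simp
  qed
  have i2: "F2a \<zeta> = \<Phi> (\<i> * of_real (pi / 2)) - \<Phi> 0"
  proof -
    have "F2a \<zeta> = (LINT y:{0..pi/2}|lborel. \<i> * f (\<i> * of_real y))" by (simp only: F2a_def f2 \<nu>_def)
    also have "\<dots> = \<Phi> (\<i> * of_real (pi / 2)) - \<Phi> (\<i> * of_real 0)"
      unfolding set_lebesgue_integral_def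
      by (rule integral_FTC_Icc[OF _ v2]) (auto intro!: continuous_intros continuous_on_compose2[OF cf])
    finally show ?thesis by simp
  qed
  have i3: "(LINT s:{0..X}|lborel. f (of_real s + \<i> * of_real (pi / 2))) = \<Phi> (of_real X + \<i> * of_real (pi / 2)) - \<Phi> (\<i> * of_real (pi / 2))" if "X \<ge> 0" for X
  proof -
    have "(LINT s:{0..X}|lborel. f (of_real s + \<i> * of_real (pi / 2))) = \<Phi> (of_real X + \<i> * of_real (pi / 2)) - \<Phi> (of_real 0 + \<i> * of_real (pi / 2))"
      unfolding set_lebesgue_integral_def
      by (rule integral_FTC_Icc[OF that v3]) (rule continuous_on_compose2[OF cf], auto intro!: continuous_intros)
    thus ?thesis by simp
  qed
  have l1: "((\<lambda>X. LINT s:{0..X}|lborel. f (of_real s)) \<longlongrightarrow> (LINT s:{0..}|lborel. f (of_real s))) at_top"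
    by (rule tendsto_set_lebesgue_integral_at_top[OF _ int1]) auto
  have l3: "((\<lambda>X. LINT s:{0..X}|lborel. f (of_real s + \<i> * of_real (pi / 2))) \<longlongrightarrow> (LINT s:{0..}|lborel. f (of_real s + \<i> * of_real (pi / 2)))) at_top"
    by (rule tendsto_set_lebesgue_integral_at_top[OF _ int3]) auto
  \<comment> \<open>Both \<open>Re \<nu>\<close> and \<open>- Im \<nu>\<close> are at least
    \<open>m\<close>, and \<open>cos y + sin y \<ge> 1\<close> on \<open>[0, pi / 2]\<close>, so on
    the closing vertical segment \<open>Re (\<nu> * sinh t) \<ge> m * sinh X\<close>, which outgrows
    the linear term.\<close>
  define m where "m = min (Re \<nu>) (- Im \<nu>)"
  have m: "m > 0" "m \<le> Re \<nu>" "m \<le> - Im \<nu>" using re im by (auto simp: m_def \<nu>_def)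
  have "((\<lambda>X. \<Phi> (of_real X) - \<Phi> (of_real X + \<i> * of_real (pi / 2))) \<longlongrightarrow> 0) at_top"
  proof (rule Lim_null_comparison)
    show "eventually (\<lambda>X. norm (\<Phi> (of_real X) - \<Phi> (of_real X + \<i> * of_real (pi / 2))) \<le> exp (- m * (X\<^sup>2 / 4) + cmod \<nu> * (X + 3)) * (pi / 2)) at_top"
      using eventually_ge_at_top[of 1]
    proof eventually_elim
      case (elim X)
      let ?S = "closed_segment (of_real X + \<i> * of_real (pi / 2)) (complex_of_real X)"
      have "cmod (\<Phi> (of_real X) - \<Phi> (of_real X + \<i> * of_real (pi / 2))) \<le> exp (- m * (X\<^sup>2 / 4) + cmod \<nu> * (X + 3)) * cmod (of_real X - (of_real X + \<i> * of_real (pi / 2)))"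
      proof (rule field_differentiable_bound[where S = ?S])
        fix t assume t: "t \<in> ?S"
        have "?S \<subseteq> ({t. Re t \<le> X} \<inter> {t. Re t \<ge> X}) \<inter> ({t. Im t \<ge> 0} \<inter> {t. Im t \<le> pi / 2})"
          by (intro closed_segment_subset convex_Int convex_halfspace_Re_le convex_halfspace_Re_ge convex_halfspace_Im_le convex_halfspace_Im_ge) auto
        from subsetD[OF this t] have tt: "Re t = X" "0 \<le> Im t" "Im t \<le> pi / 2" by auto
        show "(\<Phi> has_field_derivative f t) (at t within ?S)" using \<Phi> by (rule has_field_derivative_at_within)
        let ?y = "Im t"
        have cs: "cos ?y \<ge> 0" "sin ?y \<ge> 0" using tt pi_gt_zero by (auto intro!: cos_ge_zero sin_ge_zero)
        have cs1: "1 \<le> cos ?y + sin ?y"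
        proof -
          have "cos ?y ^ 2 \<le> cos ?y" "sin ?y ^ 2 \<le> sin ?y"
            using cs by (auto simp: power2_eq_square intro: mult_left_le)
          thus ?thesis using sin_cos_squared_add[of ?y] by linarith
        qed
        have sx: "X\<^sup>2 / 4 \<le> sinh X" "sinh X \<le> cosh X" "sinh X \<ge> 0"
        proof -
          have "exp X \<ge> 1 + X + X\<^sup>2 / 2" using exp_lower_Taylor_quadratic[of X] elim by simp
          moreover have "exp (- X) \<le> 1" using elim by simp
          ultimately show "X\<^sup>2 / 4 \<le> sinh X"
            using elim unfolding sinh_field_def diff_divide_distrib by linarith
          show "sinh X \<le> cosh X" by (simp add: sinh_field_def cosh_field_def)
          show "sinh X \<ge> 0" using elim by simp
        qed
        have "Re (\<nu> * sinh t) = Re \<nu> * (sinh X * cos ?y) + (- Im \<nu>) * (cosh X * sin ?y)"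
        proof -
          have "sinh t = Complex (sinh X * cos ?y) (cosh X * sin ?y)"
            unfolding tt(1)[symmetric] using sinh_Complex[of "Re t" ?y] by (simp only: complex_surj)
          thus ?thesis by simp
        qed
        also have "\<dots> \<ge> m * (sinh X * cos ?y) + m * (sinh X * sin ?y)"
          using m cs sx by (intro add_mono mult_mono mult_nonneg_nonneg mult_right_mono) auto
        also have "m * (sinh X * cos ?y) + m * (sinh X * sin ?y) = m * (sinh X * (cos ?y + sin ?y))" by (simp add: algebra_simps)
        also have "m * (sinh X * (cos ?y + sin ?y)) \<ge> m * ((X\<^sup>2 / 4) * 1)"
          using m cs1 sx by (intro mult_left_mono mult_mono) auto
        finally have a: "m * (X\<^sup>2 / 4) \<le> Re (\<nu> * sinh t)" by simp
        have "Re (\<nu> * t) \<le> cmod \<nu> * cmod t" using complex_Re_le_cmod[of "\<nu> * t"] by (simp add: norm_mult)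
        also have "\<dots> \<le> cmod \<nu> * (X + 3)"
          using cmod_le[of t] tt elim pi_less_4 by (intro mult_left_mono) auto
        finally have b: "Re (\<nu> * t) \<le> cmod \<nu> * (X + 3)" .
        have "Re (- \<nu> * (sinh t - t)) = - Re (\<nu> * sinh t) + Re (\<nu> * t)" by (simp add: algebra_simps)
        hence "Re (- \<nu> * (sinh t - t)) \<le> - m * (X\<^sup>2 / 4) + cmod \<nu> * (X + 3)" using a b by linarith
        thus "cmod (f t) \<le> exp (- m * (X\<^sup>2 / 4) + cmod \<nu> * (X + 3))"
          unfolding f_def norm_exp_eq_Re exp_le_cancel_iff .
      qed auto
      also have "cmod (of_real X - (of_real X + \<i> * of_real (pi / 2))) = pi / 2" by (simp add: norm_mult norm_divide)
      finally show ?case .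
    qed
    have "((\<lambda>X::real. exp (- m * (X\<^sup>2 / 4) + cmod \<nu> * (X + 3)) * (pi / 2)) \<longlongrightarrow> 0) at_top"
      using m(1) by real_asymp
    thus "((\<lambda>X::real. exp (- m * (X\<^sup>2 / 4) + cmod \<nu> * (X + 3)) * (pi / 2)) \<longlongrightarrow> 0) at_top" .
  qed
  moreover have "((\<lambda>X. \<Phi> (of_real X) - \<Phi> (of_real X + \<i> * of_real (pi / 2))) \<longlongrightarrow>
      (LINT s:{0..}|lborel. f (of_real s)) - (LINT s:{0..}|lborel. f (of_real s + \<i> * of_real (pi / 2))) + (\<Phi> 0 - \<Phi> (\<i> * of_real (pi / 2)))) at_top"
  proof (rule Lim_transform_eventually)
    show "((\<lambda>X. (LINT s:{0..X}|lborel. f (of_real s)) - (LINT s:{0..X}|lborel. f (of_real s + \<i> * of_real (pi / 2))) + (\<Phi> 0 - \<Phi> (\<i> * of_real (pi / 2)))) \<longlongrightarrow>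
      (LINT s:{0..}|lborel. f (of_real s)) - (LINT s:{0..}|lborel. f (of_real s + \<i> * of_real (pi / 2))) + (\<Phi> 0 - \<Phi> (\<i> * of_real (pi / 2)))) at_top"
      by (intro tendsto_add tendsto_diff l1 l3 tendsto_const)
    show "eventually (\<lambda>X. (LINT s:{0..X}|lborel. f (of_real s)) - (LINT s:{0..X}|lborel. f (of_real s + \<i> * of_real (pi / 2))) + (\<Phi> 0 - \<Phi> (\<i> * of_real (pi / 2)))
       = \<Phi> (of_real X) - \<Phi> (of_real X + \<i> * of_real (pi / 2))) at_top"
      using eventually_ge_at_top[of 0]
    proof eventually_elim
      case (elim X)
      show ?case unfolding i1[OF elim] i3[OF elim] by (simp add: algebra_simps)
    qed
  qed
  ultimately have "(LINT s:{0..}|lborel. f (of_real s)) - (LINT s:{0..}|lborel. f (of_real s + \<i> * of_real (pi / 2))) + (\<Phi> 0 - \<Phi> (\<i> * of_real (pi / 2))) = 0"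
    by (rule tendsto_unique[OF trivial_limit_at_top_linorder, symmetric])
  moreover have "F2b \<zeta> = (LINT s:{0..}|lborel. f (of_real s + \<i> * of_real (pi / 2)))"
    by (simp only: F2b_def f3 \<nu>_def)
  moreover have "(LINT s:{0..}|lborel. exp (- exp \<zeta> * of_real (sinh s - s))) = (LINT s:{0..}|lborel. f (of_real s))"
    by (simp only: f1 \<nu>_def)
  ultimately show ?thesis unfolding i2 by (simp add: algebra_simps)
qed

text \<open>The real-axis integral gives the equality for \<open>- pi / 2 < Im \<zeta> < 0\<close>;
  both sides are holomorphic for \<open>- pi < Im \<zeta> < 0\<close>, which includes the line
  \<open>Im \<zeta> = - pi / 2\<close> that is wanted.\<close>

lemma half_remainder_0_eq_F2:
  assumes "- pi < Im \<zeta>" "Im \<zeta> < 0"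
  shows "half_remainder 0 \<zeta> 0 = F2a \<zeta> + F2b \<zeta>"
proof -
  define S where "S = {\<zeta>. Im \<zeta> > - pi} \<inter> {\<zeta>. Im \<zeta> < 0}"
  define T where "T = {\<zeta>. Im \<zeta> > - (pi / 2)} \<inter> {\<zeta>. Im \<zeta> < 0}"
  have S: "open S" "connected S" and T: "open T" "T \<subseteq> S"
    unfolding S_def T_def
    by (auto intro!: open_Int open_halfspace_Im_gt open_halfspace_Im_lt convex_connected convex_Int convex_halfspace_Im_gt convex_halfspace_Im_lt)
  have im: "Im (exp z) < 0" if "z \<in> S" for z
  proof -
    have "sin (- Im z) > 0" using that by (intro sin_gt_zero) (auto simp: S_def)
    thus ?thesis by (simp add: Im_exp mult_pos_neg)
  qed
  have ne: "Complex 0 (- 1) \<in> T" using pi_gt3 by (auto simp: T_def)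
  show ?thesis
  proof (rule analytic_continuation_open[where f = "\<lambda>\<zeta>. half_remainder 0 \<zeta> 0" and g = "\<lambda>\<zeta>. F2a \<zeta> + F2b \<zeta>", OF T(1) S(1) _ S(2) T(2)])
    show "T \<noteq> {}" using ne by blast
    show "(\<lambda>\<zeta>. half_remainder 0 \<zeta> 0) holomorphic_on S"
      by (rule half_remainder_holomorphic[OF S(1)]) (auto simp: S_def ray_admissible_def)
    show "(\<lambda>\<zeta>. F2a \<zeta> + F2b \<zeta>) holomorphic_on S"
      by (intro holomorphic_on_add holomorphic_on_subset[OF F2a_holomorphic] holomorphic_on_subset[OF F2b_holomorphic])
         (use im in auto)
    show "\<zeta> \<in> S" using assms by (auto simp: S_def)
    fix z assume z: "z \<in> T"
    have "half_remainder 0 z 0 = half_remainder 0 z z" by (rule half_remainder_independent) (use z in \<open>auto simp: T_def ray_admissible_def\<close>)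
    also have "\<dots> = (LINT s:{0..}|lborel. exp (- exp z * of_real (sinh s - s)))"
      by (rule half_remainder_0_eq_F1) (use z in \<open>auto simp: T_def\<close>)
    also have "\<dots> = F2a z + F2b z"
    proof (rule F1_eq_F2)
      show "Re (exp z) > 0" by (rule Re_exp_pos) (use z in \<open>auto simp: T_def\<close>)
      show "Im (exp z) < 0" using im z T by auto
    qed
    finally show "half_remainder 0 z 0 = F2a z + F2b z" .
  qed
qed

section \<open>Matching with the Hankel function on the line
  \<open>Im \<zeta> = pi / 2\<close>\<close>

lemma LINT_even_split:
  fixes f :: "real \<Rightarrow> complex"
  assumes i: "set_integrable lborel {0..} f" "set_integrable lborel {0..} (\<lambda>s. f (- s))"
  shows "(\<integral>s. f s \<partial>lborel) = (LINT s:{0..}|lborel. f s) + (LINT s:{0..}|lborel. f (- s))"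
proof -
  let ?g = "\<lambda>s. indicator {0..} s *\<^sub>R f (- s)"
  have gi: "integrable lborel ?g" using i(2) by (simp add: set_integrable_def)
  have "integrable lborel (\<lambda>s. ?g (0 + (-1) * s))" by (rule lborel_integrable_real_affine[OF gi]) simp
  moreover have "(\<integral>s. ?g s \<partial>lborel) = (\<integral>s. ?g (0 + (-1) * s) \<partial>lborel)"
    using lborel_integral_real_affine[of "-1" ?g 0] by simp
  ultimately have g: "integrable lborel (\<lambda>s. indicator {..0} s *\<^sub>R f s)"
    "(LINT s:{0..}|lborel. f (- s)) = (\<integral>s. indicator {..0} s *\<^sub>R f s \<partial>lborel)"
  proof -
    have e: "(\<lambda>s. ?g (0 + (-1) * s)) = (\<lambda>s. indicator {..0} s *\<^sub>R f s)" by (auto simp: indicator_def)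
    show "integrable lborel (\<lambda>s. indicator {..0} s *\<^sub>R f s)"
      using \<open>integrable lborel (\<lambda>s. ?g (0 + (-1) * s))\<close> unfolding e .
    show "(LINT s:{0..}|lborel. f (- s)) = (\<integral>s. indicator {..0} s *\<^sub>R f s \<partial>lborel)"
      using \<open>(\<integral>s. ?g s \<partial>lborel) = _\<close> unfolding e set_lebesgue_integral_def .
  qed
  have fi: "integrable lborel (\<lambda>s. indicator {0..} s *\<^sub>R f s)" using i(1) by (simp add: set_integrable_def)
  have sum: "integrable lborel (\<lambda>s. indicator {0..} s *\<^sub>R f s + indicator {..0} s *\<^sub>R f s)"
    by (intro Bochner_Integration.integrable_add fi g)
  have ae: "AE s in lborel. indicator {0..} s *\<^sub>R f s + indicator {..0} s *\<^sub>R f s = f s"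
    using AE_lborel_singleton[of "0::real"] by eventually_elim (auto simp: indicator_def)
  have "(\<lambda>s. indicator {0..} s *\<^sub>R f s + indicator {..<0} s *\<^sub>R f s) = f" by (auto simp: indicator_def)
  moreover have "integrable lborel (\<lambda>s. indicator {..<0} s *\<^sub>R f s)"
  proof -
    have "set_integrable lborel {..0} f" using g(1) by (simp add: set_integrable_def)
    hence "set_integrable lborel {..<0} f" by (rule set_integrable_subset) auto
    thus ?thesis by (simp add: set_integrable_def)
  qed
  ultimately have "integrable lborel f"
    using Bochner_Integration.integrable_add[OF fi, of "\<lambda>s. indicator {..<0} s *\<^sub>R f s"] by (simp only:)
  hence fm: "f \<in> borel_measurable lborel" by (rule borel_measurable_integrable)
  have "(\<integral>s. f s \<partial>lborel) = (\<integral>s. indicator {0..} s *\<^sub>R f s + indicator {..0} s *\<^sub>R f s \<partial>lborel)"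
    by (rule integral_cong_AE[symmetric]) (use ae sum fm in \<open>auto intro: borel_measurable_integrable\<close>)
  also have "\<dots> = (\<integral>s. indicator {0..} s *\<^sub>R f s \<partial>lborel) + (\<integral>s. indicator {..0} s *\<^sub>R f s \<partial>lborel)"
    by (rule Bochner_Integration.integral_add[OF fi g(1)])
  finally show ?thesis unfolding g(2) unfolding set_lebesgue_integral_def .
qed

text \<open>On this line \<open>\<zeta> - \<i> pi\<close> is the conjugate of
  \<open>\<zeta>\<close>, so the sum is twice a real part. The vertical legs are imaginary and
  cancel; conjugating the integrand of the horizontal leg reflects \<open>s\<close>, so the two
  half-lines join to the full integral of \<open>hankel1_diag_imaginary\<close>.\<close>

lemma hankel1_diag_eq_half_remainder:
  assumes "Im \<zeta> = pi / 2"
  shows "hankel1_diag \<zeta> = (half_remainder 0 \<zeta> 0 + half_remainder 0 (\<zeta> - \<i> * of_real pi) 0) / (of_real pi * \<i>)"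
proof -
  define v where "v = exp (Re \<zeta>)"
  have v: "v > 0" by (simp add: v_def)
  define z where "z = \<zeta> - \<i> * of_real pi"
  have z: "Im z = - (pi / 2)" "cnj z = \<zeta>" using assms by (simp_all add: z_def complex_eq_iff)
  have ez: "exp z = - \<i> * of_real v"
  proof -
    have "Re z = Re \<zeta>" by (simp add: z_def)
    thus ?thesis by (subst exp_eq_polar) (simp add: z(1) v_def complex_eq_iff)
  qed
  let ?h = "\<lambda>s. exp (- of_real (v * cosh s) - \<i> * of_real (v * s)) :: complex"
  have F2b: "F2b z = of_real (exp (pi * v / 2)) * (LINT s:{0..}|lborel. ?h s)"
  proof -
    have "exp (- exp z * (\<i> * of_real (cosh s) - of_real s - \<i> * of_real (pi / 2))) = of_real (exp (pi * v / 2)) * ?h s" for s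
      unfolding ez exp_of_real[symmetric] exp_add[symmetric] by (rule arg_cong[where f = exp]) (simp add: algebra_simps)
    thus ?thesis unfolding F2b_def by (simp only: set_integral_mult_right)
  qed
  have F2a: "F2a z + cnj (F2a z) = 0"
  proof -
    have "\<i> * exp (- exp z * (\<i> * of_real (sin y - y))) = \<i> * of_real (exp (v * (y - sin y)))" for y
      unfolding ez exp_of_real[symmetric] by (simp add: algebra_simps)
    hence "F2a z = \<i> * of_real (LINT y:{0..pi/2}|lborel. exp (v * (y - sin y)))"
      unfolding F2a_def by (simp only: set_integral_mult_right set_integral_complex_of_real)
    thus ?thesis by simp
  qed
  have hi: "set_integrable lborel {0..} ?h"
  proof -
    have "set_integrable lborel {0..} (\<lambda>s. exp (- (- \<i> * of_real v) * (\<i> * of_real (cosh s) - of_real s - \<i> * of_real (pi / 2))))"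
      by (rule F2b_integrable) (use v in simp)
    hence "set_integrable lborel {0..} (\<lambda>s. of_real (exp (- pi * v / 2)) * exp (- (- \<i> * of_real v) * (\<i> * of_real (cosh s) - of_real s - \<i> * of_real (pi / 2))))"
      by (rule set_integrable_mult_right)
    moreover have "of_real (exp (- pi * v / 2)) * exp (- (- \<i> * of_real v) * (\<i> * of_real (cosh s) - of_real s - \<i> * of_real (pi / 2))) = ?h s" for s
      unfolding exp_of_real[symmetric] exp_add[symmetric] by (rule arg_cong[where f = exp]) (simp add: algebra_simps)
    ultimately show ?thesis by (simp only:)
  qed
  have hc: "?h (- s) = cnj (?h s)" for s by (simp add: exp_cnj)
  have he: "(\<lambda>s. indicator {0..} s *\<^sub>R ?h (- s)) = (\<lambda>s. cnj (indicator {0..} s *\<^sub>R ?h s))"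
    unfolding hc by (simp add: fun_eq_iff scaleR_conv_of_real)
  have hi': "set_integrable lborel {0..} (\<lambda>s. ?h (- s))"
    unfolding set_integrable_def he using hi unfolding set_integrable_def by (rule integrable_cnj)
  have hl: "(LINT s:{0..}|lborel. ?h (- s)) = cnj (LINT s:{0..}|lborel. ?h s)"
    unfolding set_lebesgue_integral_def he by (rule Bochner_Integration.integral_cnj)
  have "half_remainder 0 \<zeta> 0 = cnj (half_remainder 0 z 0)" using half_remainder_cnj[of 0 z 0] z by simp
  moreover have "half_remainder 0 z 0 = F2a z + F2b z" by (rule half_remainder_0_eq_F2) (use z in auto)
  ultimately have "half_remainder 0 \<zeta> 0 + half_remainder 0 z 0 = (F2a z + cnj (F2a z)) + (F2b z + cnj (F2b z))" by (simp add: algebra_simps)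
  also have "\<dots> = of_real (exp (pi * v / 2)) * ((LINT s:{0..}|lborel. ?h s) + cnj (LINT s:{0..}|lborel. ?h s))"
    unfolding F2a F2b by (simp add: algebra_simps)
  also have "\<dots> = of_real (exp (pi * v / 2)) * (\<integral>s. ?h s \<partial>lborel)"
    unfolding LINT_even_split[OF hi hi'] hl ..
  finally have "half_remainder 0 \<zeta> 0 + half_remainder 0 z 0 = of_real (exp (pi * v / 2)) * (\<integral>s. ?h s \<partial>lborel)" .
  moreover have "\<zeta> = Complex (ln v) (pi / 2)" using assms by (simp add: v_def complex_eq_iff)
  ultimately show ?thesis using hankel1_diag_imaginary[OF v] by (simp add: z_def)
qed

lemma R_H_Suc:
  "R_H (Suc N) \<zeta> = R_H N \<zeta> + of_real (2 / (3 * pi)) * (of_real (6 powr ((2 * real N + 1) / 3)) * B0 (2 * N)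
          * exp (of_real (2 * (2 * real N + 1) * pi / 3) * \<i>)
          * of_real (sin ((2 * real N + 1) * pi / 3))
          * (of_real (Gamma ((2 * real N + 1) / 3)) / exp (of_real ((2 * real N + 1) / 3) * \<zeta>)))"
proof -
  have "h - (- c * (s + t)) = h - (- c * s) + c * t" for h c s t :: complex by (simp add: algebra_simps)
  thus ?thesis unfolding R_H_def sum.lessThan_Suc .
qed

text \<open>With \<open>e = exp (\<i> a)\<close> one has \<open>e^3 = - 1\<close>, hence
  \<open>e^2 (e - 1/e) = - (1 + e)\<close>. Thus the trigonometric coefficient in \<open>R_H\<close>
  is the sum of the contributions from \<open>\<zeta>\<close> and
  \<open>\<zeta> - \<i> pi\<close>.\<close>

lemma exp_sin_identity:
  fixes N :: nat
  defines "a \<equiv> (2 * real N + 1) * pi / 3"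
  shows "2 * exp (of_real (2 * a) * \<i>) * of_real (sin a) = - (1 + exp (of_real a * \<i>)) / \<i>"
proof -
  let ?e = "exp (of_real a * \<i>)"
  have e3: "?e ^ 3 = - 1"
  proof -
    have "?e ^ 3 = exp (of_real pi * \<i>) ^ (2 * N + 1)"
      unfolding exp_of_nat_mult[symmetric] by (rule arg_cong[where f = exp]) (simp add: a_def field_simps)
    thus ?thesis by (simp add: power_mult)
  qed
  have e2: "exp (of_real (2 * a) * \<i>) = ?e ^ 2"
    unfolding exp_of_nat_mult[symmetric] by (rule arg_cong[where f = exp]) (simp add: field_simps)
  have "complex_of_real (sin a) = (?e - inverse ?e) / (2 * \<i>)"
    unfolding sin_of_real[symmetric] sin_exp_eq by (simp add: exp_minus mult.commute)
  moreover have "2 * e ^ 2 * ((e - inverse e) / (2 * \<i>)) = (e ^ 3 - e) / \<i>" if "e \<noteq> 0" for e :: complex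
    using that by (simp add: field_simps power2_eq_square power3_eq_cube)
  from this[of ?e] have "2 * ?e ^ 2 * ((?e - inverse ?e) / (2 * \<i>)) = (?e ^ 3 - ?e) / \<i>" by simp
  ultimately have "2 * exp (of_real (2 * a) * \<i>) * of_real (sin a) = (?e ^ 3 - ?e) / \<i>"
    unfolding e2 by (simp only:)
  thus ?thesis unfolding e3 by (simp add: field_simps)
qed

text \<open>Induction on \<open>N\<close>: in each step both sides lose the same term, by
  \<open>half_remainder_rec\<close> and \<open>exp_sin_identity\<close>.\<close>

lemma R_H_eq_half_remainder:
  assumes "Im \<zeta> = pi / 2"
  shows "R_H N \<zeta> = (half_remainder N \<zeta> 0 + half_remainder N (\<zeta> - \<i> * of_real pi) 0) / (of_real pi * \<i>)"
proof (induction N)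
  case 0
  show ?case using hankel1_diag_eq_half_remainder[OF assms] by (simp add: R_H_def)
next
  case (Suc N)
  define p where "p = (2 * real N + 1) / 3"
  let ?z = "\<zeta> - \<i> * of_real pi"
  let ?E = "exp (- of_real p * \<zeta>)"
  let ?e = "exp (of_real (p * pi) * \<i>)"
  let ?A = "of_real (6 powr p) * B0 (2 * N)"
  have adm: "ray_admissible \<zeta> 0" "ray_admissible ?z 0" by (simp_all add: ray_admissible_def assms)
  have A: "?A = of_real ((-1) ^ N * (2 / pi) * rho_moment N)" using B0_eq_rho_moment[of N] by (simp add: p_def)
  have 1: "half_remainder N \<zeta> 0 = ?A * of_real (Gamma p / 3) * ?E + half_remainder (Suc N) \<zeta> 0"
    unfolding A using half_remainder_rec[OF adm(1), of N] by (simp add: p_def)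
  have "exp (- of_real p * ?z) = ?e * ?E"
    unfolding exp_add[symmetric] by (rule arg_cong[where f = exp]) (simp add: algebra_simps)
  hence 2: "half_remainder N ?z 0 = ?A * of_real (Gamma p / 3) * (?e * ?E) + half_remainder (Suc N) ?z 0"
    unfolding A using half_remainder_rec[OF adm(2), of N] by (simp only: p_def of_real_mult mult.assoc)
  have pp: "(2 * real N + 1) * pi / 3 = p * pi" "2 * (2 * real N + 1) * pi / 3 = 2 * (p * pi)" by (simp_all add: p_def)
  have id: "2 * exp (of_real (2 * (p * pi)) * \<i>) * of_real (sin (p * pi)) = - (1 + ?e) / \<i>"
    using exp_sin_identity[of N] unfolding pp by simp
  have "R_H (Suc N) \<zeta> = R_H N \<zeta> + of_real (2 / (3 * pi)) * (?A
          * exp (of_real (2 * (p * pi)) * \<i>) * of_real (sin (p * pi))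
          * (of_real (Gamma p) / exp (of_real p * \<zeta>)))"
    unfolding R_H_Suc pp unfolding p_def[symmetric] ..
  also have "\<dots> = R_H N \<zeta> + ?A * of_real (Gamma p / 3) * ?E * (2 * exp (of_real (2 * (p * pi)) * \<i>) * of_real (sin (p * pi))) / of_real pi"
    by (simp add: exp_minus field_simps)
  also have "\<dots> = (half_remainder N \<zeta> 0 + half_remainder N ?z 0 - ?A * of_real (Gamma p / 3) * ?E * (1 + ?e)) / (of_real pi * \<i>)"
    unfolding id Suc.IH by (simp add: field_simps)
  also have "half_remainder N \<zeta> 0 + half_remainder N ?z 0 - ?A * of_real (Gamma p / 3) * ?E * (1 + ?e) = half_remainder (Suc N) \<zeta> 0 + half_remainder (Suc N) ?z 0"
    unfolding 1 2 by (simp add: algebra_simps)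
  finally show ?case .
qed

section \<open>Estimates for the remainder\<close>

definition omega :: complex where "omega = cis (2 * pi / 3)"

text \<open>The factor that the term with index \<open>N\<close> picks up when
  \<open>\<zeta>\<close> is replaced by \<open>\<zeta> - \<i> pi\<close>; \<open>omega\<close> is
  the ratio of consecutive phases.\<close>

definition phase :: "nat \<Rightarrow> complex" where "phase N = cis ((2 * real N + 1) * pi / 3)"

text \<open>The combination for which the two kernels \<open>1/(1 + z)\<close> and \<open>1/(1 + omega * z)\<close> merge, by partial
  fractions, into \<open>1/((1 + z) (1 + omega * z))\<close>.\<close>
definition combined_remainder :: "nat \<Rightarrow> complex \<Rightarrow> complex \<Rightarrow> complex" where
  "combined_remainder N \<zeta> \<psi> = (half_remainder N \<zeta> \<psi> - omega / phase N * half_remainder N (\<zeta> - \<i> * of_real pi) \<psi>) / (1 - omega)"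

lemma omega_value: "omega = Complex (- 1 / 2) (sqrt 3 / 2)"
  by (simp add: omega_def complex_eq_iff cos_120 sin_120)

lemma omega_neq_1: "1 - omega \<noteq> 0" by (simp add: omega_value complex_eq_iff)

lemma phase_nonzero: "phase N \<noteq> 0" by (simp add: phase_def)

lemma phase_Suc: "phase (Suc N) = phase N * omega"
  by (simp add: phase_def omega_def cis_mult algebra_simps add_divide_distrib)

lemma phase_periodic: "phase (N + 3) = phase N"
proof -
  have "omega ^ 3 = cis (3 * (2 * pi / 3))" unfolding omega_def using Complex.DeMoivre[of "2 * pi / 3" 3] by simp
  hence "omega ^ 3 = 1" by simp
  hence "omega * omega * omega = 1" by (simp add: power3_eq_cube)
  thus ?thesis by (simp add: numeral_3_eq_3 phase_Suc mult.assoc)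
qed

lemma phase_mod: "phase N = phase (N mod 3)"
proof (induction N rule: less_induct)
  case (less N)
  show ?case
  proof (cases "N < 3")
    case False
    hence "phase N = phase (N - 3)" using phase_periodic[of "N - 3"] by simp
    also have "\<dots> = phase ((N - 3) mod 3)" using False by (intro less) auto
    also have "(N - 3) mod 3 = N mod 3" using False by (simp add: le_mod_geq)
    finally show ?thesis .
  qed simp
qed

text \<open>The phases run through \<open>exp (\<i> pi / 3)\<close>, \<open>- 1\<close>,
  \<open>exp (- \<i> pi / 3)\<close>. Every nonzero sum has modulus \<open>sqrt 3\<close>, which
  combines with the factor \<open>1/3\<close> of the integral bound to the \<open>1 / sqrt 3\<close>
  of the theorem.\<close>

lemma norm_one_plus_phase:
  "N mod 3 = 0 \<Longrightarrow> cmod (1 + phase N) = sqrt 3" "N mod 3 = 0 \<Longrightarrow> cmod (omega + phase N) = sqrt 3"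
  "N mod 3 = 1 \<Longrightarrow> 1 + phase N = 0" "N mod 3 = 1 \<Longrightarrow> cmod (omega + phase N) = sqrt 3"
  "N mod 3 = 2 \<Longrightarrow> cmod (1 + phase N) = sqrt 3" "N mod 3 = 2 \<Longrightarrow> omega + phase N = 0"
proof -
  have e0: "phase 0 = Complex (1 / 2) (sqrt 3 / 2)"
    by (simp add: phase_def complex_eq_iff cos_60 sin_60)
  have e1: "phase 1 = - 1" unfolding One_nat_def phase_Suc e0 omega_value by (simp add: complex_eq_iff)
  have e2: "phase 2 = Complex (1 / 2) (- (sqrt 3 / 2))"
    unfolding numeral_2_eq_2 phase_Suc e0 omega_value by (simp add: complex_eq_iff algebra_simps)
  have s: "sqrt (9 / 4 + 3 / 4) = sqrt (3::real)" by simp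
  show "N mod 3 = 0 \<Longrightarrow> cmod (1 + phase N) = sqrt 3"
    using phase_mod[of N] s by (simp add: e0 cmod_def power2_eq_square)
  show "N mod 3 = 0 \<Longrightarrow> cmod (omega + phase N) = sqrt 3"
    using phase_mod[of N] by (simp add: e0 omega_value cmod_def power2_eq_square)
  show "N mod 3 = 1 \<Longrightarrow> 1 + phase N = 0"
    using phase_mod[of N] e1 by simp
  show "N mod 3 = 1 \<Longrightarrow> cmod (omega + phase N) = sqrt 3"
    using phase_mod[of N] s e1 by (simp add: omega_value cmod_def power2_eq_square)
  show "N mod 3 = 2 \<Longrightarrow> cmod (1 + phase N) = sqrt 3"
    using phase_mod[of N] s by (simp add: e2 cmod_def power2_eq_square)
  show "N mod 3 = 2 \<Longrightarrow> omega + phase N = 0"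
    using phase_mod[of N] by (simp add: e2 omega_value complex_eq_iff)
qed

lemma R_H_eq_combined_remainder:
  assumes "Im \<zeta> = pi / 2"
  shows "R_H N \<zeta> = ((1 + phase N) * combined_remainder N \<zeta> 0 - (omega + phase N) * combined_remainder (Suc N) \<zeta> 0) / (of_real pi * \<i>)"
proof -
  define p where "p = (2 * real N + 1) / 3"
  let ?z = "\<zeta> - \<i> * of_real pi"
  define T where "T = of_real ((-1) ^ N * (2 / pi) * rho_moment N * (Gamma p / 3)) * exp (- of_real p * \<zeta>)"
  have adm: "ray_admissible \<zeta> 0" "ray_admissible ?z 0" by (simp_all add: ray_admissible_def assms)
  have 1: "half_remainder N \<zeta> 0 = T + half_remainder (Suc N) \<zeta> 0"
    using half_remainder_rec[OF adm(1), of N] by (simp add: T_def p_def)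
  have "exp (- of_real p * ?z) = phase N * exp (- of_real p * \<zeta>)"
  proof -
    have e: "(2 * real N + 1) * pi / 3 = p * pi" by (simp add: p_def)
    show ?thesis unfolding phase_def e cis_conv_exp exp_add[symmetric]
      by (rule arg_cong[where f = exp]) (simp add: algebra_simps)
  qed
  hence 2: "half_remainder N ?z 0 = phase N * T + half_remainder (Suc N) ?z 0"
    using half_remainder_rec[OF adm(2), of N] unfolding T_def p_def by (simp only: mult.left_commute)
  \<comment> \<open>In the combination with index \<open>N + 1\<close> the split-off terms cancel,
    because \<open>omega / phase (Suc N) = 1 / phase N\<close>, leaving \<open>F - F' / e\<close>.
    Solving this together with \<open>F - w / e * F'\<close> for \<open>F + F'\<close> gives the
    coefficients \<open>1 + e\<close> and \<open>w + e\<close>.\<close>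
  have alg: "F + F' = (1 + e) * ((F - w / e * F') / (1 - w)) - (w + e) * (((F - T) - w / (e * w) * (F' - e * T)) / (1 - w))"
    if "e \<noteq> 0" "w \<noteq> 0" "1 - w \<noteq> 0" for F F' e w T :: complex
  proof -
    have "w / (e * w) * (F' - e * T) = F' / e - T" using that by (simp add: field_simps)
    hence FT: "((F - T) - w / (e * w) * (F' - e * T)) = F - F' / e" by simp
    have "(1 + e) * (F - w / e * F') - (w + e) * (F - F' / e) = (F + F') * (1 - w)"
      using that by (simp add: field_simps)
    hence "F + F' = ((1 + e) * (F - w / e * F') - (w + e) * ((F - T) - w / (e * w) * (F' - e * T))) / (1 - w)"
      unfolding FT using that by simp
    also have "\<dots> = (1 + e) * ((F - w / e * F') / (1 - w)) - (w + e) * (((F - T) - w / (e * w) * (F' - e * T)) / (1 - w))"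
      using that(3) by (metis (no_types) diff_divide_distrib times_divide_eq_right)
    finally show ?thesis .
  qed
  have "omega \<noteq> 0" by (simp add: omega_def)
  have F: "half_remainder (Suc N) \<zeta> 0 = half_remainder N \<zeta> 0 - T" "half_remainder (Suc N) ?z 0 = half_remainder N ?z 0 - phase N * T" using 1 2 by simp_all
  have "half_remainder N \<zeta> 0 + half_remainder N ?z 0 = (1 + phase N) * combined_remainder N \<zeta> 0 - (omega + phase N) * combined_remainder (Suc N) \<zeta> 0"
    unfolding combined_remainder_def phase_Suc F by (rule alg[OF phase_nonzero \<open>omega \<noteq> 0\<close> omega_neq_1])
  thus ?thesis using R_H_eq_half_remainder[OF assms, of N] by simp
qed

text \<open>Admissibility of the ray for \<open>\<zeta>\<close> and \<open>\<zeta> - \<i> pi\<close>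
  at once: the intersection of two windows of half-width \<open>3 pi / 2\<close> displaced by
  \<open>pi\<close>.\<close>

definition angle_admissible :: "complex \<Rightarrow> real \<Rightarrow> bool" where
  "angle_admissible \<zeta> \<phi> \<longleftrightarrow> \<bar>\<phi>\<bar> < pi / 2 \<and> \<phi> - pi / 2 < Im \<zeta> \<and> Im \<zeta> < \<phi> + 3 * pi / 2"

lemma angle_admissible_imp_ray_admissible: "angle_admissible \<zeta> \<phi> \<Longrightarrow> ray_admissible \<zeta> (\<i> * of_real \<phi>) \<and> ray_admissible (\<zeta> - \<i> * of_real pi) (\<i> * of_real \<phi>)"
proof -
  assume "angle_admissible \<zeta> \<phi>"
  moreover have "Im (\<i> * of_real \<phi>) = \<phi>" "Im (\<zeta> - \<i> * of_real pi) = Im \<zeta> - pi" by simp_all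
  ultimately show ?thesis unfolding angle_admissible_def ray_admissible_def abs_less_iff by linarith
qed

lemma combined_remainder_independent:
  assumes "angle_admissible \<zeta> \<phi>1" "angle_admissible \<zeta> \<phi>2"
  shows "combined_remainder N \<zeta> (\<i> * of_real \<phi>1) = combined_remainder N \<zeta> (\<i> * of_real \<phi>2)"
  unfolding combined_remainder_def
  using half_remainder_independent[of \<zeta> "\<i> * of_real \<phi>1" "\<i> * of_real \<phi>2" N]
    half_remainder_independent[of "\<zeta> - \<i> * of_real pi" "\<i> * of_real \<phi>1" "\<i> * of_real \<phi>2" N]
    angle_admissible_imp_ray_admissible[OF assms(1)] angle_admissible_imp_ray_admissible[OF assms(2)] by simp

section \<open>Continuing the representation of the remainder to all admissible arguments\<close>

lemma R_H_holomorphic: "R_H N holomorphic_on {\<zeta>. exp \<zeta> \<notin> \<int>}"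
  unfolding R_H_def[abs_def]
  by (intro holomorphic_intros hankel1_diag_holomorphic) auto

lemma countable_exp_Ints: "countable {\<zeta>::complex. exp \<zeta> \<in> \<int>}"
proof -
  have "{\<zeta>::complex. exp \<zeta> \<in> \<int>} \<subseteq> (\<lambda>(n::int, k::int). Ln (of_int n) + of_real (of_int (2 * k) * pi) * \<i>) ` UNIV"
  proof
    fix \<zeta> :: complex assume "\<zeta> \<in> {\<zeta>. exp \<zeta> \<in> \<int>}"
    then obtain n :: int where n: "exp \<zeta> = of_int n" by (auto elim: Ints_cases)
    hence "(of_int n :: complex) \<noteq> 0" by (metis exp_not_eq_zero)
    hence "exp \<zeta> = exp (Ln (of_int n))" using n by simp
    then obtain k :: int where "\<zeta> = Ln (of_int n) + of_real (of_int (2 * k) * pi) * \<i>"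
      unfolding exp_eq by auto
    thus "\<zeta> \<in> (\<lambda>(n::int, k::int). Ln (of_int n) + of_real (of_int (2 * k) * pi) * \<i>) ` UNIV" by force
  qed
  thus ?thesis by (rule countable_subset) auto
qed

text \<open>The line \<open>Im \<zeta> = pi / 2\<close> is admissible for every angle below
  \<open>pi / 2\<close> in modulus, and there both angles can be moved to 0. The identity theorem
  carries the formula through the strip common to both angles; removing the countably many points of
  integer order keeps it connected.\<close>

lemma R_H_representation:
  assumes adm: "angle_admissible \<zeta> \<phi>1" "angle_admissible \<zeta> \<phi>2" and nint: "exp \<zeta> \<notin> \<int>"
  shows "R_H N \<zeta> = ((1 + phase N) * combined_remainder N \<zeta> (\<i> * of_real \<phi>1) - (omega + phase N) * combined_remainder (Suc N) \<zeta> (\<i> * of_real \<phi>2)) / (of_real pi * \<i>)"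
proof -
  define S where "S = {\<zeta>. angle_admissible \<zeta> \<phi>1} \<inter> {\<zeta>. angle_admissible \<zeta> \<phi>2}"
  have ph: "\<bar>\<phi>1\<bar> < pi / 2" "\<bar>\<phi>2\<bar> < pi / 2" using adm by (auto simp: angle_admissible_def)
  have eq: "S = ({\<zeta>. Im \<zeta> > \<phi>1 - pi / 2} \<inter> {\<zeta>. Im \<zeta> < \<phi>1 + 3 * pi / 2}) \<inter> ({\<zeta>. Im \<zeta> > \<phi>2 - pi / 2} \<inter> {\<zeta>. Im \<zeta> < \<phi>2 + 3 * pi / 2})"
    using ph by (auto simp: S_def angle_admissible_def)
  have S: "open S" "convex S" unfolding eq
    by (intro convex_Int open_Int convex_halfspace_Im_lt convex_halfspace_Im_gt open_halfspace_Im_lt open_halfspace_Im_gt)+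
  define T where "T = S \<inter> {\<zeta>. exp \<zeta> \<notin> \<int>}"
  have "open T" unfolding T_def using S(1) open_exp_not_Ints by (rule open_Int)
  have "connected (S - {\<zeta>. exp \<zeta> \<in> \<int>})"
    by (rule connected_open_diff_countable) (use S countable_exp_Ints in \<open>auto intro: convex_connected\<close>)
  moreover have "S - {\<zeta>. exp \<zeta> \<in> \<int>} = T" by (auto simp: T_def)
  ultimately have "connected T" by simp
  define U where "U = (\<lambda>x. Complex x (pi / 2)) ` UNIV"
  have im: "Im z = pi / 2" if "z \<in> U" for z using that by (auto simp: U_def)
  have U: "U \<subseteq> T"
  proof
    fix z assume z: "z \<in> U"
    have "exp z \<notin> \<int>"
    proof
      assume "exp z \<in> \<int>"
      then obtain n :: int where "exp z = of_int n" by (auto elim: Ints_cases)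
      hence "Im (exp z) = 0" by simp
      thus False using im[OF z] by (simp add: Im_exp)
    qed
    moreover have "angle_admissible z \<phi>1" "angle_admissible z \<phi>2" using im[OF z] ph by (auto simp: angle_admissible_def abs_less_iff)
    ultimately show "z \<in> T" by (simp add: T_def S_def)
  qed
  have z0: "Complex 0 (pi / 2) \<in> U" by (auto simp: U_def)
  have lim: "Complex 0 (pi / 2) islimpt U"
    unfolding islimpt_approachable
  proof (intro allI impI)
    fix e :: real assume e: "e > 0"
    have d: "Complex (e / 2) (pi / 2) - Complex 0 (pi / 2) = of_real (e / 2)" by (simp add: complex_eq_iff)
    show "\<exists>x'\<in>U. x' \<noteq> Complex 0 (pi / 2) \<and> dist x' (Complex 0 (pi / 2)) < e"
      using e by (intro bexI[of _ "Complex (e / 2) (pi / 2)"]) (auto simp: U_def dist_norm d simp del: of_real_divide)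
  qed
  let ?G = "\<lambda>\<zeta>. ((1 + phase N) * combined_remainder N \<zeta> (\<i> * of_real \<phi>1) - (omega + phase N) * combined_remainder (Suc N) \<zeta> (\<i> * of_real \<phi>2)) / (of_real pi * \<i>)"
  have Gh: "(\<lambda>\<zeta>. combined_remainder n \<zeta> (\<i> * of_real \<phi>)) holomorphic_on S" if "\<And>z. z \<in> S \<Longrightarrow> angle_admissible z \<phi>" for n \<phi>
  proof -
    have "(\<lambda>\<zeta>. half_remainder n \<zeta> (\<i> * of_real \<phi>)) holomorphic_on S"
      by (rule half_remainder_holomorphic[OF S(1)]) (use that angle_admissible_imp_ray_admissible in auto)
    moreover have "(\<lambda>\<zeta>. half_remainder n (\<zeta> - \<i> * of_real pi) (\<i> * of_real \<phi>)) holomorphic_on S"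
      by (rule half_remainder_holomorphic[OF S(1)]) (use that angle_admissible_imp_ray_admissible in \<open>auto intro!: holomorphic_intros\<close>)
    ultimately show ?thesis unfolding combined_remainder_def using omega_neq_1 by (intro holomorphic_intros) auto
  qed
  have "(\<lambda>\<zeta>. R_H N \<zeta> - ?G \<zeta>) holomorphic_on T"
  proof (rule holomorphic_on_diff)
    show "R_H N holomorphic_on T" by (rule holomorphic_on_subset[OF R_H_holomorphic]) (auto simp: T_def)
    show "?G holomorphic_on T"
    proof (rule holomorphic_on_subset)
      have "(\<lambda>\<zeta>. combined_remainder N \<zeta> (\<i> * of_real \<phi>1)) holomorphic_on S" by (rule Gh) (simp add: S_def)
      moreover have "(\<lambda>\<zeta>. combined_remainder (Suc N) \<zeta> (\<i> * of_real \<phi>2)) holomorphic_on S" by (rule Gh) (simp add: S_def)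
      ultimately show "?G holomorphic_on S" by (intro holomorphic_intros) auto
      show "T \<subseteq> S" by (auto simp: T_def)
    qed
  qed
  moreover have "R_H N z - ?G z = 0" if "z \<in> U" for z
  proof -
    have a: "angle_admissible z \<phi>1" "angle_admissible z \<phi>2" using U that by (auto simp: T_def S_def)
    have a0: "angle_admissible z 0" unfolding angle_admissible_def im[OF that] by simp
    show ?thesis
      using R_H_eq_combined_remainder[OF im[OF that], of N] combined_remainder_independent[OF a(1) a0, of N] combined_remainder_independent[OF a(2) a0, of "Suc N"] by simp
  qed
  ultimately have "R_H N \<zeta> - ?G \<zeta> = 0"
    using analytic_continuation[OF _ \<open>open T\<close> \<open>connected T\<close> U subsetD[OF U z0] lim, of "\<lambda>\<zeta>. R_H N \<zeta> - ?G \<zeta>" \<zeta>] adm nint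
    by (simp add: T_def S_def)
  thus ?thesis by simp
qed

text \<open>After the partial fractions the integrand is at most \<open>r powr (- p) / K\<close>
  times \<open>majorant\<close>, whose integral is a moment; by \<open>B0_eq_rho_moment\<close> this
  moment is the modulus of the coefficient, and the factor \<open>1/3\<close> comes from the cubic
  substitution.\<close>

lemma combined_remainder_bound:
  assumes r: "r > 0" and adm: "angle_admissible (log_point r \<theta>) \<phi>"
    and K: "K > 0" "\<And>q. q \<ge> 0 \<Longrightarrow> K \<le> cmod ((1 + of_real q * cis (2 * (\<phi> - \<theta>) / 3)) * (1 + omega * (of_real q * cis (2 * (\<phi> - \<theta>) / 3))))"
  shows "cmod (combined_remainder N (log_point r \<theta>) (\<i> * of_real \<phi>)) \<le> 1 / K / cos \<phi> powr ((2 * real N + 1) / 3) * (b_term N r / 3)"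
proof -
  define p where "p = (2 * real N + 1) / 3"
  let ?\<zeta> = "log_point r \<theta>" and ?\<psi> = "\<i> * of_real \<phi>"
  let ?z = "?\<zeta> - \<i> * of_real pi"
  define a where "a = (?\<psi> - ?\<zeta>) / 3"
  have c: "cos \<phi> > 0" using adm by (intro cos_pos_of_abs_less) (simp add: angle_admissible_def)
  have F: "ray_admissible ?\<zeta> ?\<psi>" "ray_admissible ?z ?\<psi>" using angle_admissible_imp_ray_admissible[OF adm] by auto
  have a': "(?\<psi> - ?z) / 3 = a + \<i> * of_real (pi / 3)" by (simp add: a_def field_simps)
  have ea1: "exp (of_nat (2 * N + 1) * (a + \<i> * of_real (pi / 3))) = exp (of_nat (2 * N + 1) * a) * phase N"
    unfolding phase_def cis_conv_exp exp_add[symmetric] by (rule arg_cong[where f = exp]) (simp add: field_simps)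
  have ea2: "exp (2 * (a + \<i> * of_real (pi / 3))) = omega * exp (2 * a)"
    unfolding omega_def cis_conv_exp exp_add[symmetric] by (rule arg_cong[where f = exp]) (simp add: field_simps)
  have Re_a: "Re a = - ln r / 3" "Im a = (\<phi> - \<theta>) / 3" by (simp_all add: a_def log_point_def)
  let ?k = "\<lambda>p. (remainder_kernel N ?\<zeta> ?\<psi> p - omega / phase N * remainder_kernel N ?z ?\<psi> p) / (1 - omega)"
  have ki: "set_integrable lborel quadrant ?k"
    by (intro set_integral_diff(1) set_integrable_mult_right set_integrable_divide remainder_kernel_integrable F)
  have kb: "cmod (?k q) \<le> 1 / K * r powr (- p) * majorant N (cos \<phi>) q" if q: "q \<in> quadrant" for q
  proof -
    obtain x w where xw: "q = (x, w)" "x > 0" "w > 0" using q by (cases q) auto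
    have rh: "rho x > 0" using rho_gt_1[OF xw(2)] by simp
    define Q where "Q = exp (2 * Re a) * (w / rho x) ^ 2"
    have Q: "Q \<ge> 0" by (simp add: Q_def)
    define Z where "Z = of_real Q * cis (2 * (\<phi> - \<theta>) / 3)"
    have Z: "exp (2 * a) * of_real ((w / rho x) ^ 2) = Z"
      unfolding Z_def Q_def by (subst exp_eq_polar) (simp add: Re_a mult_ac)
    define A where "A = exp (of_nat (2 * N + 1) * a) * of_real (w ^ (2 * N) / rho x ^ (2 * N + 1)) * exp (- exp ?\<psi> * of_real (w ^ 3))"
    have KZ: "K \<le> cmod ((1 + Z) * (1 + omega * Z))" unfolding Z_def by (rule K(2)[OF Q])
    hence nz: "1 + Z \<noteq> 0" "1 + omega * Z \<noteq> 0" using K(1) by auto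
    have 1: "remainder_kernel N ?\<zeta> ?\<psi> q = A / (1 + Z)"
      unfolding xw remainder_kernel_def prod.case a_def[symmetric] Z A_def ..
    have 2: "remainder_kernel N ?z ?\<psi> q = phase N * A / (1 + omega * Z)"
      unfolding xw remainder_kernel_def prod.case a' ea1 ea2 mult.assoc[of omega] Z A_def by (simp only: mult_ac)
    have "?k q = A / ((1 + Z) * (1 + omega * Z))"
    proof -
      have "(A / (1 + Z) - w / e * (e * A / (1 + w * Z))) / (1 - w) = A / ((1 + Z) * (1 + w * Z))"
        if "e \<noteq> 0" "1 + Z \<noteq> 0" "1 + w * Z \<noteq> 0" "1 - w \<noteq> 0" for e w :: complex
      proof -
        have "w / e * (e * A / (1 + w * Z)) = w * A / (1 + w * Z)" using that(1) by simp
        hence "A / (1 + Z) - w / e * (e * A / (1 + w * Z)) = (A * (1 + w * Z) - w * A * (1 + Z)) / ((1 + Z) * (1 + w * Z))"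
          using that by (simp add: diff_frac_eq)
        also have "A * (1 + w * Z) - w * A * (1 + Z) = A * (1 - w)" by (simp add: algebra_simps)
        finally show ?thesis using that(4) by simp
      qed
      from this[OF phase_nonzero nz omega_neq_1, of N] show ?thesis unfolding 1 2 .
    qed
    hence "cmod (?k q) = cmod A / cmod ((1 + Z) * (1 + omega * Z))" by (simp only: norm_divide)
    also have "\<dots> \<le> cmod A / K" using KZ K(1) by (intro divide_left_mono mult_pos_pos) auto
    also have "cmod A = r powr (- p) * majorant N (cos \<phi>) q"
    proof -
      have "Re (of_nat (2 * N + 1) * a) = - p * ln r"
      proof -
        have "Re (of_nat (2 * N + 1) * a) = real (2 * N + 1) * Re a"
          by (simp only: times_complex.sel complex_Re_of_nat complex_Im_of_nat mult_zero_left diff_zero)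
        thus ?thesis unfolding Re_a p_def by simp
      qed
      hence "cmod (exp (of_nat (2 * N + 1) * a)) = r powr (- p)"
        using r by (simp only: norm_exp_eq_Re powr_def) simp
      moreover have "cmod (exp (- exp ?\<psi> * of_real (w ^ 3))) = exp (- cos \<phi> * w ^ 3)"
        unfolding norm_exp_eq_Re by (simp add: Re_exp)
      ultimately show ?thesis
        unfolding A_def norm_mult norm_of_real xw majorant_def prod.case using xw rh by simp
    qed
    finally show ?thesis by simp
  qed
  have gi: "set_integrable lborel quadrant (\<lambda>q. 1 / K * r powr (- p) * majorant N (cos \<phi>) q)"
    by (intro set_integrable_mult_right majorant_integrable c)
  have "combined_remainder N ?\<zeta> ?\<psi> = of_real ((-1) ^ N * (2 / pi)) * (LINT q:quadrant|lborel. ?k q)"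
  proof -
    have "(LINT q:quadrant|lborel. ?k q) = ((LINT q:quadrant|lborel. remainder_kernel N ?\<zeta> ?\<psi> q) - omega / phase N * (LINT q:quadrant|lborel. remainder_kernel N ?z ?\<psi> q)) / (1 - omega)"
      using remainder_kernel_integrable[OF F(1), of N] set_integrable_mult_right[of "omega / phase N", OF remainder_kernel_integrable[OF F(2), of N]]
      by (simp only: set_integral_divide_zero set_integral_diff(2) set_integral_mult_right)
    hence I: "(LINT q:quadrant|lborel. ?k q) = ((LINT q:quadrant|lborel. remainder_kernel N ?\<zeta> ?\<psi> q) - omega / phase N * (LINT q:quadrant|lborel. remainder_kernel N ?z ?\<psi> q)) / (1 - omega)" .
    have "(c * I - w * (c * J)) / d = c * ((I - w * J) / d)" for c I J w d :: complex
      by (simp add: algebra_simps)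
    thus ?thesis unfolding combined_remainder_def half_remainder_def I .
  qed
  hence "cmod (combined_remainder N ?\<zeta> ?\<psi>) = 2 / pi * cmod (LINT q:quadrant|lborel. ?k q)" by (simp add: norm_mult norm_power norm_divide)
  also have "cmod (LINT q:quadrant|lborel. ?k q) \<le> (LINT q:quadrant|lborel. 1 / K * r powr (- p) * majorant N (cos \<phi>) q)"
    by (rule order_trans[OF set_integral_norm_bound[OF ki] set_integral_mono[OF set_integrable_norm[OF ki] gi kb]])
  also have "\<dots> = 1 / K * r powr (- p) * (rho_moment N * (Gamma p / (3 * cos \<phi> powr p)))"
    unfolding set_integral_mult_right majorant_integral[OF c] p_def ..
  finally have "cmod (combined_remainder N ?\<zeta> ?\<psi>) \<le> 2 / pi * (1 / K * r powr (- p) * (rho_moment N * (Gamma p / (3 * cos \<phi> powr p))))"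
    by (simp add: mult_left_mono divide_right_mono)
  also have "\<dots> = 1 / K / cos \<phi> powr p * (b_term N r / 3)"
  proof -
    have "cmod (of_real (6 powr p) * B0 (2 * N)) = 2 / pi * rho_moment N"
      unfolding p_def B0_eq_rho_moment using rho_moment_nonneg[of N] by (simp add: norm_mult norm_power norm_divide)
    hence "6 powr p * cmod (B0 (2 * N)) = 2 / pi * rho_moment N" by (simp add: norm_mult)
    hence "b_term N r = 2 / pi * rho_moment N * (Gamma p / r powr p)" by (simp add: b_term_def p_def)
    thus ?thesis by (simp add: powr_minus field_simps)
  qed
  finally show ?thesis by (simp add: p_def)
qed

text \<open>For \<open>c = - d < 0\<close> the constant \<open>7 + d - 10 d\<^sup>2\<close> in the completed square is chosen numerically so that
  the remaining quadratic in \<open>q\<close> has nonpositive discriminant for all \<open>0 \<le> d \<le> 1/2\<close>.\<close>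
lemma quartic_nonneg:
  fixes q c :: real
  assumes q: "q \<ge> 0" and c: "\<bar>c\<bar> \<le> 1 / 2"
  shows "0 \<le> q ^ 4 + 2 * c * q ^ 3 + (4 * c\<^sup>2 - 1) * q\<^sup>2 + 2 * c * q + (1 + c) * (1 - 2 * c)\<^sup>2 / 2"
proof -
  define P where "P = q ^ 4 + 2 * c * q ^ 3 + (4 * c\<^sup>2 - 1) * q\<^sup>2 + 2 * c * q + (1 + c) * (1 - 2 * c)\<^sup>2 / 2"
  have "P \<ge> 0"
  proof (cases "c \<ge> 0")
  case True
  have "4 * P = 4 * q ^ 4 + 8 * c * q ^ 3 + 4 * (4 * c\<^sup>2 - 1) * q\<^sup>2 + 8 * c * q + 2 * (1 + c) * (1 - 2 * c)\<^sup>2"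
    unfolding P_def by (simp add: algebra_simps)
  also have "\<dots> = (2 * q\<^sup>2 - (1 - 2 * c))\<^sup>2 + 8 * c * q * (q - 1)\<^sup>2 + (16 * c\<^sup>2 + 8 * c) * q\<^sup>2 + (1 - 2 * c)\<^sup>2 * (1 + 2 * c)"
    by algebra
  also have "\<dots> \<ge> 0" using q True by (intro add_nonneg_nonneg mult_nonneg_nonneg) simp_all
  finally show ?thesis by simp
next
  case False
  define d where "d = - c"
  have d: "0 \<le> d" "d \<le> 1 / 2" using False c by (auto simp: d_def)
  have cd: "c = - d" by (simp add: d_def)
  define B where "B = 5 * d\<^sup>2 + d + 2"
  define R where "R = 20 * B * q\<^sup>2 - 20 * d * (17 + d - 10 * d\<^sup>2) * q + (50 * (1 - d) * (1 + 2 * d)\<^sup>2 - (7 + d - 10 * d\<^sup>2)\<^sup>2)"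
  have B: "B > 0" unfolding B_def using d by (intro add_nonneg_pos) auto
  have "100 * P = 100 * q ^ 4 + 200 * c * q ^ 3 + 100 * (4 * c\<^sup>2 - 1) * q\<^sup>2 + 200 * c * q + 50 * (1 + c) * (1 - 2 * c)\<^sup>2"
    unfolding P_def by (simp add: algebra_simps)
  also have "\<dots> = (10 * q\<^sup>2 - 10 * d * q - (7 + d - 10 * d\<^sup>2))\<^sup>2 + R"
    unfolding cd R_def B_def by algebra
  finally have eq: "100 * P = (10 * q\<^sup>2 - 10 * d * q - (7 + d - 10 * d\<^sup>2))\<^sup>2 + R" .
  \<comment> \<open>Completing the square: \<open>20 * B\<close> is the leading coefficient of
    \<open>R\<close> in \<open>q\<close>. The part free of \<open>q\<close> contains
    \<open>(1 - 2 * d)\<^sup>2\<close> and vanishes at \<open>d = 1/2\<close>.\<close>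
  have id: "20 * B * R = (20 * B * q - 10 * d * (17 + d - 10 * d\<^sup>2))\<^sup>2
      + (1 - 2 * d)\<^sup>2 * (40 + d * (5620 + 1800 * d - 9500 * d\<^sup>2 - 5000 * d ^ 3))"
    unfolding R_def B_def by algebra
  have "d\<^sup>2 \<le> (1 / 2)\<^sup>2" "d ^ 3 \<le> (1 / 2) ^ 3" using d by (intro power_mono; simp)+
  hence "d\<^sup>2 \<le> 1 / 4" "d ^ 3 \<le> 1 / 8" by (simp_all add: power2_eq_square power3_eq_cube)
  hence "5620 + 1800 * d - 9500 * d\<^sup>2 - 5000 * d ^ 3 \<ge> 0" using d by linarith
  hence "0 \<le> 20 * B * R" unfolding id using d by (intro add_nonneg_nonneg mult_nonneg_nonneg) simp_all
  hence "R \<ge> 0" using B by (simp add: zero_le_mult_iff)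
  moreover have "(10 * q\<^sup>2 - 10 * d * q - (7 + d - 10 * d\<^sup>2))\<^sup>2 \<ge> 0" by simp
  ultimately have "100 * P \<ge> 0" unfolding eq by linarith
  thus ?thesis by simp
qed
  thus ?thesis by (simp add: P_def)
qed

text \<open>With \<open>u = exp (\<i> pi / 3) * z\<close> the product is \<open>1 + u + u^2\<close>,
  whose squared modulus is a quartic in \<open>q\<close> with coefficients in
  \<open>c = cos \<mu>\<close>. The triple angle formula gives
  \<open>cos^2 (\<theta> - \<phi>) = 1 - (1 + c) (1 - 2 c)^2 / 2\<close>, and
  \<open>quartic_nonneg\<close> is exactly the comparison of the two.\<close>

lemma kernel_lower_bound:
  assumes q: "q \<ge> 0" and c: "\<bar>cos (2 * (\<phi> - \<theta>) / 3 + pi / 3)\<bar> \<le> 1 / 2"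
  shows "\<bar>cos (\<theta> - \<phi>)\<bar> \<le> cmod ((1 + of_real q * cis (2 * (\<phi> - \<theta>) / 3)) * (1 + cis (2 * pi / 3) * (of_real q * cis (2 * (\<phi> - \<theta>) / 3))))"
proof -
  define \<mu> where "\<mu> = 2 * (\<phi> - \<theta>) / 3 + pi / 3"
  define c where "c = cos \<mu>"
  define s where "s = sin \<mu>"
  define z where "z = of_real q * cis (2 * (\<phi> - \<theta>) / 3)"
  define u where "u = of_real q * cis \<mu>"
  have s2: "s\<^sup>2 = 1 - c\<^sup>2" by (simp add: s_def c_def sin_squared_eq)
  have "cis (pi / 3) * z = u" by (simp add: z_def u_def \<mu>_def cis_mult add.commute)
  moreover have "1 + cis (2 * pi / 3) = cis (pi / 3)"
    by (simp add: complex_eq_iff cos_60 sin_60 cos_120 sin_120)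
  moreover have "cis (2 * pi / 3) = cis (pi / 3) * cis (pi / 3)" by (simp add: cis_mult)
  moreover have "(1 + z) * (1 + w * z) = 1 + (1 + w) * z + w * z * z" for w :: complex by (simp add: algebra_simps)
  ultimately have 1: "(1 + z) * (1 + cis (2 * pi / 3) * z) = 1 + u + u * u" by (metis mult.assoc mult.commute)
  have "Re (1 + u + u * u) = 1 + q * c + q\<^sup>2 * (c\<^sup>2 - s\<^sup>2)" "Im (1 + u + u * u) = s * (q + 2 * q\<^sup>2 * c)"
    by (simp_all add: u_def c_def s_def power2_eq_square algebra_simps)
  hence "cmod (1 + u + u * u) ^ 2 = (1 + q * c + q\<^sup>2 * (c\<^sup>2 - s\<^sup>2))\<^sup>2 + s\<^sup>2 * (q + 2 * q\<^sup>2 * c)\<^sup>2"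
    by (simp only: cmod_power2 power_mult_distrib)
  also have "\<dots> = 1 + 2 * q * c + (4 * c\<^sup>2 - 1) * q\<^sup>2 + 2 * q ^ 3 * c + q ^ 4"
    unfolding s2 by algebra
  finally have 2: "cmod (1 + u + u * u) ^ 2 = 1 + 2 * q * c + (4 * c\<^sup>2 - 1) * q\<^sup>2 + 2 * q ^ 3 * c + q ^ 4" .
  have "\<theta> - \<phi> = pi / 2 - 3 * \<mu> / 2" by (simp add: \<mu>_def field_simps)
  hence "cos (\<theta> - \<phi>) = sin (3 * \<mu> / 2)" by (simp add: sin_cos_eq)
  moreover have "cos (3 * \<mu>) = 1 - 2 * (sin (3 * \<mu> / 2))\<^sup>2" using cos_double_sin[of "3 * \<mu> / 2"] by simp
  moreover have "cos (3 * \<mu>) = 4 * c ^ 3 - 3 * c" by (simp add: c_def cos_treble_cos)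
  ultimately have "(cos (\<theta> - \<phi>))\<^sup>2 = (1 - 4 * c ^ 3 + 3 * c) / 2" by simp
  also have "\<dots> = 1 - (1 + c) * (1 - 2 * c)\<^sup>2 / 2" by (simp add: power2_eq_square power3_eq_cube field_simps)
  also have "\<dots> \<le> cmod (1 + u + u * u) ^ 2"
    unfolding 2 using quartic_nonneg[OF q, of c] assms(2) by (simp add: c_def \<mu>_def algebra_simps)
  finally have "\<bar>cos (\<theta> - \<phi>)\<bar> ^ 2 \<le> cmod (1 + u + u * u) ^ 2" by simp
  hence "\<bar>cos (\<theta> - \<phi>)\<bar> \<le> cmod (1 + u + u * u)" by (rule power2_le_imp_le) simp
  thus ?thesis using 1 by (simp add: z_def)
qed

text \<open>The two ranges of \<open>\<theta> - \<phi>\<close> are those for which the angle in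
  \<open>kernel_lower_bound\<close> lies between \<open>pi / 3\<close> and \<open>2 pi / 3\<close>
  in absolute value. At the excluded outer ends the secant is infinite.\<close>

definition good_angle :: "real \<Rightarrow> real \<Rightarrow> bool" where
  "good_angle \<theta> \<phi> \<longleftrightarrow> \<bar>\<phi>\<bar> < pi / 2 \<and> (- (pi / 2) < \<theta> - \<phi> \<and> \<theta> - \<phi> \<le> 0 \<or> pi \<le> \<theta> - \<phi> \<and> \<theta> - \<phi> < 3 * pi / 2)"

lemma good_angle_cos:
  assumes "good_angle \<theta> \<phi>"
  shows "cos (\<theta> - \<phi>) \<noteq> 0" "\<bar>cos (2 * (\<phi> - \<theta>) / 3 + pi / 3)\<bar> \<le> 1 / 2"
proof -
  let ?\<mu> = "2 * (\<phi> - \<theta>) / 3 + pi / 3"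
  have *: "\<bar>cos x\<bar> \<le> 1 / 2" if "pi / 3 \<le> x" "x \<le> 2 * pi / 3" for x
    using that cos_monotone_0_pi_le[of "pi / 3" x] cos_monotone_0_pi_le[of x "2 * pi / 3"]
    by (simp add: cos_60 cos_120)
  consider "- (pi / 2) < \<theta> - \<phi>" "\<theta> - \<phi> \<le> 0" | "pi \<le> \<theta> - \<phi>" "\<theta> - \<phi> < 3 * pi / 2"
    using assms by (auto simp: good_angle_def)
  hence "cos (\<theta> - \<phi>) \<noteq> 0 \<and> \<bar>cos ?\<mu>\<bar> \<le> 1 / 2"
  proof cases
    case 1
    thus ?thesis using cos_gt_zero_pi[of "\<theta> - \<phi>"] *[of ?\<mu>] by (simp add: field_simps)
  next
    case 2
    have "cos (\<theta> - \<phi> - pi) > 0" by (rule cos_gt_zero_pi) (use 2 pi_gt_zero in linarith)+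
    moreover have "cos (\<theta> - \<phi> - pi) = - cos (\<theta> - \<phi>)" by (rule cos_minus_pi)
    moreover have "\<bar>cos (- ?\<mu>)\<bar> \<le> 1 / 2" by (rule *) (use 2 in \<open>simp_all add: field_simps\<close>)
    ultimately show ?thesis unfolding cos_minus by auto
  qed
  thus "cos (\<theta> - \<phi>) \<noteq> 0" "\<bar>cos ?\<mu>\<bar> \<le> 1 / 2" by auto
qed

lemma I_interval_good_angle: "\<phi> \<in> I_interval \<theta> \<Longrightarrow> good_angle \<theta> \<phi>"
proof -
  assume a: "\<phi> \<in> I_interval \<theta>"
  have "pi > 0" by simp
  have "3 * pi / 2 = pi + pi / 2" by simp
  thus ?thesis using a \<open>pi > 0\<close> unfolding good_angle_def I_interval_def
    by (simp split: if_splits)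
qed

section \<open>Existence and uniqueness of the angles in the prescribed interval\<close>

lemma ex1_sin_eq:
  fixes h y :: real
  assumes h: "0 < h" "h \<le> pi / 2" "\<bar>y\<bar> < sin h"
  shows "\<exists>!t. - h < t \<and> t < h \<and> sin t = y"
proof
  have y: "-1 \<le> y" "y \<le> 1" using h(3) sin_le_one[of h] by linarith+
  let ?t = "arcsin y"
  have t: "- (pi / 2) \<le> ?t" "?t \<le> pi / 2" "sin ?t = y" using arcsin[OF y] by auto
  have "?t < h"
    using sin_monotone_2pi_le[of h ?t] t h by linarith
  moreover have "- h < ?t"
    using sin_monotone_2pi_le[of ?t "- h"] t h sin_minus[of h] by linarith
  ultimately show "- h < ?t \<and> ?t < h \<and> sin ?t = y" using t by simp
  show "t' = ?t" if "- h < t' \<and> t' < h \<and> sin t' = y" for t'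
  proof (rule sin_inj_pi)
    show "- (pi / 2) \<le> t'" "t' \<le> pi / 2" using that h by linarith+
    show "sin t' = sin ?t" using that t by simp
  qed (use t in auto)
qed

text \<open>In terms of \<open>t = \<theta> - 2 \<phi>\<close> (or \<open>\<pi> - t\<close> when \<open>\<theta> > \<pi>\<close>) the interval is \<open>(- h, h)\<close> with
  \<open>0 < h \<le> \<pi>/2\<close> and \<open>sin h = - sin \<theta>\<close>.\<close>
lemma ex1_I_interval:
  assumes \<theta>: "- pi < \<theta> \<and> \<theta> < 0 \<or> pi < \<theta> \<and> \<theta> < 2 * pi" and c: "\<bar>c\<bar> < 1"
  shows "\<exists>!\<phi>. \<phi> \<in> I_interval \<theta> \<and> sin (\<theta> - 2 * \<phi>) = c * sin \<theta>"
proof -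
  have *: ?thesis if h: "0 < h" "h \<le> pi / 2" "sin h = - sin \<theta>"
    and g: "\<And>t. g (g' t) = t" "\<And>\<phi>. g' (g \<phi>) = \<phi>"
    and I: "\<And>\<phi>. \<phi> \<in> I_interval \<theta> \<longleftrightarrow> - h < g \<phi> \<and> g \<phi> < h"
    and s: "\<And>\<phi>. sin (\<theta> - 2 * \<phi>) = sin (g \<phi>)" for h :: real and g g' :: "real \<Rightarrow> real"
  proof -
    have "sin h > 0" using h pi_gt_zero by (intro sin_gt_zero) linarith+
    hence "\<bar>c * sin \<theta>\<bar> < sin h" unfolding abs_mult using mult_strict_right_mono[OF c, of "\<bar>sin \<theta>\<bar>"] h(3) by simp
    from ex1_sin_eq[OF h(1,2) this] obtain t where
      t: "- h < t \<and> t < h \<and> sin t = c * sin \<theta>" and u: "\<forall>t'. - h < t' \<and> t' < h \<and> sin t' = c * sin \<theta> \<longrightarrow> t' = t"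
      by (auto elim!: ex1E)
    show ?thesis
    proof (rule ex1I[of _ "g' t"])
      show "g' t \<in> I_interval \<theta> \<and> sin (\<theta> - 2 * g' t) = c * sin \<theta>" using t by (simp add: I s g)
      show "\<phi> = g' t" if "\<phi> \<in> I_interval \<theta> \<and> sin (\<theta> - 2 * \<phi>) = c * sin \<theta>" for \<phi>
        using u that I s g(2)[of \<phi>] by metis
    qed
  qed
  consider "3 * pi / 2 \<le> \<theta>" "\<theta> < 2 * pi" | "pi < \<theta>" "\<theta> < 3 * pi / 2"
    | "- pi < \<theta>" "\<theta> \<le> - (pi / 2)" | "- (pi / 2) < \<theta>" "\<theta> < 0"
    using \<theta> by linarith
  thus ?thesis
  proof cases
    case 1
    show ?thesis
    proof (rule *[of "2 * pi - \<theta>" "\<lambda>\<phi>. pi - \<theta> + 2 * \<phi>" "\<lambda>t. (t - pi + \<theta>) / 2"])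
      show "sin (2 * pi - \<theta>) = - sin \<theta>" by (simp add: sin_diff)
      show "sin (\<theta> - 2 * \<phi>) = sin (pi - \<theta> + 2 * \<phi>)" for \<phi> using sin_pi_minus[of "\<theta> - 2 * \<phi>"] by (simp add: algebra_simps)
      show "\<phi> \<in> I_interval \<theta> \<longleftrightarrow> - (2 * pi - \<theta>) < pi - \<theta> + 2 * \<phi> \<and> pi - \<theta> + 2 * \<phi> < 2 * pi - \<theta>" for \<phi>
        using 1 by (auto simp: I_interval_def)
    qed (use 1 in \<open>auto simp: field_simps\<close>)
  next
    case 2
    show ?thesis
    proof (rule *[of "\<theta> - pi" "\<lambda>\<phi>. pi - \<theta> + 2 * \<phi>" "\<lambda>t. (t - pi + \<theta>) / 2"])
      show "sin (\<theta> - pi) = - sin \<theta>" by (simp add: sin_diff)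
      show "sin (\<theta> - 2 * \<phi>) = sin (pi - \<theta> + 2 * \<phi>)" for \<phi> using sin_pi_minus[of "\<theta> - 2 * \<phi>"] by (simp add: algebra_simps)
      show "\<phi> \<in> I_interval \<theta> \<longleftrightarrow> - (\<theta> - pi) < pi - \<theta> + 2 * \<phi> \<and> pi - \<theta> + 2 * \<phi> < \<theta> - pi" for \<phi>
        using 2 by (auto simp: I_interval_def)
    qed (use 2 in \<open>auto simp: field_simps\<close>)
  next
    case 3
    show ?thesis
    proof (rule *[of "pi + \<theta>" "\<lambda>\<phi>. \<theta> - 2 * \<phi>" "\<lambda>t. (\<theta> - t) / 2"])
      show "sin (pi + \<theta>) = - sin \<theta>" by (simp add: sin_add)
      show "\<phi> \<in> I_interval \<theta> \<longleftrightarrow> - (pi + \<theta>) < \<theta> - 2 * \<phi> \<and> \<theta> - 2 * \<phi> < pi + \<theta>" for \<phi>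
        using 3 by (auto simp: I_interval_def)
    qed (use 3 in \<open>auto simp: field_simps\<close>)
  next
    case 4
    show ?thesis
    proof (rule *[of "- \<theta>" "\<lambda>\<phi>. \<theta> - 2 * \<phi>" "\<lambda>t. (\<theta> - t) / 2"])
      show "\<phi> \<in> I_interval \<theta> \<longleftrightarrow> - (- \<theta>) < \<theta> - 2 * \<phi> \<and> \<theta> - 2 * \<phi> < - \<theta>" for \<phi>
        using 4 by (auto simp: I_interval_def)
    qed (use 4 in \<open>auto simp: field_simps\<close>)
  qed
qed

text \<open>With \<open>x = 1/p\<close> this is \<open>2 x\<close> times the difference of the logarithms of the two sides of
  \<open>sqrt_powr_le\<close>.\<close>
lemma x_minus_ln_ge:
  fixes x :: real
  assumes "x \<ge> 0"
  shows "0 \<le> x - x * ln (1 + x) + x * ln (1 + x / 2) - ln (1 + x)"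
proof -
  define g where "g = (\<lambda>x::real. x - x * ln (1 + x) + x * ln (1 + x / 2) - ln (1 + x))"
  have "g 0 \<le> g x"
  proof (rule DERIV_nonneg_imp_nondecreasing[OF assms])
    fix t :: real assume t: "0 \<le> t" "t \<le> x"
    have 1: "((\<lambda>x. ln (1 + x)) has_real_derivative 1 / (1 + t)) (at t)"
      using t by (auto intro!: derivative_eq_intros)
    have 2: "((\<lambda>x. ln (1 + x / 2)) has_real_derivative 1 / 2 / (1 + t / 2)) (at t)"
      using t by (auto intro!: derivative_eq_intros)
    let ?D = "(1 - (1 * ln (1 + t) + 1 / (1 + t) * t)) + (1 * ln (1 + t / 2) + 1 / 2 / (1 + t / 2) * t) - 1 / (1 + t)"
    have "(g has_real_derivative ?D) (at t)"
      unfolding g_def by (intro DERIV_add DERIV_diff DERIV_mult DERIV_ident 1 2)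
    moreover have "?D = t / (2 + t) - (ln (1 + t) - ln (1 + t / 2))"
    proof -
      have "1 / (1 + t) * t + 1 / (1 + t) = 1" "1 / 2 / (1 + t / 2) * t = t / (2 + t)"
        using t by (simp_all add: field_simps)
      thus ?thesis by linarith
    qed
    moreover have "ln (1 + t) - ln (1 + t / 2) = ln (1 + t / (2 + t))"
    proof -
      have "(1 + t) / (1 + t / 2) = 1 + t / (2 + t)" using t by (simp add: field_simps)
      thus ?thesis using t ln_div[of "1 + t" "1 + t / 2"] by simp
    qed
    moreover have "ln (1 + t / (2 + t)) \<le> t / (2 + t)" using t by (intro ln_add_one_self_le_self) auto
    ultimately show "\<exists>y. DERIV g t :> y \<and> y \<ge> 0" by auto
  qed
  thus ?thesis by (simp add: g_def)
qed

text \<open>Squared, this is \<open>(p + 1) * (1 + 1/p)^p \<le> e * (p + 1/2)\<close>; its logarithm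
  is \<open>x_minus_ln_ge\<close> at \<open>1/p\<close>, multiplied by \<open>p\<close>.\<close>

lemma sqrt_powr_le:
  fixes p :: real
  assumes p: "p > 0"
  shows "sqrt (p + 1) / sqrt (p / (p + 1)) powr p \<le> sqrt (exp 1 * (p + 1 / 2))"
proof -
  have "p * 0 \<le> p * (1 / p - 1 / p * ln (1 + 1 / p) + 1 / p * ln (1 + 1 / p / 2) - ln (1 + 1 / p))"
    using x_minus_ln_ge[of "1 / p"] p by (intro mult_left_mono) auto
  also have "\<dots> = 1 - ln (1 + 1 / p) + ln (1 + 1 / p / 2) - p * ln (1 + 1 / p)"
    using p by (simp add: field_simps)
  also have "1 + 1 / p = (p + 1) / p" using p by (simp add: field_simps)
  also have "1 + 1 / p / 2 = (p + 1 / 2) / p" using p by (simp add: field_simps)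
  finally have main: "0 \<le> 1 - ln (p + 1) + ln (p + 1 / 2) - p * (ln (p + 1) - ln p)"
    using p by (simp add: ln_div)
  have "ln (sqrt (p + 1) / sqrt (p / (p + 1)) powr p) = ln (p + 1) / 2 - p * ((ln p - ln (p + 1)) / 2)"
    using p by (simp add: ln_div ln_sqrt ln_powr)
  also have "\<dots> \<le> (1 + ln (p + 1 / 2)) / 2" using main by (simp add: field_simps)
  also have "\<dots> = ln (sqrt (exp 1 * (p + 1 / 2)))" using p by (simp add: ln_sqrt ln_mult)
  finally show ?thesis using p by (subst (asm) ln_le_cancel_iff) auto
qed

text \<open>At \<open>\<theta> = - pi / 2\<close> and \<open>\<phi> = - \<alpha>\<close> the
  quantity is \<open>1 / (sin \<alpha> * cos \<alpha> powr p)\<close>, minimal for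
  \<open>tan^2 \<alpha> = 1/p\<close>, that is \<open>sin \<alpha> = 1 / sqrt (p + 1)\<close>. The
  same angle works while \<open>\<theta> \<le> - \<alpha>\<close>, because then
  \<open>cos (\<theta> + \<alpha>) \<ge> sin \<alpha>\<close>; nearer to 0 the choice
  \<open>\<phi> = \<theta>\<close> makes the secant 1 and has
  \<open>cos \<theta> \<ge> cos \<alpha>\<close>.\<close>

lemma ex_good_angle_left:
  assumes p: "p > 0" and \<theta>: "- (pi / 2) \<le> \<theta>" "\<theta> < 0"
  shows "\<exists>\<phi>. - (pi / 2) < \<phi> \<and> \<phi> < 0 \<and> - (pi / 2) < \<theta> - \<phi> \<and> \<theta> - \<phi> \<le> 0 \<and>
    \<bar>1 / cos (\<theta> - \<phi>)\<bar> / cos \<phi> powr p \<le> sqrt (exp 1 * (p + 1 / 2))"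
proof -
  define s where "s = 1 / sqrt (p + 1)"
  define k where "k = sqrt (p / (p + 1))"
  define \<alpha> where "\<alpha> = arcsin s"
  have s: "0 < s" "s < 1" using p by (auto simp: s_def)
  have k: "k > 0" using p by (simp add: k_def)
  have b: "- (pi / 2) < \<alpha>" "\<alpha> < pi / 2" using arcsin_lt_bounded[of s] s by (auto simp: \<alpha>_def)
  have sa: "sin \<alpha> = s" using s by (simp add: \<alpha>_def)
  have ca: "cos \<alpha> = k"
  proof -
    have "1 - s\<^sup>2 = p / (p + 1)" using p by (simp add: s_def power_divide field_simps)
    thus ?thesis using s by (simp add: \<alpha>_def cos_arcsin k_def)
  qed
  have a0: "\<alpha> > 0" using sa s b sin_monotone_2pi_le[of \<alpha> 0] by force
  have S: "sqrt (p + 1) / k powr p \<le> sqrt (exp 1 * (p + 1 / 2))" unfolding k_def by (rule sqrt_powr_le[OF p])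
  show ?thesis
  proof (cases "\<theta> \<le> - \<alpha>")
    case True
    have "cos (pi / 2 - \<alpha>) \<le> cos (- \<alpha> - \<theta>)" using True \<theta> b a0 by (intro cos_monotone_0_pi_le) linarith+
    moreover have "cos (pi / 2 - \<alpha>) = s" using sa by (simp add: sin_cos_eq)
    moreover have "cos (- \<alpha> - \<theta>) = cos (\<theta> - - \<alpha>)" using cos_minus[of "\<theta> - - \<alpha>"] by (simp add: minus_diff_commute)
    ultimately have cs: "s \<le> cos (\<theta> - - \<alpha>)" by simp
    have "\<bar>1 / cos (\<theta> - - \<alpha>)\<bar> / cos (- \<alpha>) powr p \<le> sqrt (p + 1) / k powr p"
    proof -
      have "1 / cos (\<theta> - - \<alpha>) \<le> 1 / s" using cs s by (intro divide_left_mono mult_pos_pos) linarith+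
      moreover have "0 < 1 / cos (\<theta> - - \<alpha>)" using cs s by simp
      ultimately have "\<bar>1 / cos (\<theta> - - \<alpha>)\<bar> \<le> 1 / s" by linarith
      hence "\<bar>1 / cos (\<theta> - - \<alpha>)\<bar> \<le> sqrt (p + 1)" by (simp add: s_def)
      thus ?thesis unfolding cos_minus ca by (intro divide_right_mono) simp_all
    qed
    thus ?thesis using True \<theta> b a0 S by (intro exI[of _ "- \<alpha>"]) auto
  next
    case False
    have "cos \<alpha> \<le> cos (- \<theta>)" using False \<theta> b by (intro cos_monotone_0_pi_le) linarith+
    hence kc: "k \<le> cos \<theta>" using ca by simp
    have "1 / cos \<theta> powr p \<le> sqrt (p + 1) / k powr p"
      using kc k p by (intro frac_le powr_mono2) auto
    hence "\<bar>1 / cos (\<theta> - \<theta>)\<bar> / cos \<theta> powr p \<le> sqrt (exp 1 * (p + 1 / 2))" using S by simp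
    thus ?thesis using False \<theta> b by (intro exI[of _ \<theta>]) auto
  qed
qed

lemma ex_good_angle:
  assumes p: "p > 0" and \<theta>: "pi < \<theta> \<and> \<theta> \<le> 3 * pi / 2 \<or> - (pi / 2) \<le> \<theta> \<and> \<theta> < 0"
  shows "\<exists>\<phi>. good_angle \<theta> \<phi> \<and> \<bar>1 / cos (\<theta> - \<phi>)\<bar> / cos \<phi> powr p \<le> sqrt (exp 1 * (p + 1 / 2))"
  using \<theta>
proof
  assume "- (pi / 2) \<le> \<theta> \<and> \<theta> < 0"
  then obtain \<phi> where "- (pi / 2) < \<phi> \<and> \<phi> < 0 \<and> - (pi / 2) < \<theta> - \<phi> \<and> \<theta> - \<phi> \<le> 0 \<and>
    \<bar>1 / cos (\<theta> - \<phi>)\<bar> / cos \<phi> powr p \<le> sqrt (exp 1 * (p + 1 / 2))"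
    using ex_good_angle_left[OF p] by blast
  thus ?thesis by (intro exI[of _ \<phi>]) (auto simp: good_angle_def)
next
  \<comment> \<open>Reflection \<open>\<theta> \<mapsto> pi - \<theta>\<close>,
    \<open>\<phi> \<mapsto> - \<phi>\<close>, which only changes the sign of
    \<open>cos (\<theta> - \<phi>)\<close>.\<close>
  assume "pi < \<theta> \<and> \<theta> \<le> 3 * pi / 2"
  hence t: "- (pi / 2) \<le> pi - \<theta>" "pi - \<theta> < 0" by linarith+
  obtain \<phi> where f: "- (pi / 2) < \<phi>" "\<phi> < 0" "- (pi / 2) < pi - \<theta> - \<phi>" "pi - \<theta> - \<phi> \<le> 0"
    "\<bar>1 / cos (pi - \<theta> - \<phi>)\<bar> / cos \<phi> powr p \<le> sqrt (exp 1 * (p + 1 / 2))"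
    using ex_good_angle_left[OF p t] by blast
  have "\<theta> - - \<phi> = pi - (pi - \<theta> - \<phi>)" by simp
  hence "cos (\<theta> - - \<phi>) = - cos (pi - \<theta> - \<phi>)" by (metis cos_pi_minus)
  hence "\<bar>1 / cos (\<theta> - - \<phi>)\<bar> = \<bar>1 / cos (pi - \<theta> - \<phi>)\<bar>" by simp
  moreover have "good_angle \<theta> (- \<phi>)" unfolding good_angle_def using f by auto
  ultimately show ?thesis using f(5) by (intro exI[of _ "- \<phi>"]) (simp only: cos_minus)
qed

section \<open>Assembling the bounds for the remainder\<close>

lemma good_angle_imp_angle_admissible: "good_angle \<theta> \<phi> \<Longrightarrow> angle_admissible (log_point r \<theta>) \<phi>"
  unfolding good_angle_def angle_admissible_def log_point_def using pi_gt_zero by auto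

lemma combined_remainder_bound_good_angle:
  assumes "r > 0" and g: "good_angle \<theta> \<phi>"
  shows "cmod (combined_remainder N (log_point r \<theta>) (\<i> * of_real \<phi>)) \<le> \<bar>1 / cos (\<theta> - \<phi>)\<bar> / cos \<phi> powr ((2 * real N + 1) / 3) * (b_term N r / 3)"
proof -
  have "cmod (combined_remainder N (log_point r \<theta>) (\<i> * of_real \<phi>)) \<le> 1 / \<bar>cos (\<theta> - \<phi>)\<bar> / cos \<phi> powr ((2 * real N + 1) / 3) * (b_term N r / 3)"
  proof (rule combined_remainder_bound[OF assms(1) good_angle_imp_angle_admissible[OF g]])
    show "\<bar>cos (\<theta> - \<phi>)\<bar> > 0" using good_angle_cos(1)[OF g] by simp
    show "\<bar>cos (\<theta> - \<phi>)\<bar> \<le> cmod ((1 + of_real q * cis (2 * (\<phi> - \<theta>) / 3)) * (1 + omega * (of_real q * cis (2 * (\<phi> - \<theta>) / 3))))"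
      if "q \<ge> 0" for q
      unfolding omega_def by (rule kernel_lower_bound[OF that good_angle_cos(2)[OF g]])
  qed
  thus ?thesis by simp
qed

lemma b_term_nonneg: "0 \<le> b_term N r / (sqrt 3 * pi)"
proof -
  have "Gamma ((2 * real N + 1) / 3) > 0" by (intro Gamma_real_pos) simp
  thus ?thesis unfolding b_term_def by simp
qed

lemma R_H_bound:
  fixes N :: nat
  assumes r: "r > 0" and \<theta>: "sin \<theta> \<noteq> 0" and g: "good_angle \<theta> \<phi>1" "good_angle \<theta> \<phi>2"
  defines "X1 \<equiv> \<bar>1 / cos (\<theta> - \<phi>1)\<bar> / cos \<phi>1 powr ((2 * real N + 1) / 3) * (b_term N r / (sqrt 3 * pi))"
    and "X2 \<equiv> \<bar>1 / cos (\<theta> - \<phi>2)\<bar> / cos \<phi>2 powr ((2 * real N + 3) / 3) * (b_term (N + 1) r / (sqrt 3 * pi))"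
  shows "cmod (R_H N (log_point r \<theta>)) \<le> cmod (1 + phase N) / sqrt 3 * X1 + cmod (omega + phase N) / sqrt 3 * X2"
proof -
  let ?z = "log_point r \<theta>"
  define G1 where "G1 = combined_remainder N ?z (\<i> * of_real \<phi>1)"
  define G2 where "G2 = combined_remainder (Suc N) ?z (\<i> * of_real \<phi>2)"
  \<comment> \<open>\<open>sin \<theta> \<noteq> 0\<close> keeps the order off the real axis and so
    away from the integers excluded in \<open>R_H_representation\<close>.\<close>
  have nint: "exp ?z \<notin> \<int>"
  proof
    assume "exp ?z \<in> \<int>"
    then obtain n :: int where "exp ?z = of_int n" by (auto elim: Ints_cases)
    hence "Im (exp ?z) = 0" by simp
    thus False using r \<theta> by (simp add: Im_exp log_point_def)
  qed
  have s3: "b / 3 = sqrt 3 * pi * (b / (sqrt 3 * pi)) / 3" for b :: real by simp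
  have "cmod G1 \<le> \<bar>1 / cos (\<theta> - \<phi>1)\<bar> / cos \<phi>1 powr ((2 * real N + 1) / 3) * (b_term N r / 3)"
    unfolding G1_def by (rule combined_remainder_bound_good_angle[OF r g(1)])
  also have "\<dots> = sqrt 3 * pi / 3 * X1" unfolding X1_def by simp
  finally have 1: "cmod G1 \<le> sqrt 3 * pi / 3 * X1" .
  have e: "2 * real (Suc N) + 1 = 2 * real N + 3" by simp
  have "cmod G2 \<le> \<bar>1 / cos (\<theta> - \<phi>2)\<bar> / cos \<phi>2 powr ((2 * real N + 3) / 3) * (b_term (Suc N) r / 3)"
    unfolding G2_def e[symmetric] by (rule combined_remainder_bound_good_angle[OF r g(2)])
  also have "\<dots> = sqrt 3 * pi / 3 * X2" unfolding X2_def by simp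
  finally have 2: "cmod G2 \<le> sqrt 3 * pi / 3 * X2" .
  have "cmod (R_H N ?z) = cmod ((1 + phase N) * G1 - (omega + phase N) * G2) / pi"
    unfolding R_H_representation[OF g[THEN good_angle_imp_angle_admissible] nint] G1_def G2_def by (simp add: norm_divide norm_mult)
  also have "\<dots> \<le> (cmod (1 + phase N) * (sqrt 3 * pi / 3 * X1) + cmod (omega + phase N) * (sqrt 3 * pi / 3 * X2)) / pi"
  proof (rule divide_right_mono)
    have "cmod ((1 + phase N) * G1 - (omega + phase N) * G2) \<le> cmod (1 + phase N) * cmod G1 + cmod (omega + phase N) * cmod G2"
      using norm_triangle_ineq4[of "(1 + phase N) * G1" "(omega + phase N) * G2"] by (simp only: norm_mult)
    also have "\<dots> \<le> cmod (1 + phase N) * (sqrt 3 * pi / 3 * X1) + cmod (omega + phase N) * (sqrt 3 * pi / 3 * X2)"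
      by (intro add_mono mult_left_mono 1 2 norm_ge_zero)
    finally show "cmod ((1 + phase N) * G1 - (omega + phase N) * G2)
      \<le> cmod (1 + phase N) * (sqrt 3 * pi / 3 * X1) + cmod (omega + phase N) * (sqrt 3 * pi / 3 * X2)" .
  qed simp
  also have "\<dots> = cmod (1 + phase N) * (sqrt 3 / 3) * X1 + cmod (omega + phase N) * (sqrt 3 / 3) * X2"
    by (simp add: field_simps)
  also have "sqrt 3 / 3 = 1 / sqrt (3::real)" by (simp add: field_simps)
  finally show ?thesis by simp
qed

lemma R_H_bound_cases:
  assumes r: "r > 0" and \<theta>: "sin \<theta> \<noteq> 0" and g: "good_angle \<theta> \<phi>1" "good_angle \<theta> \<phi>2"
  shows "N mod 3 = 0 \<Longrightarrow> cmod (R_H N (log_point r \<theta>))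
      \<le> \<bar>1 / cos (\<theta> - \<phi>1)\<bar> / cos \<phi>1 powr ((2 * real N + 1) / 3) * (b_term N r / (sqrt 3 * pi))
        + \<bar>1 / cos (\<theta> - \<phi>2)\<bar> / cos \<phi>2 powr ((2 * real N + 3) / 3) * (b_term (N + 1) r / (sqrt 3 * pi))"
    and "N mod 3 = 1 \<Longrightarrow> cmod (R_H N (log_point r \<theta>))
      \<le> \<bar>1 / cos (\<theta> - \<phi>2)\<bar> / cos \<phi>2 powr ((2 * real N + 3) / 3) * (b_term (N + 1) r / (sqrt 3 * pi))"
    and "N mod 3 = 2 \<Longrightarrow> cmod (R_H N (log_point r \<theta>))
      \<le> \<bar>1 / cos (\<theta> - \<phi>1)\<bar> / cos \<phi>1 powr ((2 * real N + 1) / 3) * (b_term N r / (sqrt 3 * pi))"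
  using R_H_bound[OF r \<theta> g, of N] norm_one_plus_phase[of N] by simp_all

text \<open>Origin of \<open>5/2\<close>: with \<open>p = (2N + 1) / 3\<close> the bound
  \<open>p + 1/2\<close> equals \<open>(2N + 5/2) / 3\<close>. For \<open>N + 1\<close> in place of
  \<open>N\<close> it becomes \<open>9/2\<close>.\<close>

lemma ex_good_angle_sqrt_bound:
  assumes \<theta>: "pi < \<theta> \<and> \<theta> \<le> 3 * pi / 2 \<or> - (pi / 2) \<le> \<theta> \<and> \<theta> < 0"
  obtains \<phi> where "good_angle \<theta> \<phi>"
    "\<bar>1 / cos (\<theta> - \<phi>)\<bar> / cos \<phi> powr ((2 * real N + 1) / 3) \<le> sqrt (exp 1 / 3 * (2 * real N + 5 / 2))"
proof -
  have "(2 * real N + 1) / 3 > 0" by simp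
  from ex_good_angle[OF this \<theta>] obtain \<phi> where "good_angle \<theta> \<phi>"
    "\<bar>1 / cos (\<theta> - \<phi>)\<bar> / cos \<phi> powr ((2 * real N + 1) / 3) \<le> sqrt (exp 1 * ((2 * real N + 1) / 3 + 1 / 2))" by blast
  moreover have "exp 1 * ((2 * real N + 1) / 3 + 1 / 2) = exp 1 / 3 * (2 * real N + 5 / 2)" by (simp add: field_simps)
  ultimately show thesis using that by simp
qed

theorem mainTheorem7:
  fixes N :: nat and r \<theta> :: real
  assumes "0 < r"
  shows
    "(- pi < \<theta> \<and> \<theta> < 0 \<or> pi < \<theta> \<and> \<theta> < 2 * pi \<longrightarrow>
        (\<exists>!\<phi>. \<phi> \<in> I_interval \<theta> \<and> sin (\<theta> - 2 * \<phi>) = real N / (real N + 3) * sin \<theta>) \<and>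
        (\<exists>!\<phi>. \<phi> \<in> I_interval \<theta> \<and> sin (\<theta> - 2 * \<phi>) = (real N - 1) / (real N + 2) * sin \<theta>) \<and>
        (\<forall>\<phi>1 \<phi>2.
           \<phi>1 \<in> I_interval \<theta> \<and> sin (\<theta> - 2 * \<phi>1) = real N / (real N + 3) * sin \<theta> \<and>
           \<phi>2 \<in> I_interval \<theta> \<and> sin (\<theta> - 2 * \<phi>2) = (real N - 1) / (real N + 2) * sin \<theta> \<longrightarrow>
           (N mod 3 = 0 \<longrightarrow>
              cmod (R_H N (log_point r \<theta>)) \<le> \<bar>1 / cos (\<theta> - \<phi>1)\<bar> / cos \<phi>1 powr ((2 * real N + 1) / 3)
                    * (b_term N r / (sqrt 3 * pi))
                + \<bar>1 / cos (\<theta> - \<phi>2)\<bar> / cos \<phi>2 powr ((2 * real N + 3) / 3)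
                    * (b_term (N + 1) r / (sqrt 3 * pi))) \<and>
           (N mod 3 = 1 \<longrightarrow>
              cmod (R_H N (log_point r \<theta>)) \<le> \<bar>1 / cos (\<theta> - \<phi>1)\<bar> / cos \<phi>1 powr ((2 * real N + 3) / 3)
                    * (b_term (N + 1) r / (sqrt 3 * pi))) \<and>
           (N mod 3 = 2 \<longrightarrow>
              cmod (R_H N (log_point r \<theta>)) \<le> \<bar>1 / cos (\<theta> - \<phi>2)\<bar> / cos \<phi>2 powr ((2 * real N + 1) / 3)
                    * (b_term N r / (sqrt 3 * pi)))))
     \<and>
     (pi < \<theta> \<and> \<theta> \<le> 3 * pi / 2 \<or> - (pi / 2) \<le> \<theta> \<and> \<theta> < 0 \<longrightarrow>
        (N mod 3 = 0 \<and> 3 \<le> N \<longrightarrow>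
           cmod (R_H N (log_point r \<theta>)) \<le> sqrt (exp 1 / 3 * (2 * real N + 5 / 2)) * (b_term N r / (sqrt 3 * pi))
             + sqrt (exp 1 / 3 * (2 * real N + 9 / 2)) * (b_term (N + 1) r / (sqrt 3 * pi))) \<and>
        (N = 0 \<longrightarrow>
           cmod (R_H N (log_point r \<theta>)) \<le> sqrt (exp 1 / 3 * (2 * real N + 9 / 2)) * (b_term N r / (sqrt 3 * pi))
             + sqrt (exp 1 / 3 * (2 * real N + 9 / 2)) * (b_term (N + 1) r / (sqrt 3 * pi))) \<and>
        (N mod 3 = 1 \<longrightarrow>
           cmod (R_H N (log_point r \<theta>)) \<le> sqrt (exp 1 / 3 * (2 * real N + 9 / 2)) * (b_term (N + 1) r / (sqrt 3 * pi))) \<and>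
        (N mod 3 = 2 \<longrightarrow>
           cmod (R_H N (log_point r \<theta>)) \<le> sqrt (exp 1 / 3 * (2 * real N + 5 / 2)) * (b_term N r / (sqrt 3 * pi))))"
    (is "(?H1 \<longrightarrow> ?E1 \<and> ?E2 \<and> ?B) \<and> (?H2 \<longrightarrow> ?C)")
proof
  have sin_nz: "sin \<theta> \<noteq> 0" if "- pi < \<theta> \<and> \<theta> < 0 \<or> pi < \<theta> \<and> \<theta> < 2 * pi"
    using that
  proof
    assume "- pi < \<theta> \<and> \<theta> < 0"
    thus ?thesis using sin_gt_zero[of "- \<theta>"] by simp
  next
    assume "pi < \<theta> \<and> \<theta> < 2 * pi"
    thus ?thesis using sin_lt_zero[of \<theta>] by simp
  qed
  show "?H1 \<longrightarrow> ?E1 \<and> ?E2 \<and> ?B"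
  proof
    assume H: ?H1
    have ?E1 by (rule ex1_I_interval[OF H]) simp
    moreover have ?E2 by (rule ex1_I_interval[OF H]) (simp add: abs_if field_simps)
    moreover have ?B
    proof (intro allI impI conjI; elim conjE)
      fix \<phi>1 \<phi>2
      assume m: "\<phi>1 \<in> I_interval \<theta>" "\<phi>2 \<in> I_interval \<theta>"
      note b = R_H_bound_cases[OF assms sin_nz[OF H]]
      note g = m[THEN I_interval_good_angle]
      show "cmod (R_H N (log_point r \<theta>)) \<le> \<bar>1 / cos (\<theta> - \<phi>1)\<bar> / cos \<phi>1 powr ((2 * real N + 1) / 3)
                    * (b_term N r / (sqrt 3 * pi))
                + \<bar>1 / cos (\<theta> - \<phi>2)\<bar> / cos \<phi>2 powr ((2 * real N + 3) / 3)
                    * (b_term (N + 1) r / (sqrt 3 * pi))" if "N mod 3 = 0"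
        by (rule b(1)[OF g that])
      \<comment> \<open>The surviving term has the exponent of the second summand but is evaluated
        at the first angle; so \<open>\<phi>1\<close> is supplied in both places. For
        \<open>N mod 3 = 2\<close> the roles are exchanged.\<close>
      show "cmod (R_H N (log_point r \<theta>)) \<le> \<bar>1 / cos (\<theta> - \<phi>1)\<bar> / cos \<phi>1 powr ((2 * real N + 3) / 3)
                    * (b_term (N + 1) r / (sqrt 3 * pi))" if "N mod 3 = 1"
        by (rule b(2)[OF g(1) g(1) that])
      show "cmod (R_H N (log_point r \<theta>)) \<le> \<bar>1 / cos (\<theta> - \<phi>2)\<bar> / cos \<phi>2 powr ((2 * real N + 1) / 3)
                    * (b_term N r / (sqrt 3 * pi))" if "N mod 3 = 2"
        by (rule b(3)[OF g(2) g(2) that])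
    qed
    ultimately show "?E1 \<and> ?E2 \<and> ?B" by blast
  qed
  show "?H2 \<longrightarrow> ?C"
  proof
    assume H: ?H2
    hence "- pi < \<theta> \<and> \<theta> < 0 \<or> pi < \<theta> \<and> \<theta> < 2 * pi" using pi_gt_zero by linarith
    note nz = sin_nz[OF this]
    obtain \<phi>1 where g1: "good_angle \<theta> \<phi>1"
      and c1: "\<bar>1 / cos (\<theta> - \<phi>1)\<bar> / cos \<phi>1 powr ((2 * real N + 1) / 3) \<le> sqrt (exp 1 / 3 * (2 * real N + 5 / 2))"
      by (rule ex_good_angle_sqrt_bound[OF H])
    obtain \<phi>2 where g2: "good_angle \<theta> \<phi>2"
      and "\<bar>1 / cos (\<theta> - \<phi>2)\<bar> / cos \<phi>2 powr ((2 * real (N + 1) + 1) / 3) \<le> sqrt (exp 1 / 3 * (2 * real (N + 1) + 5 / 2))"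
      by (rule ex_good_angle_sqrt_bound[OF H])
    moreover have "2 * real (N + 1) + 1 = 2 * real N + 3" "2 * real (N + 1) + 5 / 2 = 2 * real N + 9 / 2" by simp_all
    ultimately have c2: "\<bar>1 / cos (\<theta> - \<phi>2)\<bar> / cos \<phi>2 powr ((2 * real N + 3) / 3) \<le> sqrt (exp 1 / 3 * (2 * real N + 9 / 2))"
      by (simp only:)
    note b = R_H_bound_cases[OF assms nz g1 g2]
    note x1 = mult_right_mono[OF c1 b_term_nonneg[of N r]] and x2 = mult_right_mono[OF c2 b_term_nonneg[of "N + 1" r]]
    \<comment> \<open>For \<open>N = 0\<close> the theorem states the larger constant
      \<open>9/2\<close> in the first summand, so the bound with \<open>5/2\<close> is
      relaxed.\<close>
    have le: "sqrt (exp 1 / 3 * (2 * real N + 5 / 2)) * (b_term N r / (sqrt 3 * pi)) \<le> sqrt (exp 1 / 3 * (2 * real N + 9 / 2)) * (b_term N r / (sqrt 3 * pi))"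
      by (intro mult_right_mono[OF _ b_term_nonneg] real_sqrt_le_mono mult_left_mono) simp_all
    show ?C
    proof (intro conjI impI)
      show "cmod (R_H N (log_point r \<theta>)) \<le> sqrt (exp 1 / 3 * (2 * real N + 5 / 2)) * (b_term N r / (sqrt 3 * pi))
             + sqrt (exp 1 / 3 * (2 * real N + 9 / 2)) * (b_term (N + 1) r / (sqrt 3 * pi))" if "N mod 3 = 0 \<and> 3 \<le> N"
        by (rule order_trans[OF b(1) add_mono[OF x1 x2]]) (use that in simp)
      show "cmod (R_H N (log_point r \<theta>)) \<le> sqrt (exp 1 / 3 * (2 * real N + 9 / 2)) * (b_term N r / (sqrt 3 * pi))
             + sqrt (exp 1 / 3 * (2 * real N + 9 / 2)) * (b_term (N + 1) r / (sqrt 3 * pi))" if "N = 0"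
        by (rule order_trans[OF b(1) add_mono[OF order_trans[OF x1 le] x2]]) (use that in simp)
      show "cmod (R_H N (log_point r \<theta>)) \<le> sqrt (exp 1 / 3 * (2 * real N + 9 / 2)) * (b_term (N + 1) r / (sqrt 3 * pi))" if "N mod 3 = 1"
        by (rule order_trans[OF b(2)[OF that] x2])
      show "cmod (R_H N (log_point r \<theta>)) \<le> sqrt (exp 1 / 3 * (2 * real N + 5 / 2)) * (b_term N r / (sqrt 3 * pi))" if "N mod 3 = 2"
        by (rule order_trans[OF b(3)[OF that] x1])
    qed
  qed
qed

end
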